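(* Let $n\ge 0$ and $a,b,c,d\ge 0$ be integers with $a+2b+2c+3d=4n$. Then $$f_{a,b,c,d}=\sum_{\substack{\beta\in p_5(b),\ \gamma\in p_4(c),\ \delta\in p_4(d)\\ 0\le l\le\beta_2+\beta_3\\ 0\le m\le\gamma_1+\gamma_2}}\binom{b}{\beta}\binom{c}{\gamma}\binom{d}{\delta}\binom{\beta_2+\beta_3}{l}\binom{\gamma_1+\gamma_2}{m}\;\omega_{(i_1,i_2,i_3,i_4)},$$ where $$\begin{aligned} i_1&=1+\sum_{j\ne1}\delta_j+\gamma_1+\gamma_4+\beta_1,\\ i_2&=2+\sum_{j\ne2}\delta_j+\gamma_2+\gamma_4+\beta_2+2\beta_5,\\ i_3&=3+\sum_{j\ne3}\delta_j+\gamma_3+\beta_3+l+m,\\ i_4&=4+\sum_{j\ne4}\delta_j+\gamma_1+\gamma_2+\gamma_3+\beta_2+2\beta_4+\beta_3-l-m,\end{aligned}$$ and $\omega_{(i_1,i_2,i_3,i_4)}=0$ if $i_p>n+4$ for some $p\in\{1,2,3,4\}$.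
   Context: For integers $h\ge1,m\ge 0$: $p_h(m)=\{\mu=(\mu_1,\dots,\mu_h)\in\mathbb N^h:\sum_i\mu_i=m\}$ (with $0\in\mathbb N$), and $\binom{m}{\mu}=\frac{m!}{\mu_1!\cdots\mu_h!}$. $G(4,n+4)$ is the Grassmannian of $4$-dimensional subspaces of $\mathbb C^{n+4}$, $\sigma_i$ is the $i$-th Chern class of its universal quotient bundle of rank $n$ ($\sigma_0=1$, $\sigma_i=0$ for $i<0$ or $i>n$), and for an increasing sequence $I=(i_1<i_2<i_3<i_4)$ of positive integers $\sigma_I=\det(\sigma_{i_s-r})_{1\le r,s\le 4}$. Here $\int_{G(4,n+4)}$ is the degree of the $0$-dimensional part of a cycle class. The number $f_{a,b,c,d}$ is $$f_{a,b,c,d}=\int_{G(4,n+4)}\sigma_1^a\,\sigma_2^b\,\sigma_{(1,2,4,5)}^c\,\sigma_{(1,3,4,5)}^d\cap[G(4,n+4)].$$ It is the number, counted with (intersection) multiplicities, of projectively non-equivalent rational space curves of degree $n+3$ (i.e. base point free linear series $g^3_{n+3}$ on $\mathbb P^1$) having $a$ stalls, $b$ hyperstalls, $c$ flexes and $d$ cusps at $a+b+c+d$ prescribed distinct points of $\mathbb P^1$. Here a point $P$ gives a stall, hyperstall, flex, cusp if the ramification sequence of the linear series at $P$ is $(1,2,3,5)$, $(1,2,3,6)$, $(1,2,4,5)$, $(1,3,4,5)$ respectively; the ramification sequence of $V\subset H^0(\mathbb P^1,\mathcal O(n+3))$, $\dim V=4$, at $P$ is $i_1<i_2<i_3<i_4$,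 where $i_j-1$ are the orders of vanishing at $P$ of nonzero sections in $V$. For $1\le i_1<i_2<i_3<i_4\le n+4$, with $w=\sum_{s=1}^{4}(i_s-s)$, $\omega_{(i_1,\dots,i_4)}=\int_{G(4,n+4)}\sigma_1^{4n-w}\sigma_{(i_1,\dots,i_4)}\cap[G(4,n+4)]$ is the degree, in the Plücker embedding, of the corresponding Schubert variety (of codimension $w$). For a sequence of distinct integers in $\{1,\dots,n+4\}$ obtained from an increasing sequence $I$ by a permutation $\tau$, $\omega_{I^\tau}:=\mathrm{sgn}(\tau)\,\omega_I$; $\omega$ is $0$ if the sequence has two equal entries. *)

theory Defs
  imports
    "HOL-Analysis.Analysis"
    "Jordan_Normal_Form.Schur_Decomposition"
    "Jordan_Normal_Form.DL_Rank"
begin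

no_notation Finite_Cartesian_Product.vec_nth (infixl "$" 90)
hide_const (open) Finite_Cartesian_Product.mat Finite_Cartesian_Product.vec
  Determinants.det

section \<open>Even-degree exterior forms\<close>

text \<open>
  The commutative algebra of complex exterior forms of even degree in the generators
  dx 0, dx 1, dx 2, .... A form is given by its coefficients: the value at a finite set
  K = {k1 < ... < kr} is the coefficient of dx k1 \<and> ... \<and> dx kr.
\<close>

typedef even_form = "{f :: nat set \<Rightarrow> complex. \<forall>K. infinite K \<or> odd (card K) \<longrightarrow> f K = 0}"
  morphisms form_coeff Abs_even_form
  by (rule exI[of _ "\<lambda>_. 0"]) auto

setup_lifting type_definition_even_form

lemma even_form_eqI:
  assumes "\<And>K. finite K \<Longrightarrow> even (card K) \<Longrightarrow> form_coeff \<alpha> K = form_coeff \<beta> K"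
  shows "\<alpha> = \<beta>"
  using assms by transfer (metis ext)

text \<open>dx I \<and> dx J = shuffle_sign I J * dx (I \<union> J) for disjoint finite I, J.\<close>
definition shuffle_sign :: "nat set \<Rightarrow> nat set \<Rightarrow> complex" where
  "shuffle_sign I J = (- 1) ^ card {(i, j). i \<in> I \<and> j \<in> J \<and> j < i}"

lemma finite_inversions: "finite I \<Longrightarrow> finite J \<Longrightarrow> finite {(i, j). i \<in> I \<and> j \<in> J \<and> j < (i::nat)}"
  by (rule finite_subset[of _ "I \<times> J"]) auto

lemma shuffle_sign_Un_left:
  assumes "finite I" "finite J" "finite L" "I \<inter> J = {}"
  shows "shuffle_sign (I \<union> J) L = shuffle_sign I L * shuffle_sign J L"
proof -
  have "{(i, j). i \<in> I \<union> J \<and> j \<in> L \<and> j < i} =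
      {(i, j). i \<in> I \<and> j \<in> L \<and> j < i} \<union> {(i, j). i \<in> J \<and> j \<in> L \<and> j < i}"
    by auto
  then have "card {(i, j). i \<in> I \<union> J \<and> j \<in> L \<and> j < i} =
      card {(i, j). i \<in> I \<and> j \<in> L \<and> j < i} + card {(i, j). i \<in> J \<and> j \<in> L \<and> j < i}"
    using assms by (simp only:) (intro card_Un_disjoint finite_inversions, auto)
  then show ?thesis by (simp add: shuffle_sign_def power_add)
qed

lemma shuffle_sign_Un_right:
  assumes "finite I" "finite J" "finite L" "J \<inter> L = {}"
  shows "shuffle_sign I (J \<union> L) = shuffle_sign I J * shuffle_sign I L"
proof -
  have "{(i, j). i \<in> I \<and> j \<in> J \<union> L \<and> j < i} =
      {(i, j). i \<in> I \<and> j \<in> J \<and> j < i} \<union> {(i, j). i \<in> I \<and> j \<in> L \<and> j < i}"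
    by auto
  then have "card {(i, j). i \<in> I \<and> j \<in> J \<union> L \<and> j < i} =
      card {(i, j). i \<in> I \<and> j \<in> J \<and> j < i} + card {(i, j). i \<in> I \<and> j \<in> L \<and> j < i}"
    using assms by (simp only:) (intro card_Un_disjoint finite_inversions, auto)
  then show ?thesis by (simp add: shuffle_sign_def power_add)
qed

lemma shuffle_sign_commute:
  assumes "finite I" "finite J" "I \<inter> J = {}" "even (card I)"
  shows "shuffle_sign I J = shuffle_sign J I"
proof -
  let ?A = "{(i, j). i \<in> I \<and> j \<in> J \<and> j < i}" and ?B = "{(i, j). i \<in> I \<and> j \<in> J \<and> i < j}"
  let ?C = "{(j, i). j \<in> J \<and> i \<in> I \<and> i < j}"
  have fin: "finite ?A" "finite ?B"
    by (rule finite_subset[of _ "I \<times> J"]; use assms in auto)+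
  have "?A \<union> ?B = I \<times> J"
    using assms(3) by (auto simp: disjoint_iff) (metis nat_neq_iff)
  moreover have "card (?A \<union> ?B) = card ?A + card ?B"
    using fin by (intro card_Un_disjoint) auto
  ultimately have "card ?A + card ?B = card I * card J"
    by (simp add: card_cartesian_product)
  moreover have "card ?B = card ?C"
    by (rule bij_betw_same_card[of prod.swap]) (auto simp: bij_betw_def inj_on_def image_def)
  ultimately have "even (card ?A + card ?C)" using assms(4) by simp
  then show ?thesis by (auto simp: shuffle_sign_def uminus_power_if)
qed

instantiation even_form :: comm_ring_1
begin

lift_definition zero_even_form :: even_form is "\<lambda>_. 0" by simp
lift_definition one_even_form :: even_form is "\<lambda>K. if K = {} then 1 else 0" by auto
lift_definition plus_even_form :: "even_form \<Rightarrow> even_form \<Rightarrow> even_form" is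
  "\<lambda>f g K. f K + g K" by simp
lift_definition uminus_even_form :: "even_form \<Rightarrow> even_form" is "\<lambda>f K. - f K" by simp
lift_definition minus_even_form :: "even_form \<Rightarrow> even_form \<Rightarrow> even_form" is
  "\<lambda>f g K. f K - g K" by simp
lift_definition times_even_form :: "even_form \<Rightarrow> even_form \<Rightarrow> even_form" is
  "\<lambda>f g K. \<Sum>I \<in> Pow K. shuffle_sign I (K - I) * f I * g (K - I)"
proof -
  fix f g :: "nat set \<Rightarrow> complex" and K :: "nat set"
  assume f: "\<And>K. infinite K \<or> odd (card K) \<Longrightarrow> f K = 0"
    and g: "\<And>K. infinite K \<or> odd (card K) \<Longrightarrow> g K = 0" and K: "infinite K \<or> odd (card K)"
  show "(\<Sum>I \<in> Pow K. shuffle_sign I (K - I) * f I * g (K - I)) = 0"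
  proof (cases "finite K")
    case True
    have "f I = 0 \<or> g (K - I) = 0" if "I \<subseteq> K" for I
    proof -
      have "card K = card I + card (K - I)"
        using True that by (metis card_Diff_subset card_mono finite_subset le_add_diff_inverse)
      then have "odd (card I) \<or> odd (card (K - I))" using K True by (metis even_add)
      then show ?thesis using f g by blast
    qed
    then show ?thesis by (intro sum.neutral) auto
  qed simp
qed

instance
proof
  fix \<alpha> \<beta> \<gamma> :: even_form
  show "\<alpha> * \<beta> * \<gamma> = \<alpha> * (\<beta> * \<gamma>)"
  proof (rule even_form_eqI)
    fix K :: "nat set" assume K: "finite K"
    let ?a = "form_coeff \<alpha>" and ?b = "form_coeff \<beta>" and ?c = "form_coeff \<gamma>" and ?s = shuffle_sign
    have "form_coeff (\<alpha> * \<beta> * \<gamma>) K =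
        (\<Sum>(J, I) \<in> (SIGMA J : Pow K. Pow J).
          ?s J (K - J) * (?s I (J - I) * ?a I * ?b (J - I)) * ?c (K - J))"
      using K by (simp add: times_even_form.rep_eq sum_distrib_left sum_distrib_right
          sum.Sigma finite_subset)
    also have "\<dots> = (\<Sum>(I, M) \<in> (SIGMA I : Pow K. Pow (K - I)).
          ?s I (K - I) * ?a I * (?s M (K - I - M) * ?b M * ?c (K - I - M)))"
    proof (rule sum.reindex_bij_witness[where i = "\<lambda>(I, M). (I \<union> M, I)" and j = "\<lambda>(J, I). (I, J - I)"],
        goal_cases)
      case (5 p)
      obtain J I where p: "p = (J, I)" by force
      with 5 have IJ: "I \<subseteq> J" "J \<subseteq> K" by auto
      then have fin: "finite I" "finite (J - I)" "finite (K - J)"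
        using K by (auto intro: finite_subset)
      have "?s J (K - J) = ?s I (K - J) * ?s (J - I) (K - J)"
        using shuffle_sign_Un_left[OF fin] IJ by (simp add: Un_absorb1)
      moreover have "(J - I) \<union> (K - J) = K - I" using IJ by auto
      then have "?s I (K - I) = ?s I (J - I) * ?s I (K - J)"
        using shuffle_sign_Un_right[OF fin] by auto
      moreover have "K - I - (J - I) = K - J" using IJ by auto
      ultimately show ?case by (simp add: p mult_ac)
    qed auto
    also have "\<dots> = form_coeff (\<alpha> * (\<beta> * \<gamma>)) K"
      using K by (simp add: times_even_form.rep_eq sum_distrib_left sum.Sigma)
    finally show "form_coeff (\<alpha> * \<beta> * \<gamma>) K = form_coeff (\<alpha> * (\<beta> * \<gamma>)) K" .
  qed
  show "\<alpha> * \<beta> = \<beta> * \<alpha>"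
  proof (rule even_form_eqI)
    fix K :: "nat set" assume K: "finite K"
    show "form_coeff (\<alpha> * \<beta>) K = form_coeff (\<beta> * \<alpha>) K"
      unfolding times_even_form.rep_eq
    proof (rule sum.reindex_bij_witness[where i = "\<lambda>I. K - I" and j = "\<lambda>I. K - I"], goal_cases)
      case (5 I)
      then have fin: "finite I" "finite (K - I)" "I \<inter> (K - I) = {}" and [simp]: "K - (K - I) = I"
        using K by (auto intro: finite_subset)
      show ?case
      proof (cases "even (card I)")
        case True
        then show ?thesis using shuffle_sign_commute[OF fin] by (simp add: mult_ac)
      next
        case False
        then have "form_coeff \<alpha> I = 0" by transfer auto
        then show ?thesis by simp
      qed
    qed auto
  qed
  show "1 * \<alpha> = \<alpha>"
  proof (rule even_form_eqI)
    fix K :: "nat set" assume K: "finite K"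
    have "form_coeff (1 * \<alpha>) K =
        (\<Sum>I \<in> Pow K. if I = {} then shuffle_sign {} K * form_coeff \<alpha> K else 0)"
      unfolding times_even_form.rep_eq one_even_form.rep_eq by (intro sum.cong) auto
    also have "\<dots> = form_coeff \<alpha> K" using K by (simp add: shuffle_sign_def)
    finally show "form_coeff (1 * \<alpha>) K = form_coeff \<alpha> K" .
  qed
  show "(\<alpha> + \<beta>) * \<gamma> = \<alpha> * \<gamma> + \<beta> * \<gamma>"
    by (rule even_form_eqI)
      (simp add: times_even_form.rep_eq plus_even_form.rep_eq algebra_simps sum.distrib)
  show "\<alpha> + \<beta> + \<gamma> = \<alpha> + (\<beta> + \<gamma>)" "\<alpha> + \<beta> = \<beta> + \<alpha>" "0 + \<alpha> = \<alpha>" "- \<alpha> + \<alpha> = 0" "\<alpha> - \<beta> = \<alpha> + - \<beta>"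
    by (transfer; simp add: fun_eq_iff)+
  show "(0::even_form) \<noteq> 1"
    by transfer (metis zero_neq_one)
qed

end

lift_definition form_scale :: "complex \<Rightarrow> even_form \<Rightarrow> even_form" is "\<lambda>c f K. c * f K" by simp

text \<open>The wedge product of the 1-forms \<Sum>i. a i * dx i and \<Sum>i. b i * dx i.\<close>
lift_definition wedge1 :: "(nat \<Rightarrow> complex) \<Rightarrow> (nat \<Rightarrow> complex) \<Rightarrow> even_form" is
  "\<lambda>a b K. if card K = 2 then a (Min K) * b (Max K) - a (Max K) * b (Min K) else 0"
  by (metis card.infinite even_numeral numeral_neq_zero zero_neq_numeral)

lift_definition homogeneous_part :: "nat \<Rightarrow> even_form \<Rightarrow> even_form" is
  "\<lambda>k f K. if card K = k then f K else 0" by auto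


section \<open>The Grassmannian and its tautological bundles\<close>

definition grassmannian :: "nat \<Rightarrow> nat \<Rightarrow> complex vec set set" where
  "grassmannian k N = {V. subspace class_ring V (module_vec TYPE(complex) N) \<and>
     vectorspace.dim class_ring (module_vec TYPE(complex) N\<lparr>carrier := V\<rparr>) = k}"

text \<open>Orthogonal projector of C^N onto V, for the standard Hermitian inner product.\<close>
definition orth_proj :: "nat \<Rightarrow> complex vec set \<Rightarrow> complex mat" where
  "orth_proj N V = (THE P. P \<in> carrier_mat N N \<and> P * P = P \<and> mat_adjoint P = P \<and>
     (\<lambda>x. P *\<^sub>v x) ` carrier_vec N = V)"

text \<open>
  Hermitian vector bundles over the Grassmannian are given as sub-bundles of the trivial
  bundle C^N, i.e. by fields of orthogonal projectors. The universal subbundle S has fibre V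
  over V; the universal quotient bundle Q has fibre C^N/V, which, with the quotient
  metric, is the orthogonal complement of V.
\<close>
definition universal_quotient :: "nat \<Rightarrow> complex vec set \<Rightarrow> complex mat" where
  "universal_quotient N V = 1\<^sub>m N - orth_proj N V"

text \<open>
  The affine chart of G(4,n+4) of the graphs of linear maps Z from C^4 to C^n. Its real
  coordinates u 0, ..., u (8n-1) are the real and imaginary parts of the entries of Z,
  each real part followed by its imaginary part (the complex orientation).
\<close>
definition chart_mat :: "nat \<Rightarrow> (nat \<Rightarrow> real) \<Rightarrow> complex mat" where
  "chart_mat n u = mat n 4 (\<lambda>(i, j). Complex (u (2 * (4 * i + j))) (u (2 * (4 * i + j) + 1)))"

definition chart :: "nat \<Rightarrow> (nat \<Rightarrow> real) \<Rightarrow> complex vec set" where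
  "chart n u = {x @\<^sub>v (chart_mat n u *\<^sub>v x) | x. x \<in> carrier_vec 4}"

lemma mat_col_unit:
  fixes A :: "complex mat"
  assumes "A \<in> carrier_mat nr nc" "i < nc"
  shows "A *\<^sub>v unit_vec nc i = col A i"
  by (rule eq_vecI) (use assms in auto)

lemma chart_inj: "inj_on (chart n) ({..<8 * n} \<rightarrow>\<^sub>E UNIV)"
proof (rule inj_onI)
  fix u v assume u: "u \<in> {..<8 * n} \<rightarrow>\<^sub>E UNIV" and v: "v \<in> {..<8 * n} \<rightarrow>\<^sub>E UNIV"
    and eq: "chart n u = chart n v"
  have Z: "chart_mat n w \<in> carrier_mat n 4" for w by (simp add: chart_mat_def)
  have mult: "chart_mat n u *\<^sub>v x = chart_mat n v *\<^sub>v x" if x: "x \<in> carrier_vec 4" for x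
  proof -
    have "x @\<^sub>v (chart_mat n u *\<^sub>v x) \<in> chart n u" using x by (auto simp: chart_def)
    then obtain y where "y \<in> carrier_vec 4" "x @\<^sub>v (chart_mat n u *\<^sub>v x) = y @\<^sub>v (chart_mat n v *\<^sub>v y)"
      unfolding eq by (auto simp: chart_def)
    then show ?thesis using append_vec_eq[OF x] by metis
  qed
  have entry: "chart_mat n u $$ (i, j) = chart_mat n v $$ (i, j)" if "i < n" "j < 4" for i j
  proof -
    have "col (chart_mat n u) j = col (chart_mat n v) j"
      using mult[of "unit_vec 4 j"] mat_col_unit[OF Z] that by simp
    then have "col (chart_mat n u) j $ i = col (chart_mat n v) j $ i" by simp
    then show ?thesis using that by (simp add: chart_mat_def)
  qed
  have "u k = v k" if k: "k < 8 * n" for k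
  proof -
    define i j where "i = k div 8" and "j = k div 2 mod 4"
    have ij: "i < n" "j < 4" using k by (auto simp: i_def j_def)
    have "k div 8 = k div 2 div 4" using div_mult2_eq[of k 2 4] by simp
    then have "4 * i + j = k div 2" by (simp add: i_def j_def)
    moreover have "k = 2 * (k div 2) \<or> k = 2 * (k div 2) + 1" by arith
    ultimately have "k = 2 * (4 * i + j) \<or> k = 2 * (4 * i + j) + 1" by (simp only:)
    then show ?thesis
      using entry[OF ij] ij by (elim disjE) (simp_all add: chart_mat_def)
  qed
  then show "u = v" using u v by (intro PiE_ext) auto
qed

lemma chart_eq_range:
  "chart n u = (\<lambda>x. (1\<^sub>m 4 @\<^sub>r chart_mat n u) *\<^sub>v x) ` carrier_vec 4"
proof -
  have "(1\<^sub>m 4 @\<^sub>r chart_mat n u) *\<^sub>v x = x @\<^sub>v (chart_mat n u *\<^sub>v x)" if "x \<in> carrier_vec 4" for x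
    using mat_mult_append[of "1\<^sub>m 4" 4 4 "chart_mat n u" n x] that by (simp add: chart_mat_def)
  then show ?thesis by (auto simp: chart_def)
qed

lemma chart_in_grassmannian: "chart n u \<in> grassmannian 4 (n + 4)"
proof -
  interpret vec_space "TYPE(complex)" "n + 4" .
  let ?Z = "chart_mat n u" and ?W = "1\<^sub>m 4 @\<^sub>r chart_mat n u"
  have Z: "?Z \<in> carrier_mat n 4" by (simp add: chart_mat_def)
  have W: "?W \<in> carrier_mat (n + 4) 4"
    using carrier_append_rows[OF one_carrier_mat Z] by (simp add: add.commute)
  have W_mult: "?W *\<^sub>v x = x @\<^sub>v (?Z *\<^sub>v x)" if "x \<in> carrier_vec 4" for x
    using mat_mult_append[OF one_carrier_mat Z that] that by simp
  have inj: "x = y" if "x \<in> carrier_vec 4" "y \<in> carrier_vec 4" "?W *\<^sub>v x = ?W *\<^sub>v y" for x y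
    using that by (simp add: W_mult append_vec_eq)
  have dist: "distinct (cols ?W)"
  proof (unfold distinct_conv_nth, intro allI impI)
    fix i j assume ij: "i < length (cols ?W)" "j < length (cols ?W)" "i \<noteq> j"
    then have "i < 4" "j < 4" using W by auto
    then have "?W *\<^sub>v unit_vec 4 i \<noteq> ?W *\<^sub>v unit_vec 4 j"
      using inj[of "unit_vec 4 i" "unit_vec 4 j"] ij(3) by auto
    then show "cols ?W ! i \<noteq> cols ?W ! j"
      using W \<open>i < 4\<close> \<open>j < 4\<close> mat_col_unit[OF W] by simp
  qed
  have "lin_indpt (set (cols ?W))"
  proof (rule ccontr)
    assume "\<not> lin_indpt (set (cols ?W))"
    then obtain v where v: "v \<in> carrier_vec 4" "v \<noteq> 0\<^sub>v 4" "?W *\<^sub>v v = 0\<^sub>v (n + 4)"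
      using lin_depE[OF W _ dist] by blast
    moreover have "?W *\<^sub>v 0\<^sub>v 4 = 0\<^sub>v (n + 4)" using W by auto
    ultimately show False using inj[of v "0\<^sub>v 4"] by simp
  qed
  then have "rank ?W = 4" using lin_indpt_full_rank[OF W dist] by blast
  moreover have "span (set (cols ?W)) = chart n u"
    using col_space_eq[OF W] W unfolding col_space_def chart_eq_range by auto
  moreover have "subspace class_ring (span (set (cols ?W))) V"
    by (rule span_is_subspace) (use W cols_dim[of ?W] in auto)
  ultimately show ?thesis unfolding grassmannian_def rank_def by auto
qed


section \<open>Chern forms and integration\<close>

definition partial_deriv :: "nat \<Rightarrow> ((nat \<Rightarrow> real) \<Rightarrow> complex) \<Rightarrow> (nat \<Rightarrow> real) \<Rightarrow> complex" where
  "partial_deriv i g u = vector_derivative (\<lambda>t. g (u(i := t))) (at (u i))"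

definition d_entry :: "((nat \<Rightarrow> real) \<Rightarrow> complex mat) \<Rightarrow> nat \<Rightarrow> nat \<Rightarrow> (nat \<Rightarrow> real) \<Rightarrow> nat \<Rightarrow> complex" where
  "d_entry R p q u = (\<lambda>i. partial_deriv i (\<lambda>v. R v $$ (p, q)) u)"

text \<open>
  Curvature of the connection s \<mapsto> R ds on the image of the projector field R. Since R dR R = 0,
  it is the matrix R dR \<and> dR R. For the universal quotient bundle this connection
  is the Chern connection of the quotient metric.
\<close>
definition curvature :: "nat \<Rightarrow> ((nat \<Rightarrow> real) \<Rightarrow> complex mat) \<Rightarrow> (nat \<Rightarrow> real) \<Rightarrow> even_form mat" where
  "curvature N R u = mat N N (\<lambda>(k, l). \<Sum>p<N. \<Sum>q<N. \<Sum>r<N.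
     form_scale (R u $$ (k, p) * R u $$ (r, l)) (wedge1 (d_entry R p q u) (d_entry R q r u)))"

text \<open>
  Chern-Weil: the total Chern form det(1 + (i/2pi) F). The determinant is taken over all of
  C^N; on the complement of the bundle F vanishes, so this is the determinant on the bundle.
\<close>
definition total_chern_form :: "nat \<Rightarrow> ((nat \<Rightarrow> real) \<Rightarrow> complex mat) \<Rightarrow> (nat \<Rightarrow> real) \<Rightarrow> even_form" where
  "total_chern_form N R u =
     det (1\<^sub>m N + map_mat (form_scale (\<i> / (2 * complex_of_real pi))) (curvature N R u))"

definition chern_form ::
    "nat \<Rightarrow> (complex vec set \<Rightarrow> complex mat) \<Rightarrow> nat \<Rightarrow> (nat \<Rightarrow> real) \<Rightarrow> even_form" where
  "chern_form n E i u =
     homogeneous_part (2 * i) (total_chern_form (n + 4) (\<lambda>v. E (chart n v)) u)"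

text \<open>
  Integral over G(4,n+4) of the component of top degree 8n of a form; the complement of the
  chart is a proper subvariety, hence a null set. On polynomials in Chern forms it is the degree of the 0-dimensional
  part of the corresponding polynomial in Chern classes, capped with [G(4,n+4)].
\<close>
definition grassmannian_integral :: "nat \<Rightarrow> ((nat \<Rightarrow> real) \<Rightarrow> even_form) \<Rightarrow> complex" where
  "grassmannian_integral n \<omega> =
     (LINT u | (\<Pi>\<^sub>M i \<in> {..<8 * n}. lborel). form_coeff (\<omega> u) {..<8 * n})"


section \<open>Schubert classes and their degrees\<close>

definition sigma :: "nat \<Rightarrow> int \<Rightarrow> (nat \<Rightarrow> real) \<Rightarrow> even_form" where
  "sigma n i u = (if i < 0 \<or> i > int n then 0 else if i = 0 then 1
     else chern_form n (universal_quotient (n + 4)) (nat i) u)"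

definition sigma_seq :: "nat \<Rightarrow> nat list \<Rightarrow> (nat \<Rightarrow> real) \<Rightarrow> even_form" where
  "sigma_seq n I u = det (mat 4 4 (\<lambda>(s, r). sigma n (int (I ! s) - int (r + 1)) u))"

definition f_number :: "nat \<Rightarrow> nat \<Rightarrow> nat \<Rightarrow> nat \<Rightarrow> nat \<Rightarrow> complex" where
  "f_number n a b c d = grassmannian_integral n (\<lambda>u.
     sigma n 1 u ^ a * sigma n 2 u ^ b * sigma_seq n [1, 2, 4, 5] u ^ c * sigma_seq n [1, 3, 4, 5] u ^ d)"

definition schubert_degree :: "nat \<Rightarrow> nat list \<Rightarrow> complex" where
  "schubert_degree n I = (let w = (\<Sum>s<4. I ! s - (s + 1)) in
     grassmannian_integral n (\<lambda>u. sigma n 1 u ^ (4 * n - w) * sigma_seq n I u))"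

text \<open>Alternating extension to arbitrary sequences of length 4; 0 if an entry exceeds n + 4.\<close>
definition omega :: "nat \<Rightarrow> nat list \<Rightarrow> complex" where
  "omega n J = (if distinct J \<and> set J \<subseteq> {1..n + 4}
     then of_int (sign (THE \<tau>. \<tau> permutes {..<4} \<and> J = permute_list \<tau> (sort J)))
       * schubert_degree n (sort J)
     else 0)"

definition weak_compositions :: "nat \<Rightarrow> nat \<Rightarrow> (nat \<Rightarrow> nat) set" where
  "weak_compositions h m = {\<mu> \<in> {1..h} \<rightarrow>\<^sub>E UNIV. (\<Sum>i = 1..h. \<mu> i) = m}"

definition multinomial :: "nat \<Rightarrow> nat \<Rightarrow> (nat \<Rightarrow> nat) \<Rightarrow> nat" where
  "multinomial h m \<mu> = fact m div (\<Prod>i = 1..h. fact (\<mu> i))"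

end

theory Submission
  imports Defs "HOL-Library.Poly_Mapping"
begin

text \<open>
  The identity is a Pieri-type calculation in the ring of Chern forms. The quotient bundle has
  curvature \<open>B \<and> C\<close> with \<open>B\<close>, \<open>C\<close> matrices of 1-forms of sizes \<open>n \<times> 4\<close> and \<open>4 \<times> n\<close>. Since
  1-forms anticommute, \<open>det (1 + B \<and> C)\<close> and \<open>det (1 + C \<and> B)\<close> are inverse to each other; the second
  has degree at most 4 in the curvature, so \<open>\<sigma>\<close> satisfies pointwise a linear recurrence of order 4.
  Hence raising the index of a row of \<open>\<sigma>\<^sub>I\<close> is multiplication by a fixed \<open>4 \<times> 4\<close> matrix, and the
  elementary symmetric polynomials in the four raising operators act on \<open>\<sigma>\<^sub>I\<close> as multiplication by
  \<open>\<sigma>\<^sub>1\<close>, \<open>\<sigma>\<^bsub>(1,2,4,5)\<^esub>\<close> and \<open>\<sigma>\<^bsub>(1,3,4,5)\<^esub>\<close>; expanding multinomially gives the formula.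

  The integrals may be added without proving integrability: every form that occurs is a polynomial
  with constant coefficients in the same \<open>8n\<close> moving 1-forms, so all the top degree parts are
  constant multiples of a single density.
\<close>

section \<open>Wedge products of 1-forms\<close>

text \<open>Two obstacles shape the proof. The second obstacle is a count: the projector onto the
  quotient bundle acts on C^(n+4), so its curvature has factors of sizes (n+4) x 4 and 4 x (n+4),
  that is 8n + 32 one-forms, while the single-density argument needs exactly as many as the top
  degree 8n. Passing to the 4 x 4 determinant and back removes the surplus: there the left factor
  becomes the conjugate differential of the frame (1; Z), whose upper block is constant. The
  asymmetry of the final formula comes from \<open>sigma n 2\<close>, a complete and not an
  elementary symmetric polynomial. Its part divisible by X1 is X1 (X1 + X2 + X3 + X4), traded for X1
  times a genuine factor \<open>sigma n 1\<close>; hence \<beta> 1 occurs only in the first index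
  and in the exponent of \<open>sigma n 1\<close>.\<close>

lemma shuffle_sign_singletons: "shuffle_sign {i} {j} = (if j < i then - 1 else 1)"
proof -
  have "{(k, l). k \<in> {i} \<and> l \<in> {j} \<and> l < k} = (if j < i then {(i, j)} else {})" by auto
  then show ?thesis by (simp add: shuffle_sign_def)
qed

lemma shuffle_sign_pairs:
  assumes "i \<noteq> j" "k \<noteq> l"
  shows "shuffle_sign {i, j} {k, l} =
    shuffle_sign {i} {k} * shuffle_sign {i} {l} * shuffle_sign {j} {k} * shuffle_sign {j} {l}"
  using assms shuffle_sign_Un_left[of "{i}" "{j}" "{k, l}"]
    shuffle_sign_Un_right[of "{i}" "{k}" "{l}"] shuffle_sign_Un_right[of "{j}" "{k}" "{l}"]
  by (simp add: insert_commute)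

lemma card_4_sorted:
  fixes K :: "nat set"
  assumes "card K = 4"
  obtains w x y z where "K = {w, x, y, z}" "w < x" "x < y" "y < z"
proof -
  have fin: "finite K" using assms card.infinite by fastforce
  have len: "length (sorted_list_of_set K) = 4" using assms by simp
  then obtain w x y z where l: "sorted_list_of_set K = [w, x, y, z]"
    by (auto simp: eval_nat_numeral length_Suc_conv simp del: sorted_list_of_set.length_sorted_key_list_of_set)
  have "K = {w, x, y, z}" using set_sorted_list_of_set[OF fin] l by simp
  moreover have "sorted_wrt (<) [w, x, y, z]" using strict_sorted_list_of_set[of K] l by simp
  ultimately show thesis using that by simp
qed

text \<open>Only the six 2-subsets can carry a coefficient of the first factor; the signs are those
  of the (2,2)-shuffles.\<close>

lemma times_coeff_4:
  assumes "w < x" "x < y" "y < z"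
    and \<alpha>: "\<And>K. card K \<noteq> 2 \<Longrightarrow> form_coeff \<alpha> K = 0"
  shows "form_coeff (\<alpha> * \<beta>) {w, x, y, z} =
    form_coeff \<alpha> {w, x} * form_coeff \<beta> {y, z} - form_coeff \<alpha> {w, y} * form_coeff \<beta> {x, z}
    + form_coeff \<alpha> {w, z} * form_coeff \<beta> {x, y} + form_coeff \<alpha> {x, y} * form_coeff \<beta> {w, z}
    - form_coeff \<alpha> {x, z} * form_coeff \<beta> {w, y} + form_coeff \<alpha> {y, z} * form_coeff \<beta> {w, x}"
proof -
  let ?K = "{w, x, y, z}" and ?S = "{{w, x}, {w, y}, {w, z}, {x, y}, {x, z}, {y, z}}"
  let ?t = "\<lambda>I. shuffle_sign I (?K - I) * form_coeff \<alpha> I * form_coeff \<beta> (?K - I)"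
  have sum6: "sum f ?S = f {w, x} + f {w, y} + f {w, z} + f {x, y} + f {x, z} + f {y, z}"
    for f :: "nat set \<Rightarrow> complex"
    using assms(1-3) by (simp add: doubleton_eq_iff add.assoc)
  have mem: "I \<in> ?S" if I: "I \<subseteq> ?K" "card I = 2" for I
  proof -
    obtain p q where pq: "I = {p, q}" "p \<noteq> q" using I(2) by (auto simp: card_2_iff)
    then have "p = w \<or> p = x \<or> p = y \<or> p = z" "q = w \<or> q = x \<or> q = y \<or> q = z"
      using I(1) by auto
    then show ?thesis unfolding pq(1) using pq(2)
      by (elim disjE; hypsubst; simp only: insert_iff doubleton_eq_iff simp_thms)
  qed
  have "form_coeff (\<alpha> * \<beta>) ?K = sum ?t (Pow ?K)" by (simp add: times_even_form.rep_eq)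
  also have "\<dots> = sum ?t ?S"
  proof (rule sum.mono_neutral_right)
    show "\<forall>I\<in>Pow ?K - ?S. ?t I = 0"
    proof
      fix I assume I: "I \<in> Pow ?K - ?S"
      have "card I \<noteq> 2" using mem[of I] DiffD1[OF I] DiffD2[OF I] by (metis PowD)
      then show "?t I = 0" by (simp add: \<alpha>)
    qed
  qed auto
  also have "\<dots> = ?t {w, x} + ?t {w, y} + ?t {w, z} + ?t {x, y} + ?t {x, z} + ?t {y, z}"
    by (rule sum6)
  finally have *: "form_coeff (\<alpha> * \<beta>) ?K =
    ?t {w, x} + ?t {w, y} + ?t {w, z} + ?t {x, y} + ?t {x, z} + ?t {y, z}" .
  have diff: "?K - {w, x} = {y, z}" "?K - {w, y} = {x, z}" "?K - {w, z} = {x, y}"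
    "?K - {x, y} = {w, z}" "?K - {x, z} = {w, y}" "?K - {y, z} = {w, x}"
    using assms(1-3) by auto
  show ?thesis
    unfolding * diff using assms(1-3) by (simp add: shuffle_sign_pairs shuffle_sign_singletons)
qed

lemma wedge1_coeff:
  "i < j \<Longrightarrow> form_coeff (wedge1 a b) {i, j} = a i * b j - a j * b i"
  by (simp add: wedge1.rep_eq)

lemma wedge1_coeff_eq_0: "card K \<noteq> 2 \<Longrightarrow> form_coeff (wedge1 a b) K = 0"
  by (simp add: wedge1.rep_eq)

lemma wedge1_swap: "wedge1 a b = - wedge1 b a"
  by transfer (auto simp: fun_eq_iff)

text \<open>Moving \<open>b\<close> past the two factors \<open>c\<close> and \<open>d\<close> costs no sign.\<close>
lemma wedge1_rotate: "wedge1 b c * wedge1 d e = wedge1 c d * wedge1 b e"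
proof (rule even_form_eqI)
  fix K :: "nat set" assume K: "finite K"
  show "form_coeff (wedge1 b c * wedge1 d e) K = form_coeff (wedge1 c d * wedge1 b e) K"
  proof (cases "card K = 4")
    case True
    then obtain w x y z where "K = {w, x, y, z}" "w < x" "x < y" "y < z" by (rule card_4_sorted)
    then show ?thesis
      by (simp add: times_coeff_4 wedge1_coeff_eq_0 wedge1_coeff algebra_simps)
  next
    case False
    have "form_coeff (wedge1 p q * wedge1 r s) K = 0" for p q r s
      unfolding times_even_form.rep_eq
    proof (intro sum.neutral ballI)
      fix I assume I: "I \<in> Pow K"
      then have "card K = card I + card (K - I)"
        using K by (metis PowD card_Diff_subset card_mono finite_subset le_add_diff_inverse)
      then have "card I \<noteq> 2 \<or> card (K - I) \<noteq> 2" using False by linarith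
      then show "shuffle_sign I (K - I) * form_coeff (wedge1 p q) I * form_coeff (wedge1 r s) (K - I) = 0"
        by (auto simp: wedge1_coeff_eq_0)
    qed
    then show ?thesis by simp
  qed
qed

text \<open>Both sides rotate to a multiple of \<open>wedge1 a d\<close>, leaving
  \<open>wedge1 b c\<close> against \<open>wedge1 c b\<close>. This is the antisymmetry of two
  neighbours that sit in different factors.\<close>

lemma wedge1_exchange: "wedge1 a b * wedge1 c d = - (wedge1 a c * wedge1 b d)"
  proof -
  have "wedge1 a b * wedge1 c d = wedge1 b c * wedge1 a d" by (rule wedge1_rotate)
  moreover have "wedge1 a c * wedge1 b d = wedge1 c b * wedge1 a d" by (rule wedge1_rotate)
  moreover have "wedge1 b c = - wedge1 c b" by (rule wedge1_swap)
  ultimately show ?thesis by simp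
qed

section \<open>Traces and the derivative of a determinant\<close>

definition mat_trace :: "'a :: comm_monoid_add mat \<Rightarrow> 'a" where
  "mat_trace A = (\<Sum>i<dim_row A. A $$ (i, i))"

lemma mat_trace_add:
  "A \<in> carrier_mat n n \<Longrightarrow> B \<in> carrier_mat n n \<Longrightarrow> mat_trace (A + B) = mat_trace A + mat_trace B"
  by (auto simp: mat_trace_def sum.distrib)

lemma mat_trace_smult:
  fixes A :: "'a :: semiring_0 mat"
  assumes "A \<in> carrier_mat n n"
  shows "mat_trace (c \<cdot>\<^sub>m A) = c * mat_trace A"
  using assms by (auto simp: mat_trace_def sum_distrib_left)

lemma mat_trace_mult:
  fixes A :: "'a :: semiring_0 mat"
  assumes "A \<in> carrier_mat n m" "B \<in> carrier_mat m n"
  shows "mat_trace (A * B) = (\<Sum>i<n. \<Sum>j<m. A $$ (i, j) * B $$ (j, i))"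
  using assms by (auto simp: mat_trace_def scalar_prod_def atLeast0LessThan)

lemma mat_mult_index:
  fixes A B :: "'a :: semiring_0 mat"
  assumes "A \<in> carrier_mat nr n" "B \<in> carrier_mat n nc" "i < nr" "j < nc"
  shows "(A * B) $$ (i, j) = (\<Sum>l<n. A $$ (i, l) * B $$ (l, j))"
  using assms by (auto simp: scalar_prod_def atLeast0LessThan)

text \<open>Jacobi's formula for an arbitrary derivation: Leibniz' rule yields one determinant per
  differentiated row, and each is expanded along that row.\<close>

lemma det_derivation:
  fixes D :: "'a :: comm_ring_1 \<Rightarrow> 'a"
  assumes add: "\<And>a b. D (a + b) = D a + D b"
    and mult: "\<And>a b. D (a * b) = D a * b + a * D b"
    and A: "A \<in> carrier_mat n n"
  shows "D (det A) = (\<Sum>i<n. \<Sum>j<n. D (A $$ (i, j)) * cofactor A i j)"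
proof -
  have D0: "D 0 = 0" using add[of 0 0] by simp
  have D1: "D 1 = 0" using mult[of 1 1] by simp
  have Dneg: "D (- a) = - D a" for a using add[of a "- a"] D0 by (simp add: eq_neg_iff_add_eq_0 add.commute)
  have Dsum: "D (sum f S) = (\<Sum>x\<in>S. D (f x))" for f and S :: "'b set"
    by (induction S rule: infinite_finite_induct) (auto simp: D0 add)
  have Dprod: "D (prod f S) = (\<Sum>x\<in>S. D (f x) * prod f (S - {x}))" if "finite S"
    for f and S :: "nat set" using that
  proof (induction S)
    case (insert x S)
    have "D (prod f (insert x S)) = D (f x) * prod f S + f x * (\<Sum>y\<in>S. D (f y) * prod f (S - {y}))"
      using insert by (simp add: mult)
    also have "f x * (\<Sum>y\<in>S. D (f y) * prod f (S - {y})) =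
        (\<Sum>y\<in>S. D (f y) * prod f (insert x S - {y}))"
      unfolding sum_distrib_left
    proof (rule sum.cong)
      fix y assume y: "y \<in> S"
      then have "insert x S - {y} = insert x (S - {y})" using insert by auto
      then show "f x * (D (f y) * prod f (S - {y})) = D (f y) * prod f (insert x S - {y})"
        using insert by (simp add: mult_ac)
    qed simp
    finally show ?case using insert by simp
  qed (simp add: D1)
  have Dsign: "D (signof p * a) = signof p * D a" for p a
    by (simp add: sign_def Dneg)
  \<comment> \<open>Row \<open>i\<close> is differentiated; the cofactors along that row do not see
    the change.\<close>
  define B where "B i = mat n n (\<lambda>(k, j). if k = i then D (A $$ (i, j)) else A $$ (k, j))" for i
  have B: "B i \<in> carrier_mat n n" for i by (simp add: B_def)
  have cof: "cofactor (B i) i j = cofactor A i j" if "i < n" "j < n" for i j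
  proof -
    have "mat_delete (B i) i j = mat_delete A i j"
      using A that by (intro eq_matI) (auto simp: mat_delete_def B_def)
    then show ?thesis by (simp add: cofactor_def)
  qed
  have "D (det A) = (\<Sum>p\<in>{p. p permutes {0..<n}}. signof p *
      (\<Sum>i\<in>{0..<n}. D (A $$ (i, p i)) * prod (\<lambda>i. A $$ (i, p i)) ({0..<n} - {i})))"
    unfolding det_def'[OF A] Dsum Dsign by (subst Dprod) simp_all
  also have "\<dots> = (\<Sum>i<n. \<Sum>p\<in>{p. p permutes {0..<n}}. signof p *
      (D (A $$ (i, p i)) * prod (\<lambda>i. A $$ (i, p i)) ({0..<n} - {i})))"
    unfolding sum_distrib_left by (subst sum.swap) (simp add: atLeast0LessThan)
  also have "\<dots> = (\<Sum>i<n. det (B i))"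
  proof (rule sum.cong)
    fix i assume i: "i \<in> {..<n}"
    have "D (A $$ (i, p i)) * prod (\<lambda>i. A $$ (i, p i)) ({0..<n} - {i}) = (\<Prod>k=0..<n. B i $$ (k, p k))"
      if p: "p permutes {0..<n}" for p
    proof -
      have pl: "p k < n" if "k < n" for k using permutes_in_image[OF p, of k] that by simp
      have "(\<Prod>k=0..<n. B i $$ (k, p k)) = B i $$ (i, p i) * (\<Prod>k\<in>{0..<n} - {i}. B i $$ (k, p k))"
        using i by (intro prod.remove) auto
      also have "(\<Prod>k\<in>{0..<n} - {i}. B i $$ (k, p k)) = (\<Prod>k\<in>{0..<n} - {i}. A $$ (k, p k))"
        by (intro prod.cong) (auto simp: B_def pl)
      finally show ?thesis using i by (simp add: B_def pl)
    qed
    then show "(\<Sum>p\<in>{p. p permutes {0..<n}}. signof p *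
      (D (A $$ (i, p i)) * prod (\<lambda>i. A $$ (i, p i)) ({0..<n} - {i}))) = det (B i)"
      unfolding det_def'[OF B] by (intro sum.cong) auto
  qed simp
  also have "\<dots> = (\<Sum>i<n. \<Sum>j<n. D (A $$ (i, j)) * cofactor A i j)"
  proof (intro sum.cong refl)
    fix i assume i: "i \<in> {..<n}"
    then have "det (B i) = (\<Sum>j<n. B i $$ (i, j) * cofactor (B i) i j)"
      by (intro laplace_expansion_row[OF B]) simp
    also have "\<dots> = (\<Sum>j<n. D (A $$ (i, j)) * cofactor A i j)"
      using i by (intro sum.cong refl) (simp add: cof, simp add: B_def)
    finally show "det (B i) = (\<Sum>j<n. D (A $$ (i, j)) * cofactor A i j)" .
  qed
  finally show ?thesis .
qed

section \<open>Coefficients, the degree derivation and degree bounds\<close>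

lemma form_coeff_simps [simp]:
  "form_coeff 0 K = 0"
  "form_coeff 1 K = (if K = {} then 1 else 0)"
  "form_coeff (\<alpha> + \<beta>) K = form_coeff \<alpha> K + form_coeff \<beta> K"
  "form_coeff (\<alpha> - \<beta>) K = form_coeff \<alpha> K - form_coeff \<beta> K"
  "form_coeff (- \<alpha>) K = - form_coeff \<alpha> K"
  "form_coeff (form_scale c \<alpha>) K = c * form_coeff \<alpha> K"
  by (transfer; simp)+

lemma form_coeff_sum [simp]: "form_coeff (sum f S) K = (\<Sum>x\<in>S. form_coeff (f x) K)"
  by (induction S rule: infinite_finite_induct) auto

lemma form_coeff_mult:
  "form_coeff (\<alpha> * \<beta>) K = (\<Sum>I\<in>Pow K. shuffle_sign I (K - I) * form_coeff \<alpha> I * form_coeff \<beta> (K - I))"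
  by (simp add: times_even_form.rep_eq)

lemma form_coeff_infinite: "infinite K \<or> odd (card K) \<Longrightarrow> form_coeff \<alpha> K = 0"
  by transfer auto

lemma card_add_Diff: "finite K \<Longrightarrow> I \<subseteq> K \<Longrightarrow> card I + card (K - I) = card K"
  by (metis card_Diff_subset card_mono finite_subset le_add_diff_inverse)

text \<open>The degree operator. It is a derivation, and in characteristic 0 only constants are
  killed by it, so a form is known once its image and its constant coefficient are.\<close>

lift_definition euler :: "even_form \<Rightarrow> even_form" is "\<lambda>f K. of_nat (card K) * f K" by auto

lemma form_coeff_euler [simp]: "form_coeff (euler \<alpha>) K = of_nat (card K) * form_coeff \<alpha> K"
  by transfer simp

lemma euler_add: "euler (\<alpha> + \<beta>) = euler \<alpha> + euler \<beta>"
  by (rule even_form_eqI) (simp add: algebra_simps)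

lemma euler_mult: "euler (\<alpha> * \<beta>) = euler \<alpha> * \<beta> + \<alpha> * euler \<beta>"
proof (rule even_form_eqI)
  fix K :: "nat set" assume K: "finite K"
  have "of_nat (card K) * (shuffle_sign I (K - I) * form_coeff \<alpha> I * form_coeff \<beta> (K - I)) =
      shuffle_sign I (K - I) * (of_nat (card I) * form_coeff \<alpha> I) * form_coeff \<beta> (K - I)
      + shuffle_sign I (K - I) * form_coeff \<alpha> I * (of_nat (card (K - I)) * form_coeff \<beta> (K - I))"
    if "I \<in> Pow K" for I
  proof -
    have "of_nat (card K) = (of_nat (card I) + of_nat (card (K - I)) :: complex)"
      using card_add_Diff[OF K, of I] that by (simp flip: of_nat_add)
    then show ?thesis by (simp only: algebra_simps)
  qed
  then show "form_coeff (euler (\<alpha> * \<beta>)) K = form_coeff (euler \<alpha> * \<beta> + \<alpha> * euler \<beta>) K"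
    unfolding form_coeff_euler form_coeff_simps form_coeff_mult sum_distrib_left sum.distrib[symmetric]
    by (rule sum.cong[OF refl])
qed

definition min_degree :: "nat \<Rightarrow> even_form \<Rightarrow> bool" where
  "min_degree k \<alpha> \<longleftrightarrow> (\<forall>K. card K < k \<longrightarrow> form_coeff \<alpha> K = 0)"

definition max_degree :: "nat \<Rightarrow> even_form \<Rightarrow> bool" where
  "max_degree k \<alpha> \<longleftrightarrow> (\<forall>K. k < card K \<longrightarrow> form_coeff \<alpha> K = 0)"

lemma min_degree_triv [simp]: "min_degree 0 \<alpha>" by (simp add: min_degree_def)

lemma min_degree_add: "min_degree k \<alpha> \<Longrightarrow> min_degree k \<beta> \<Longrightarrow> min_degree k (\<alpha> + \<beta>)"
  by (simp add: min_degree_def)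

lemma min_degree_sum: "(\<And>x. x \<in> S \<Longrightarrow> min_degree k (f x)) \<Longrightarrow> min_degree k (sum f S)"
  by (simp add: min_degree_def)

lemma min_degree_mult: "min_degree k \<alpha> \<Longrightarrow> min_degree l \<beta> \<Longrightarrow> min_degree (k + l) (\<alpha> * \<beta>)"
  unfolding min_degree_def form_coeff_mult
proof (intro allI impI sum.neutral ballI)
  fix K I :: "nat set" assume *: "\<forall>K. card K < k \<longrightarrow> form_coeff \<alpha> K = 0" "\<forall>K. card K < l \<longrightarrow> form_coeff \<beta> K = 0"
    and K: "card K < k + l" and I: "I \<in> Pow K"
  show "shuffle_sign I (K - I) * form_coeff \<alpha> I * form_coeff \<beta> (K - I) = 0"
  proof (cases "finite K")
    case True
    then have "card I + card (K - I) = card K" using I by (simp add: card_add_Diff)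
    then have "card I < k \<or> card (K - I) < l" using K by linarith
    then show ?thesis using * by auto
  next
    case False
    \<comment> \<open>An infinite set has \<open>card\<close> 0 and so meets the degree bound; its
      coefficients vanish by definition of \<open>even_form\<close>.\<close>
    then have "infinite I \<or> infinite (K - I)" using I by (metis Diff_infinite_finite)
    then show ?thesis by (elim disjE) (simp_all add: form_coeff_infinite)
  qed
qed

lemma min_degree_mult_left: "min_degree k \<alpha> \<Longrightarrow> min_degree k (\<alpha> * \<beta>)"
  using min_degree_mult[of k \<alpha> 0 \<beta>] by simp

lemma max_degree_1 [simp]: "max_degree k 1" by (auto simp: max_degree_def)
lemma max_degree_0 [simp]: "max_degree k 0" by (auto simp: max_degree_def)

lemma max_degree_add: "max_degree k \<alpha> \<Longrightarrow> max_degree k \<beta> \<Longrightarrow> max_degree k (\<alpha> + \<beta>)"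
  by (simp add: max_degree_def)

lemma max_degree_sum: "(\<And>x. x \<in> S \<Longrightarrow> max_degree k (f x)) \<Longrightarrow> max_degree k (sum f S)"
  by (simp add: max_degree_def)

lemma max_degree_mult: "max_degree k \<alpha> \<Longrightarrow> max_degree l \<beta> \<Longrightarrow> max_degree (k + l) (\<alpha> * \<beta>)"
  unfolding max_degree_def form_coeff_mult
proof (intro allI impI sum.neutral ballI)
  fix K I :: "nat set" assume *: "\<forall>K. k < card K \<longrightarrow> form_coeff \<alpha> K = 0" "\<forall>K. l < card K \<longrightarrow> form_coeff \<beta> K = 0"
    and K: "k + l < card K" and I: "I \<in> Pow K"
  have "finite K" using K by (metis card.infinite not_less_zero)
  then have "card I + card (K - I) = card K" using I by (simp add: card_add_Diff)
  then have "k < card I \<or> l < card (K - I)" using K by linarith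
  then show "shuffle_sign I (K - I) * form_coeff \<alpha> I * form_coeff \<beta> (K - I) = 0" using * by auto
qed

lemma max_degree_prod:
  "(\<And>x. x \<in> S \<Longrightarrow> max_degree k (f x)) \<Longrightarrow> max_degree (k * card S) (prod f S)"
proof (induction S rule: infinite_finite_induct)
  case (insert x S)
  then have "max_degree (k + k * card S) (f x * prod f S)" by (intro max_degree_mult) auto
  then show ?case using insert by simp
qed auto

lemma max_degree_det:
  assumes A: "A \<in> carrier_mat n n" and "\<And>i j. i < n \<Longrightarrow> j < n \<Longrightarrow> max_degree k (A $$ (i, j))"
  shows "max_degree (k * n) (det A)"
  unfolding det_def'[OF A]
proof (rule max_degree_sum)
  fix p assume "p \<in> {p. p permutes {0..<n}}"
  then have "p i < n" if "i < n" for i using permutes_in_image[of p "{0..<n}" i] that by simp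
  then have "max_degree (k * card {0..<n}) (\<Prod>i=0..<n. A $$ (i, p i))"
    using assms(2) by (intro max_degree_prod) auto
  moreover have "max_degree 0 (signof p)" by (simp add: sign_def max_degree_def)
  ultimately show "max_degree (k * n) (signof p * (\<Prod>i=0..<n. A $$ (i, p i)))"
    using max_degree_mult[of 0] by (metis add_0 card_atLeastLessThan diff_zero)
qed

lemma const_coeff_hom: "comm_ring_hom (\<lambda>\<alpha>. form_coeff \<alpha> {})"
  by unfold_locales (auto simp: form_coeff_mult shuffle_sign_def)

text \<open>Taking the coefficient at the empty set is a ring homomorphism, and it sends
  \<open>1\<^sub>m n + X\<close> to the identity matrix.\<close>

lemma const_coeff_det:
  assumes X: "X \<in> carrier_mat n n" and "\<And>i j. i < n \<Longrightarrow> j < n \<Longrightarrow> form_coeff (X $$ (i, j)) {} = 0"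
  shows "form_coeff (det (1\<^sub>m n + X)) {} = 1"
proof -
  interpret comm_ring_hom "\<lambda>\<alpha>. form_coeff \<alpha> {}" by (rule const_coeff_hom)
  have "map_mat (\<lambda>\<alpha>. form_coeff \<alpha> {}) (1\<^sub>m n + X) = 1\<^sub>m n"
    using assms by (intro eq_matI) auto
  then show ?thesis using hom_det[of "1\<^sub>m n + X"] by simp
qed

section \<open>Sylvester's identity for matrices of 1-forms\<close>

definition is_two_form :: "even_form \<Rightarrow> bool" where
  "is_two_form \<alpha> \<longleftrightarrow> (\<forall>K. card K \<noteq> 2 \<longrightarrow> form_coeff \<alpha> K = 0)"

lemma is_two_form_sum: "(\<And>x. x \<in> S \<Longrightarrow> is_two_form (f x)) \<Longrightarrow> is_two_form (sum f S)"
  by (simp add: is_two_form_def)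

lemma is_two_form_wedge1: "is_two_form (wedge1 a b)"
  by (simp add: is_two_form_def wedge1_coeff_eq_0)

lemma euler_two_form: "is_two_form \<alpha> \<Longrightarrow> euler \<alpha> = 2 * \<alpha>"
proof (rule even_form_eqI)
  fix K :: "nat set" assume "is_two_form \<alpha>"
  then show "form_coeff (euler \<alpha>) K = form_coeff (2 * \<alpha>) K"
    unfolding mult_2 form_coeff_simps by (cases "card K = 2") (simp_all add: is_two_form_def)
qed

lemma min_degree_two_form: "is_two_form \<alpha> \<Longrightarrow> min_degree 2 \<alpha>"
  by (auto simp: is_two_form_def min_degree_def)

lemma max_degree_two_form: "is_two_form \<alpha> \<Longrightarrow> max_degree 2 \<alpha>"
  by (auto simp: is_two_form_def max_degree_def)

locale two_form_matrix =
  fixes n :: nat and X :: "even_form mat"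
  assumes carrier [simp]: "X \<in> carrier_mat n n"
    and two_form: "i < n \<Longrightarrow> j < n \<Longrightarrow> is_two_form (X $$ (i, j))"
begin

abbreviation "A \<equiv> 1\<^sub>m n + X"

lemma carrier_simps [simp]:
  "A \<in> carrier_mat n n" "adj_mat A \<in> carrier_mat n n" "X ^\<^sub>m k \<in> carrier_mat n n"
  using adj_mat(1)[of A n] pow_carrier_mat[of X n k] by simp_all

text \<open>Jacobi's formula for \<open>euler\<close>: the entries of \<open>X\<close> have degree
  2, so the derivative of \<open>A\<close> is twice \<open>X\<close>.\<close>

lemma euler_det: "euler (det A) = 2 * mat_trace (X * adj_mat A)"
proof -
  have "euler 1 = 0" by (rule even_form_eqI) simp
  moreover have "euler 0 = 0" by (rule even_form_eqI) simp
  ultimately have ent: "euler (A $$ (i, j)) = 2 * X $$ (i, j)" if "i < n" "j < n" for i j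
    using that two_form[of i j] carrier_matD[OF carrier]
    by (simp add: euler_add euler_two_form)
  have adj: "adj_mat A $$ (j, i) = cofactor A i j" if "i < n" "j < n" for i j
    using that carrier_matD[OF carrier] by (simp add: adj_mat_def)
  have "euler (det A) = (\<Sum>i<n. \<Sum>j<n. euler (A $$ (i, j)) * cofactor A i j)"
    by (rule det_derivation) (simp_all add: euler_add euler_mult)
  also have "\<dots> = (\<Sum>i<n. \<Sum>j<n. 2 * (X $$ (i, j) * adj_mat A $$ (j, i)))"
    by (intro sum.cong refl) (simp only: ent adj lessThan_iff mult.assoc)
  also have "\<dots> = 2 * mat_trace (X * adj_mat A)"
    by (subst mat_trace_mult[of _ n n]) (simp_all add: sum_distrib_left)
  finally show ?thesis .
qed

text \<open>The adjugate stands in for the inverse of \<open>A\<close>, which avoids power series: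
  X^k (1 + X) adj A = det A X^k.\<close>

lemma trace_pow_adj:
  "mat_trace (X ^\<^sub>m k * adj_mat A) + mat_trace (X ^\<^sub>m Suc k * adj_mat A) = det A * mat_trace (X ^\<^sub>m k)"
proof -
  have "X ^\<^sub>m k * adj_mat A + X ^\<^sub>m Suc k * adj_mat A = (X ^\<^sub>m k + X ^\<^sub>m k * X) * adj_mat A"
    by (subst add_mult_distrib_mat[of _ n n _ _ n]) (simp_all add: mult_carrier_mat[of _ n n])
  also have "X ^\<^sub>m k + X ^\<^sub>m k * X = X ^\<^sub>m k * A"
    by (subst mult_add_distrib_mat[of _ n n _ n]) (simp_all add: right_mult_one_mat[of _ n n])
  also have "X ^\<^sub>m k * A * adj_mat A = X ^\<^sub>m k * (A * adj_mat A)"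
    by (rule assoc_mult_mat[of _ n n _ n _ n]) simp_all
  also have "\<dots> = det A \<cdot>\<^sub>m X ^\<^sub>m k"
    by (subst adj_mat(2)[of _ n], simp, subst mult_smult_distrib[of _ n n _ n])
      (auto simp: right_mult_one_mat[of _ n n])
  finally have eq: "X ^\<^sub>m k * adj_mat A + X ^\<^sub>m Suc k * adj_mat A = det A \<cdot>\<^sub>m X ^\<^sub>m k" .
  have "mat_trace (X ^\<^sub>m k * adj_mat A + X ^\<^sub>m Suc k * adj_mat A) =
      mat_trace (X ^\<^sub>m k * adj_mat A) + mat_trace (X ^\<^sub>m Suc k * adj_mat A)"
    by (rule mat_trace_add[of _ n]) (simp_all add: mult_carrier_mat[of _ n n])
  moreover have "mat_trace (det A \<cdot>\<^sub>m X ^\<^sub>m k) = det A * mat_trace (X ^\<^sub>m k)"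
    by (rule mat_trace_smult[of _ n]) simp
  ultimately show ?thesis using eq by simp
qed

lemma min_degree_pow: "i < n \<Longrightarrow> j < n \<Longrightarrow> min_degree (2 * k) ((X ^\<^sub>m k) $$ (i, j))"
proof (induction k arbitrary: j)
  case (Suc k)
  have "(X ^\<^sub>m Suc k) $$ (i, j) = (\<Sum>l<n. (X ^\<^sub>m k) $$ (i, l) * X $$ (l, j))"
    using Suc.prems by (simp add: mat_mult_index[of _ n n _ n])
  also have "min_degree (2 * k + 2) \<dots>"
    using Suc by (intro min_degree_sum min_degree_mult min_degree_two_form two_form) auto
  finally show ?case by simp
qed simp

lemma min_degree_trace: "min_degree (2 * k) (mat_trace (X ^\<^sub>m k * adj_mat A))"
  by (subst mat_trace_mult[of _ n n])
    (auto intro!: min_degree_sum min_degree_mult_left min_degree_pow)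

lemma const_coeff: "form_coeff (det A) {} = 1"
  using two_form by (intro const_coeff_det) (simp_all add: is_two_form_def)

end

text \<open>By the Newton identities \<open>det (1 + X)\<close> is determined by the traces of the powers of \<open>X\<close>.\<close>
lemma det_mult_eq_1:
  assumes "two_form_matrix n X" "two_form_matrix m Y"
    and tr: "\<And>k. mat_trace (X ^\<^sub>m Suc k) + mat_trace (Y ^\<^sub>m Suc k) = 0"
  shows "det (1\<^sub>m n + X) * det (1\<^sub>m m + Y) = 1"
proof -
  interpret X: two_form_matrix n X by fact
  interpret Y: two_form_matrix m Y by fact
  \<comment> \<open>\<open>2 * S 1\<close> is the Euler derivative of the product of the
    determinants. The sign alternation below starts at index 1, because the traces of the 0-th
    powers need not cancel.\<close>
  define S where "S k = det Y.A * mat_trace (X ^\<^sub>m k * adj_mat X.A)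
      + det X.A * mat_trace (Y ^\<^sub>m k * adj_mat Y.A)" for k
  have "S (Suc k) + S (Suc (Suc k)) = det Y.A * (det X.A * mat_trace (X ^\<^sub>m Suc k))
      + det X.A * (det Y.A * mat_trace (Y ^\<^sub>m Suc k))" for k
    unfolding S_def X.trace_pow_adj[symmetric] Y.trace_pow_adj[symmetric] by (simp add: algebra_simps)
  also have "det Y.A * (det X.A * mat_trace (X ^\<^sub>m Suc k)) + det X.A * (det Y.A * mat_trace (Y ^\<^sub>m Suc k))
      = det X.A * det Y.A * (mat_trace (X ^\<^sub>m Suc k) + mat_trace (Y ^\<^sub>m Suc k))" for k
    by (simp only: algebra_simps)
  finally have step: "S (Suc k) = - S (Suc (Suc k))" for k
    using tr by (simp add: eq_neg_iff_add_eq_0)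
  have S1: "S 1 = (- 1) ^ k * S (Suc k)" for k
  proof (induction k)
    case (Suc k)
    then show ?case using step[of k] by simp
  qed simp
  have "euler (det X.A * det Y.A) = 2 * S 1"
    by (simp add: euler_mult X.euler_det Y.euler_det S_def algebra_simps)
  moreover have "form_coeff (S 1) K = 0" for K
  proof -
    \<comment> \<open>\<open>S 1\<close> agrees up to sign with every later \<open>S\<close>; the
      index is chosen so that the degree bound exceeds \<open>card K\<close>.\<close>
    have "min_degree (2 * Suc (card K)) (S (Suc (card K)))"
      unfolding S_def mult.commute[of "det _"]
      by (intro min_degree_add min_degree_mult_left X.min_degree_trace Y.min_degree_trace)
    then have "form_coeff (S (Suc (card K))) K = 0" by (simp add: min_degree_def)
    moreover have "S 1 = S (Suc (card K)) \<or> S 1 = - S (Suc (card K))"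
      using S1[of "card K"] by (cases "even (card K)") simp_all
    ultimately show ?thesis by auto
  qed
  then have "S 1 = 0" by (intro even_form_eqI) simp
  ultimately have eu: "euler (det X.A * det Y.A) = 0" by simp
  show ?thesis
  proof (rule even_form_eqI)
    fix K :: "nat set" assume K: "finite K"
    show "form_coeff (det X.A * det Y.A) K = form_coeff 1 K"
    proof (cases "K = {}")
      case True
      then show ?thesis by (simp add: form_coeff_mult shuffle_sign_def X.const_coeff Y.const_coeff)
    next
      case False
      have "of_nat (card K) * form_coeff (det X.A * det Y.A) K = 0"
        using arg_cong[OF eu, of "\<lambda>\<alpha>. form_coeff \<alpha> K"] by simp
      then show ?thesis using K False by simp
    qed
  qed
qed

text \<open>A product of two matrices of 1-forms. A 1-form is encoded by its coefficient function,
  so the last argument of \<open>B\<close> and \<open>C\<close> is the coordinate index.\<close>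

definition wedge_mat ::
    "nat \<Rightarrow> nat \<Rightarrow> nat \<Rightarrow> (nat \<Rightarrow> nat \<Rightarrow> nat \<Rightarrow> complex) \<Rightarrow> (nat \<Rightarrow> nat \<Rightarrow> nat \<Rightarrow> complex) \<Rightarrow> even_form mat" where
  "wedge_mat n m k B C = mat n k (\<lambda>(i, j). \<Sum>l<m. wedge1 (B i l) (C l j))"

lemma wedge_mat_carrier [simp]: "wedge_mat n m k B C \<in> carrier_mat n k"
  by (simp add: wedge_mat_def)

lemma wedge_mat_index:
  "i < n \<Longrightarrow> j < k \<Longrightarrow> wedge_mat n m k B C $$ (i, j) = (\<Sum>l<m. wedge1 (B i l) (C l j))"
  by (simp add: wedge_mat_def)

lemma two_form_wedge_mat: "two_form_matrix n (wedge_mat n m n B C)"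
  by unfold_locales (auto simp: wedge_mat_def intro!: is_two_form_sum is_two_form_wedge1)

text \<open>
  Sylvester's identity for matrices of odd elements: moving \<open>B\<close> around the trace of a power
  changes the sign, so the two determinants are inverse to each other instead of equal.
\<close>
lemma odd_sylvester:
  "det (1\<^sub>m n + wedge_mat n m n B C) * det (1\<^sub>m m + wedge_mat m n m C B) = 1"
proof (rule det_mult_eq_1)
  let ?X = "wedge_mat n m n B C" and ?Y = "wedge_mat m n m C B"
  show "two_form_matrix n ?X" "two_form_matrix m ?Y" by (rule two_form_wedge_mat)+
  interpret X: two_form_matrix n ?X by (rule two_form_wedge_mat)
  interpret Y: two_form_matrix m ?Y by (rule two_form_wedge_mat)
  \<comment> \<open>A spare 1-form \<open>b\<close> in front of \<open>C\<close> makes the entries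
    even, so that the relation C (B C) = (C B) C can be stated with ordinary matrix products;
    \<open>b\<close> passes a 2-form without sign.\<close>
  define M where "M b = mat m n (\<lambda>(l, j). wedge1 b (C l j))" for b
  have M [simp]: "M b \<in> carrier_mat m n" for b by (simp add: M_def)
  have comm: "M b * ?X = ?Y * M b" for b
  proof (rule eq_matI)
    fix l j assume "l < dim_row (?Y * M b)" "j < dim_col (?Y * M b)"
    then have lj: "l < m" "j < n" using M[of b] by (auto simp: wedge_mat_def)
    have "(M b * ?X) $$ (l, j) = (\<Sum>i<n. \<Sum>k<m. wedge1 b (C l i) * wedge1 (B i k) (C k j))"
      using lj by (simp add: M_def wedge_mat_def scalar_prod_def atLeast0LessThan sum_distrib_left)
    also have "\<dots> = (\<Sum>k<m. \<Sum>i<n. wedge1 (C l i) (B i k) * wedge1 b (C k j))"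
      by (subst sum.swap) (intro sum.cong refl wedge1_rotate)
    also have "\<dots> = (?Y * M b) $$ (l, j)"
      using lj by (simp add: M_def wedge_mat_def scalar_prod_def atLeast0LessThan sum_distrib_right)
    finally show "(M b * ?X) $$ (l, j) = (?Y * M b) $$ (l, j)" .
  qed (auto simp: M_def wedge_mat_def)
  have comm_pow: "M b * ?X ^\<^sub>m k = ?Y ^\<^sub>m k * M b" for b k
  proof (induction k)
    case 0
    then show ?case by (auto simp: M_def wedge_mat_def)
  next
    case (Suc k)
    have "M b * ?X ^\<^sub>m Suc k = M b * ?X ^\<^sub>m k * ?X"
      by (simp add: assoc_mult_mat[of _ m n _ n _ n])
    also have "\<dots> = ?Y ^\<^sub>m k * (M b * ?X)"
      by (simp add: Suc assoc_mult_mat[of _ m m _ n _ n])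
    also have "\<dots> = ?Y ^\<^sub>m Suc k * M b"
      by (simp add: comm assoc_mult_mat[of _ m m _ m _ n])
    finally show ?case .
  qed
  fix k
  \<comment> \<open>One factor is split off the power; its entries \<open>B j l\<close> then play
    the role of the spare form.\<close>
  have "mat_trace (?X ^\<^sub>m Suc k) = (\<Sum>i<n. \<Sum>j<n. (?X ^\<^sub>m k) $$ (i, j) * ?X $$ (j, i))"
    unfolding pow_mat.simps by (rule mat_trace_mult) simp_all
  also have "\<dots> = (\<Sum>i<n. \<Sum>j<n. \<Sum>l<m. (?X ^\<^sub>m k) $$ (i, j) * wedge1 (B j l) (C l i))"
    by (intro sum.cong refl) (simp add: wedge_mat_index sum_distrib_left)
  also have "\<dots> = (\<Sum>j<n. \<Sum>l<m. \<Sum>i<n. (?X ^\<^sub>m k) $$ (i, j) * wedge1 (B j l) (C l i))"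
    by (subst sum.swap, rule sum.cong, rule refl, rule sum.swap)
  also have "\<dots> = (\<Sum>j<n. \<Sum>l<m. (M (B j l) * ?X ^\<^sub>m k) $$ (l, j))"
    by (intro sum.cong refl) (simp add: mat_mult_index[of _ m n _ n], simp add: M_def mult.commute)
  also have "\<dots> = (\<Sum>j<n. \<Sum>l<m. \<Sum>i<m. (?Y ^\<^sub>m k) $$ (l, i) * wedge1 (B j l) (C i j))"
    unfolding comm_pow
    by (intro sum.cong refl) (simp add: mat_mult_index[of _ m m _ n], simp add: M_def)
  also have "\<dots> = (\<Sum>l<m. \<Sum>i<m. \<Sum>j<n. (?Y ^\<^sub>m k) $$ (l, i) * wedge1 (B j l) (C i j))"
    by (subst sum.swap, rule sum.cong, rule refl, rule sum.swap)
  \<comment> \<open>The sign arises here: in the entries of \<open>?Y\<close> the form from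
    \<open>C\<close> precedes the one from \<open>B\<close>.\<close>
  also have "\<dots> = (\<Sum>l<m. \<Sum>i<m. - ((?Y ^\<^sub>m k) $$ (l, i) * ?Y $$ (i, l)))"
    by (intro sum.cong refl)
      (simp add: wedge_mat_index sum_distrib_left wedge1_swap[of "B _ _" "C _ _"] sum_negf)
  also have "\<dots> = - mat_trace (?Y ^\<^sub>m Suc k)"
    unfolding pow_mat.simps by (subst mat_trace_mult[of _ m m]) (simp_all add: sum_negf)
  finally show "mat_trace (?X ^\<^sub>m Suc k) + mat_trace (?Y ^\<^sub>m Suc k) = 0" by simp
qed

section \<open>Families of forms with constant coefficients\<close>

lemma form_coeff_homogeneous_part [simp]:
  "form_coeff (homogeneous_part k \<alpha>) K = (if card K = k then form_coeff \<alpha> K else 0)"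
  by (simp add: homogeneous_part.rep_eq)

lemma homogeneous_part_add: "homogeneous_part k (\<alpha> + \<beta>) = homogeneous_part k \<alpha> + homogeneous_part k \<beta>"
  by (rule even_form_eqI) simp

lemma homogeneous_part_scale: "homogeneous_part k (form_scale c \<alpha>) = form_scale c (homogeneous_part k \<alpha>)"
  by (rule even_form_eqI) simp

lemma homogeneous_part_mult:
  "homogeneous_part (2 * m) (\<alpha> * \<beta>) =
    (\<Sum>i\<le>m. homogeneous_part (2 * i) \<alpha> * homogeneous_part (2 * (m - i)) \<beta>)"
proof (rule even_form_eqI)
  fix K :: "nat set" assume K: "finite K"
  let ?t = "\<lambda>I. shuffle_sign I (K - I) * form_coeff \<alpha> I * form_coeff \<beta> (K - I)"
  have "(if card K = 2 * m then ?t I else 0) = (\<Sum>i\<le>m. shuffle_sign I (K - I) *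
      form_coeff (homogeneous_part (2 * i) \<alpha>) I * form_coeff (homogeneous_part (2 * (m - i)) \<beta>) (K - I))"
    if "I \<in> Pow K" for I
  \<comment> \<open>Odd degrees carry no coefficients, so splittings into the even degrees
    \<open>2 * i\<close> and \<open>2 * (m - i)\<close> suffice.\<close>
  proof (cases "odd (card I)")
    case True
    then have "form_coeff \<alpha> I = 0" by (simp add: form_coeff_infinite)
    then show ?thesis by simp
  next
    case False
    then obtain k where k: "card I = 2 * k" by (auto elim: evenE)
    have c: "card I + card (K - I) = card K" using K that by (simp add: card_add_Diff)
    have "(\<Sum>i\<le>m. shuffle_sign I (K - I) *
        form_coeff (homogeneous_part (2 * i) \<alpha>) I * form_coeff (homogeneous_part (2 * (m - i)) \<beta>) (K - I))
      = (\<Sum>i\<le>m. if i = k then if card K = 2 * m then ?t I else 0 else 0)"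
      using c k by (intro sum.cong refl) auto
    also have "\<dots> = (if card K = 2 * m then ?t I else 0)"
      using c k by auto
    finally show ?thesis by simp
  qed
  then have "(\<Sum>I\<in>Pow K. if card K = 2 * m then ?t I else 0) =
      (\<Sum>I\<in>Pow K. \<Sum>i\<le>m. shuffle_sign I (K - I) *
      form_coeff (homogeneous_part (2 * i) \<alpha>) I * form_coeff (homogeneous_part (2 * (m - i)) \<beta>) (K - I))"
    by (intro sum.cong refl)
  moreover have "form_coeff (homogeneous_part (2 * m) (\<alpha> * \<beta>)) K =
      (\<Sum>I\<in>Pow K. if card K = 2 * m then ?t I else 0)"
    by (simp add: form_coeff_mult)
  moreover have "form_coeff (\<Sum>i\<le>m. homogeneous_part (2 * i) \<alpha> * homogeneous_part (2 * (m - i)) \<beta>) K =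
      (\<Sum>I\<in>Pow K. \<Sum>i\<le>m. shuffle_sign I (K - I) *
      form_coeff (homogeneous_part (2 * i) \<alpha>) I * form_coeff (homogeneous_part (2 * (m - i)) \<beta>) (K - I))"
    unfolding form_coeff_sum form_coeff_mult by (rule sum.swap)
  ultimately show "form_coeff (homogeneous_part (2 * m) (\<alpha> * \<beta>)) K =
      form_coeff (\<Sum>i\<le>m. homogeneous_part (2 * i) \<alpha> * homogeneous_part (2 * (m - i)) \<beta>) K"
    by (simp only:)
qed

lemma homogeneous_part_0: "homogeneous_part 0 \<alpha> = form_scale (form_coeff \<alpha> {}) 1"
  by (rule even_form_eqI) auto

lemma homogeneous_part_max_degree: "max_degree k \<alpha> \<Longrightarrow> k < l \<Longrightarrow> homogeneous_part l \<alpha> = 0"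
  by (rule even_form_eqI) (auto simp: max_degree_def)

text \<open>An ordered exterior product, formed two letters at a time because only even products
  exist here. Words of odd length get the value 0, which keeps \<open>word_swap\<close> and the
  later rules free of parity conditions.\<close>

fun word :: "(nat \<Rightarrow> nat \<Rightarrow> complex) \<Rightarrow> nat list \<Rightarrow> even_form" where
  "word \<theta> [] = 1"
| "word \<theta> [p] = 0"
| "word \<theta> (p # q # w) = wedge1 (\<theta> p) (\<theta> q) * word \<theta> w"

lemma word_append: "even (length v) \<Longrightarrow> word \<theta> (v @ w) = word \<theta> v * word \<theta> w"
  by (induction \<theta> v rule: word.induct) (auto simp: mult.assoc)

lemma word_swap: "word \<theta> (v @ p # q # w) = - word \<theta> (v @ q # p # w)"
proof (induction \<theta> v rule: word.induct)
  case (1 \<theta>)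
  then show ?case by (simp add: wedge1_swap[of "\<theta> p" "\<theta> q"])
next
  \<comment> \<open>The two letters lie in different factors; a longer prefix is peeled off in
    pairs.\<close>
  case (2 \<theta> r)
  show ?case
    by (cases w) (auto simp: wedge1_exchange[of "\<theta> r" "\<theta> p"] mult.assoc[symmetric])
qed simp

lemma even_form_eq_minus_self: "\<alpha> = - \<alpha> \<Longrightarrow> \<alpha> = (0 :: even_form)"
proof (rule even_form_eqI)
  fix K assume "\<alpha> = - \<alpha>"
  then have "form_coeff \<alpha> K = - form_coeff \<alpha> K" by (metis form_coeff_simps(5))
  then show "form_coeff \<alpha> K = form_coeff 0 K" by simp
qed

text \<open>Moving \<open>p\<close> past the letters of \<open>w\<close> brings its two copies
  together, where antisymmetry makes the form equal to its negative.\<close>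

lemma word_repeat: "word \<theta> (v @ p # w @ p # x) = 0"
proof (induction w arbitrary: v)
  case Nil
  show ?case using word_swap[of \<theta> v p p x] by (intro even_form_eq_minus_self) simp
next
  case (Cons q w)
  have "word \<theta> (v @ p # (q # w) @ p # x) = - word \<theta> ((v @ [q]) @ p # w @ p # x)"
    using word_swap[of \<theta> v p q "w @ p # x"] by simp
  then show ?case using Cons[of "v @ [q]"] by simp
qed

text \<open>The scalar is chosen before \<theta>: it must be the same at all points to become a
  constant factor of the integrand. The prefix \<open>v\<close> absorbs the letters passed during
  the induction.\<close>

lemma word_insort: "\<exists>c. \<forall>\<theta> v. word \<theta> (v @ p # w) = form_scale c (word \<theta> (v @ insort p w))"
proof (induction w)
  case Nil
  show ?case by (rule exI[of _ 1]) (auto intro!: even_form_eqI)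
next
  case (Cons q w)
  then obtain c where c: "\<And>\<theta> v. word \<theta> (v @ p # w) = form_scale c (word \<theta> (v @ insort p w))" by blast
  show ?case
  proof (cases "p \<le> q")
    case True
    then show ?thesis by (intro exI[of _ 1]) (auto intro!: even_form_eqI)
  next
    case False
    have "word \<theta> (v @ p # q # w) = form_scale (- c) (word \<theta> (v @ q # insort p w))" for \<theta> v
    proof -
      have "word \<theta> (v @ p # q # w) = - word \<theta> ((v @ [q]) @ p # w)"
        using word_swap[of \<theta> v p q w] by simp
      also have "\<dots> = form_scale (- c) (word \<theta> ((v @ [q]) @ insort p w))"
        unfolding c by (intro even_form_eqI) simp
      finally show ?thesis by simp
    qed
    then show ?thesis using False by auto
  qed
qed

lemma word_sort: "\<exists>c. \<forall>\<theta> v. word \<theta> (v @ w) = form_scale c (word \<theta> (v @ sort w))"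
proof (induction w)
  case Nil
  show ?case by (rule exI[of _ 1]) (auto intro!: even_form_eqI)
next
  case (Cons p w)
  then obtain c where c: "\<And>\<theta> v. word \<theta> (v @ w) = form_scale c (word \<theta> (v @ sort w))" by blast
  obtain d where d: "\<And>\<theta> v. word \<theta> (v @ p # sort w) = form_scale d (word \<theta> (v @ insort p (sort w)))"
    using word_insort by blast
  have "word \<theta> (v @ p # w) = form_scale (c * d) (word \<theta> (v @ insort p (sort w)))" for \<theta> v
    using c[of \<theta> "v @ [p]"] d[of \<theta> v] by (intro even_form_eqI) simp
  then show ?case by auto
qed

lemma form_coeff_word: "card K \<noteq> length w \<Longrightarrow> form_coeff (word \<theta> w) K = 0"
proof (induction \<theta> w arbitrary: K rule: word.induct)
  case (1 \<theta>)
  then show ?case by auto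
next
  case (3 \<theta> p q w)
  show ?case
  proof (cases "finite K")
    case True
    show ?thesis unfolding word.simps form_coeff_mult
    proof (intro sum.neutral ballI)
      fix I assume "I \<in> Pow K"
      then have "card I + card (K - I) = card K" using True by (simp add: card_add_Diff)
      then have "card I \<noteq> 2 \<or> card (K - I) \<noteq> length w" using 3(2) by auto
      then show "shuffle_sign I (K - I) * form_coeff (wedge1 (\<theta> p) (\<theta> q)) I * form_coeff (word \<theta> w) (K - I) = 0"
        using 3(1) by (auto simp: wedge1_coeff_eq_0)
    qed
  qed (simp add: form_coeff_infinite)
qed simp

text \<open>
  Families of forms that are polynomials with constant coefficients in the products
  \<open>\<theta> p \<and> \<theta> q\<close> of \<open>N\<close> moving 1-forms. In degree \<open>N\<close> such a family is a constant multiple of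
  \<open>\<theta> 0 \<and> \<dots> \<and> \<theta> (N - 1)\<close>, so no integrability is needed to add integrals.
\<close>
inductive constant_family :: "('u \<Rightarrow> nat \<Rightarrow> nat \<Rightarrow> complex) \<Rightarrow> nat \<Rightarrow> ('u \<Rightarrow> even_form) \<Rightarrow> bool"
  for \<theta> N where
  zero: "constant_family \<theta> N (\<lambda>u. 0)"
| word: "set w \<subseteq> {..<N} \<Longrightarrow> even (length w) \<Longrightarrow> constant_family \<theta> N (\<lambda>u. form_scale c (word (\<theta> u) w))"
| add: "constant_family \<theta> N \<alpha> \<Longrightarrow> constant_family \<theta> N \<beta> \<Longrightarrow> constant_family \<theta> N (\<lambda>u. \<alpha> u + \<beta> u)"

lemma form_scale_mult: "form_scale c \<alpha> * form_scale d \<beta> = form_scale (c * d) (\<alpha> * \<beta>)"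
  by (rule even_form_eqI) (simp add: form_coeff_mult sum_distrib_left mult_ac)

lemma form_scale_simps:
  "form_scale c (\<alpha> + \<beta>) = form_scale c \<alpha> + form_scale c \<beta>" "form_scale c 0 = 0"
  "form_scale c (form_scale d \<alpha>) = form_scale (c * d) \<alpha>" "form_scale 1 \<alpha> = \<alpha>"
  "form_scale (- 1) \<alpha> = - \<alpha>" "form_scale 0 \<alpha> = 0"
  by (rule even_form_eqI; simp add: algebra_simps)+

context
  fixes \<theta> :: "'u \<Rightarrow> nat \<Rightarrow> nat \<Rightarrow> complex" and N :: nat
begin

abbreviation "const \<equiv> constant_family \<theta> N"

lemma constant_family_scale: "const \<alpha> \<Longrightarrow> const (\<lambda>u. form_scale c (\<alpha> u))"
  by (induction rule: constant_family.induct) (auto simp: form_scale_simps intro: constant_family.intros)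

lemma constant_family_1: "const (\<lambda>u. 1)"
  using constant_family.word[of "[]" N \<theta> 1] by (simp add: form_scale_simps)

lemma constant_family_uminus: "const \<alpha> \<Longrightarrow> const (\<lambda>u. - \<alpha> u)"
  using constant_family_scale[of \<alpha> "- 1"] by (simp add: form_scale_simps)

lemma constant_family_wedge1: "p < N \<Longrightarrow> q < N \<Longrightarrow> const (\<lambda>u. wedge1 (\<theta> u p) (\<theta> u q))"
  using constant_family.word[of "[p, q]" N \<theta> 1] by (simp add: form_scale_simps)

lemma constant_family_mult:
  assumes "const \<alpha>" "const \<beta>"
  shows "const (\<lambda>u. \<alpha> u * \<beta> u)"
  using assms(1)
proof (induction rule: constant_family.induct)
  case (word v c)
  from assms(2) show ?case
  proof (induction rule: constant_family.induct)
    case (word w d)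
    have "const (\<lambda>u. form_scale (c * d) (word (\<theta> u) (v @ w)))"
      using word \<open>set v \<subseteq> {..<N}\<close> \<open>even (length v)\<close> by (intro constant_family.word) auto
    then show ?case using \<open>even (length v)\<close> by (simp add: form_scale_mult word_append)
  next
    case (add \<alpha> \<beta>)
    then show ?case by (simp add: distrib_left constant_family.add)
  qed (simp add: constant_family.zero)
next
  case (add \<alpha> \<alpha>')
  then show ?case by (simp add: distrib_right constant_family.add)
qed (simp add: constant_family.zero)

lemma constant_family_sum: "(\<And>x. x \<in> S \<Longrightarrow> const (f x)) \<Longrightarrow> const (\<lambda>u. \<Sum>x\<in>S. f x u)"
  by (induction S rule: infinite_finite_induct) (auto intro: constant_family.intros)

lemma constant_family_prod: "(\<And>x. x \<in> S \<Longrightarrow> const (f x)) \<Longrightarrow> const (\<lambda>u. \<Prod>x\<in>S. f x u)"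
  by (induction S rule: infinite_finite_induct) (auto intro: constant_family_mult constant_family_1)

lemma constant_family_power: "const \<alpha> \<Longrightarrow> const (\<lambda>u. \<alpha> u ^ k)"
  by (induction k) (auto intro: constant_family_mult constant_family_1)

lemma constant_family_det:
  assumes "\<And>i j. i < k \<Longrightarrow> j < k \<Longrightarrow> const (\<lambda>u. f u (i, j))"
  shows "const (\<lambda>u. det (mat k k (f u)))"
proof -
  have "const (\<lambda>u. \<Sum>p\<in>{p. p permutes {0..<k}}. signof p * (\<Prod>i=0..<k. f u (i, p i)))"
  proof (intro constant_family_sum constant_family_mult constant_family_prod)
    fix p i assume "p \<in> {p. p permutes {0..<k}}" "i \<in> {0..<k}"
    then show "const (\<lambda>u. f u (i, p i))" using assms permutes_in_image[of p "{0..<k}" i] by simp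
  next
    fix p :: "nat \<Rightarrow> nat"
    show "const (\<lambda>u. signof p)"
      using constant_family_1 constant_family_uminus[OF constant_family_1] by (simp add: sign_def)
  qed
  also have "(\<lambda>u. \<Sum>p\<in>{p. p permutes {0..<k}}. signof p * (\<Prod>i=0..<k. f u (i, p i))) = (\<lambda>u. det (mat k k (f u)))"
  proof
    fix u
    have "(\<Prod>i=0..<k. f u (i, p i)) = (\<Prod>i=0..<k. mat k k (f u) $$ (i, p i))" if "p permutes {0..<k}" for p
      using permutes_in_image[OF that] by (intro prod.cong) auto
    then show "(\<Sum>p\<in>{p. p permutes {0..<k}}. signof p * (\<Prod>i=0..<k. f u (i, p i))) = det (mat k k (f u))"
      by (subst det_def'[of _ k]) (auto intro!: sum.cong)
  qed
  finally show ?thesis .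
qed

lemma constant_family_homogeneous_part: "const \<alpha> \<Longrightarrow> const (\<lambda>u. homogeneous_part k (\<alpha> u))"
proof (induction rule: constant_family.induct)
  case zero
  have "homogeneous_part k 0 = 0" by (rule even_form_eqI) simp
  then show ?case by (simp add: constant_family.zero)
next
  case (word w c)
  have "homogeneous_part k (word (\<theta> u) w) = (if length w = k then word (\<theta> u) w else 0)" for u
    by (rule even_form_eqI) (auto simp: form_coeff_word)
  then show ?case using word
    by (cases "length w = k")
      (simp_all add: homogeneous_part_scale form_scale_simps constant_family.zero constant_family.word)
next
  case (add \<alpha> \<beta>)
  then show ?case by (simp add: homogeneous_part_add constant_family.add)
qed

text \<open>A word of length \<open>N\<close> in \<open>N\<close> letters either is a rearrangement
  of \<open>[0..<N]\<close> or repeats a letter and vanishes; other lengths do not reach degree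
  \<open>N\<close>.\<close>

lemma constant_family_top_coeff:
  assumes "const \<alpha>"
  shows "\<exists>c. \<forall>u. form_coeff (\<alpha> u) {..<N} = c * form_coeff (word (\<theta> u) [0..<N]) {..<N}"
  using assms
proof (induction rule: constant_family.induct)
  case zero
  then show ?case by (auto intro: exI[of _ 0])
next
  case (word w c)
  show ?case
  proof (cases "length w = N \<and> distinct w")
    case True
    then have "set w = {..<N}"
      using word(1) by (metis card_lessThan card_subset_eq distinct_card finite_lessThan)
    then have sort: "sort w = [0..<N]"
      using True by (intro sorted_distinct_set_unique) (auto simp: atLeast0LessThan)
    obtain d where d: "\<forall>\<theta> v. word \<theta> (v @ w) = form_scale d (word \<theta> (v @ sort w))"
      using word_sort by blast
    have "word (\<theta> u) w = form_scale d (word (\<theta> u) [0..<N])" for u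
      using d[rule_format, of "\<theta> u" "[]"] by (simp add: sort)
    then have "form_coeff (form_scale c (word (\<theta> u) w)) {..<N} =
        c * d * form_coeff (word (\<theta> u) [0..<N]) {..<N}" for u
      by simp
    then show ?thesis by blast
  next
    case False
    have "form_coeff (word (\<theta> u) w) {..<N} = 0" for u
    proof (cases "distinct w")
      case True
      then show ?thesis using False by (intro form_coeff_word) auto
    next
      case False
      then obtain x p y z where "w = x @ [p] @ y @ [p] @ z" using not_distinct_decomp by blast
      then show ?thesis using word_repeat[of "\<theta> u" x p y z] by simp
    qed
    then show ?thesis by (auto intro: exI[of _ 0])
  qed
next
  case (add \<alpha> \<beta>)
  then obtain c d where cd: "\<forall>u. form_coeff (\<alpha> u) {..<N} = c * form_coeff (word (\<theta> u) [0..<N]) {..<N}"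
    "\<forall>u. form_coeff (\<beta> u) {..<N} = d * form_coeff (word (\<theta> u) [0..<N]) {..<N}" by blast
  show ?case by (rule exI[of _ "c + d"]) (simp add: cd distrib_right)
qed

end

text \<open>Holds without integrability: a function that is not integrable has integral 0, and so
  has every multiple of it.\<close>

lemma grassmannian_integral_scale:
  "grassmannian_integral n (\<lambda>u. form_scale c (\<alpha> u)) = c * grassmannian_integral n \<alpha>"
  by (simp add: grassmannian_integral_def)

lemma grassmannian_integral_uminus:
  "grassmannian_integral n (\<lambda>u. - \<alpha> u) = - grassmannian_integral n \<alpha>"
  by (simp add: grassmannian_integral_def)

lemma grassmannian_integral_add:
  assumes "constant_family \<theta> (8 * n) \<alpha>" "constant_family \<theta> (8 * n) \<beta>"
  shows "grassmannian_integral n (\<lambda>u. \<alpha> u + \<beta> u) = grassmannian_integral n \<alpha> + grassmannian_integral n \<beta>"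
proof -
  obtain c where c: "\<forall>u. form_coeff (\<alpha> u) {..<8 * n} = c * form_coeff (word (\<theta> u) [0..<8 * n]) {..<8 * n}"
    using constant_family_top_coeff[OF assms(1)] by blast
  obtain d where d: "\<forall>u. form_coeff (\<beta> u) {..<8 * n} = d * form_coeff (word (\<theta> u) [0..<8 * n]) {..<8 * n}"
    using constant_family_top_coeff[OF assms(2)] by blast
  show ?thesis by (simp add: grassmannian_integral_def c d flip: distrib_right)
qed

lemma grassmannian_integral_sum:
  assumes "\<And>x. x \<in> S \<Longrightarrow> constant_family \<theta> (8 * n) (f x)"
  shows "grassmannian_integral n (\<lambda>u. \<Sum>x\<in>S. f x u) = (\<Sum>x\<in>S. grassmannian_integral n (f x))"
  using assms
proof (induction S rule: infinite_finite_induct)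
  case (insert x S)
  then have "grassmannian_integral n (\<lambda>u. f x u + (\<Sum>x\<in>S. f x u)) =
      grassmannian_integral n (f x) + grassmannian_integral n (\<lambda>u. \<Sum>x\<in>S. f x u)"
    by (intro grassmannian_integral_add[of \<theta>] constant_family_sum) auto
  then show ?case using insert by simp
qed (simp_all add: grassmannian_integral_def)

section \<open>The projector onto the universal quotient bundle\<close>

lemma mat_adjoint_carrier [simp]:
  "A \<in> carrier_mat n m \<Longrightarrow> mat_adjoint A \<in> carrier_mat m n"
  unfolding mat_adjoint_def by (intro carrier_matI) auto

lemma mat_adjoint_index:
  fixes A :: "complex mat"
  assumes "A \<in> carrier_mat n m" "i < m" "j < n"
  shows "mat_adjoint A $$ (i, j) = cnj (A $$ (j, i))"
  using assms by (auto simp: mat_adjoint_def mat_of_rows_index)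

lemma mat_adjoint_mult:
  fixes A B :: "complex mat"
  assumes "A \<in> carrier_mat n m" "B \<in> carrier_mat m k"
  shows "mat_adjoint (A * B) = mat_adjoint B * mat_adjoint A"
proof (rule eq_matI)
  note carr = mat_adjoint_carrier[OF assms(1)] mat_adjoint_carrier[OF assms(2)] mult_carrier_mat[OF assms]
  note carr' = mult_carrier_mat[OF carr(2,1)] mat_adjoint_carrier[OF carr(3)]
  show "dim_row (mat_adjoint (A * B)) = dim_row (mat_adjoint B * mat_adjoint A)"
    "dim_col (mat_adjoint (A * B)) = dim_col (mat_adjoint B * mat_adjoint A)"
    using carr'[THEN carrier_matD(1)] carr'[THEN carrier_matD(2)] by simp_all
  fix i j assume "i < dim_row (mat_adjoint B * mat_adjoint A)" "j < dim_col (mat_adjoint B * mat_adjoint A)"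
  then have ij: "i < k" "j < n" using carrier_matD[OF carr'(1)] by simp_all
  show "mat_adjoint (A * B) $$ (i, j) = (mat_adjoint B * mat_adjoint A) $$ (i, j)"
    unfolding mat_adjoint_index[OF carr(3) ij] mat_mult_index[OF assms ij(2,1)]
      mat_mult_index[OF carr(2,1) ij] cnj_sum
    by (intro sum.cong refl)
      (use ij in \<open>simp add: mat_adjoint_index[OF assms(1)] mat_adjoint_index[OF assms(2)] mult.commute\<close>)
qed

lemma mat_adjoint_adjoint:
  fixes A :: "complex mat"
  assumes A: "A \<in> carrier_mat n m"
  shows "mat_adjoint (mat_adjoint A) = A"
proof (rule eq_matI)
  note A' = mat_adjoint_carrier[OF A]
  show "dim_row (mat_adjoint (mat_adjoint A)) = dim_row A" "dim_col (mat_adjoint (mat_adjoint A)) = dim_col A"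
    using carrier_matD[OF mat_adjoint_carrier[OF A']] carrier_matD[OF A] by simp_all
  fix i j assume "i < dim_row A" "j < dim_col A"
  then show "mat_adjoint (mat_adjoint A) $$ (i, j) = A $$ (i, j)"
    using A by (simp add: mat_adjoint_index[OF A'] mat_adjoint_index[OF A])
qed

lemma mat_eq_on_vecI:
  fixes A B :: "complex mat"
  assumes A: "A \<in> carrier_mat n m" and B: "B \<in> carrier_mat n m"
    and eq: "\<And>x. x \<in> carrier_vec m \<Longrightarrow> A *\<^sub>v x = B *\<^sub>v x"
  shows "A = B"
proof (rule eq_matI)
  fix i j assume ij: "i < dim_row B" "j < dim_col B"
  then have "j < m" using B by simp
  then have "col A j = col B j"
    using eq[of "unit_vec m j"] by (simp add: mat_col_unit[OF A] mat_col_unit[OF B])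
  then have "col A j $ i = col B j $ i" by simp
  then show "A $$ (i, j) = B $$ (i, j)"
    using carrier_matD[OF A] carrier_matD[OF B] ij by (simp add: col_def)
qed (simp_all add: carrier_matD[OF A] carrier_matD[OF B])

text \<open>\<open>orth_proj\<close> is a definite description, so uniqueness is the point.
  Projectors with the same range satisfy P Q = Q and Q P = P; the adjoint of the first identity
  gives Q = Q P = P.\<close>

lemma orth_proj_eqI:
  assumes P: "P \<in> carrier_mat N N" "P * P = P" "mat_adjoint P = P"
    and V: "(\<lambda>x. P *\<^sub>v x) ` carrier_vec N = V"
  shows "orth_proj N V = P"
proof -
  have absorb: "A * B = B"
    if A: "A \<in> carrier_mat N N" "A * A = A" "(\<lambda>x. A *\<^sub>v x) ` carrier_vec N = V"
      and B: "B \<in> carrier_mat N N" "(\<lambda>x. B *\<^sub>v x) ` carrier_vec N = V" for A B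
  proof (rule mat_eq_on_vecI[of _ N N])
    fix x :: "complex vec" assume x: "x \<in> carrier_vec N"
    then have "B *\<^sub>v x \<in> (\<lambda>x. A *\<^sub>v x) ` carrier_vec N" unfolding A(3) using B(2) by blast
    then obtain y where y: "y \<in> carrier_vec N" "B *\<^sub>v x = A *\<^sub>v y" by blast
    have "A * B *\<^sub>v x = A *\<^sub>v (B *\<^sub>v x)" by (rule assoc_mult_mat_vec[OF A(1) B(1) x])
    also have "\<dots> = A * A *\<^sub>v y" unfolding y(2) by (rule assoc_mult_mat_vec[OF A(1) A(1) y(1), symmetric])
    finally show "A * B *\<^sub>v x = B *\<^sub>v x" by (simp only: A(2) y(2))
  qed (use A B in simp_all)
  show ?thesis unfolding orth_proj_def
  proof (rule the_equality)
    fix Q assume Q: "Q \<in> carrier_mat N N \<and> Q * Q = Q \<and> mat_adjoint Q = Q \<and>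
      (\<lambda>x. Q *\<^sub>v x) ` carrier_vec N = V"
    have "Q = mat_adjoint (P * Q)" using absorb[of P Q] P V Q by simp
    also have "\<dots> = Q * P" using P Q by (simp add: mat_adjoint_mult[of _ N N _ N])
    also have "\<dots> = P" using absorb[of Q P] P V Q by simp
    finally show "Q = P" .
  qed (use P V in auto)
qed

text \<open>If the Gram matrix kills \<open>v\<close>, the squared norm of W v is the Hermitian
  product of the zero vector with \<open>v\<close>.\<close>

lemma gram_det_nonzero:
  fixes W :: "complex mat"
  assumes W: "W \<in> carrier_mat N k"
    and inj: "\<And>v. v \<in> carrier_vec k \<Longrightarrow> W *\<^sub>v v = 0\<^sub>v N \<Longrightarrow> v = 0\<^sub>v k"
  shows "det (mat_adjoint W * W) \<noteq> 0"
proof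
  note W' = mat_adjoint_carrier[OF W]
  assume "det (mat_adjoint W * W) = 0"
  then obtain v where v: "v \<in> carrier_vec k" "v \<noteq> 0\<^sub>v k" "mat_adjoint W * W *\<^sub>v v = 0\<^sub>v k"
    using det_0_iff_vec_prod_zero[OF mult_carrier_mat[OF W' W]] by blast
  define y where "y = W *\<^sub>v v"
  have y: "y \<in> carrier_vec N" using W v by (simp add: y_def)
  have y0: "mat_adjoint W *\<^sub>v y = 0\<^sub>v k"
    using v(3) unfolding y_def by (simp only: assoc_mult_mat_vec[OF W' W v(1)])
  have sum0: "(\<Sum>p<N. cnj (W $$ (p, q)) * y $ p) = 0" if "q < k" for q
  proof -
    have "(mat_adjoint W *\<^sub>v y) $ q = (\<Sum>p<N. cnj (W $$ (p, q)) * y $ p)"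
      using that carrier_matD[OF W'] carrier_vecD[OF y] mat_adjoint_index[OF W that]
      by (simp add: scalar_prod_def atLeast0LessThan)
    then show ?thesis using y0 that by simp
  qed
  have "y \<bullet>c y = (\<Sum>p<N. y $ p * cnj (y $ p))"
    using y by (simp add: scalar_prod_def atLeast0LessThan)
  also have "\<dots> = (\<Sum>p<N. \<Sum>q<k. cnj (v $ q) * (cnj (W $$ (p, q)) * y $ p))"
  proof (intro sum.cong refl)
    fix p assume "p \<in> {..<N}"
    then have "y $ p = (\<Sum>q<k. W $$ (p, q) * v $ q)"
      using W v by (simp add: y_def scalar_prod_def atLeast0LessThan)
    then have "y $ p * cnj (y $ p) = y $ p * (\<Sum>q<k. cnj (W $$ (p, q)) * cnj (v $ q))" by simp
    then show "y $ p * cnj (y $ p) = (\<Sum>q<k. cnj (v $ q) * (cnj (W $$ (p, q)) * y $ p))"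
      by (simp add: sum_distrib_left mult_ac)
  qed
  also have "\<dots> = (\<Sum>q<k. cnj (v $ q) * (\<Sum>p<N. cnj (W $$ (p, q)) * y $ p))"
    by (subst sum.swap) (simp add: sum_distrib_left)
  also have "\<dots> = 0" by (simp add: sum0)
  finally have "y = 0\<^sub>v N" using y by simp
  then show False using inj[OF v(1)] v(2) by (simp add: y_def)
qed

text \<open>Cramer's rule: the entries are visibly rational in those of \<open>K\<close>, from which
  their differentiability follows. For singular \<open>K\<close> this is the zero matrix.\<close>

definition mat_inv :: "complex mat \<Rightarrow> complex mat" where
  "mat_inv K = (1 / det K) \<cdot>\<^sub>m adj_mat K"

lemma mat_inv:
  assumes K: "K \<in> carrier_mat k k" and "det K \<noteq> 0"
  shows "mat_inv K \<in> carrier_mat k k" "K * mat_inv K = 1\<^sub>m k" "mat_inv K * K = 1\<^sub>m k"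
proof -
  note adj = adj_mat[OF K]
  show "mat_inv K \<in> carrier_mat k k" using adj by (simp add: mat_inv_def)
  have s: "(1 / det K) \<cdot>\<^sub>m (det K \<cdot>\<^sub>m 1\<^sub>m k) = 1\<^sub>m k"
    using assms by (intro eq_matI) auto
  show "K * mat_inv K = 1\<^sub>m k"
    unfolding mat_inv_def using mult_smult_distrib[OF K adj(1)] adj(2) s by simp
  show "mat_inv K * K = 1\<^sub>m k"
    unfolding mat_inv_def using mult_smult_assoc_mat[OF adj(1) K] adj(3) s by simp
qed

text \<open>The orthogonal projector onto the column space when the columns are independent.\<close>

definition range_proj :: "complex mat \<Rightarrow> complex mat" where
  "range_proj W = W * (mat_inv (mat_adjoint W * W) * mat_adjoint W)"

locale injective_mat =
  fixes N k :: nat and W :: "complex mat"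
  assumes W [simp]: "W \<in> carrier_mat N k"
    and inj: "\<And>v. v \<in> carrier_vec k \<Longrightarrow> W *\<^sub>v v = 0\<^sub>v N \<Longrightarrow> v = 0\<^sub>v k"
begin

abbreviation "W' \<equiv> mat_adjoint W"
abbreviation "G \<equiv> mat_inv (W' * W)"
abbreviation "P \<equiv> range_proj W"

lemma W' [simp]: "W' \<in> carrier_mat k N" by simp
lemma gram [simp]: "W' * W \<in> carrier_mat k k" by (rule mult_carrier_mat[OF W' W])

lemma det_gram: "det (W' * W) \<noteq> 0" by (rule gram_det_nonzero[OF W inj])

lemmas G = mat_inv[OF gram det_gram]
declare G(1) [simp]

lemma GW' [simp]: "G * W' \<in> carrier_mat k N" by (rule mult_carrier_mat[OF G(1) W'])
lemma P [simp]: "P \<in> carrier_mat N N" unfolding range_proj_def by (rule mult_carrier_mat[OF W GW'])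

lemma G_adjoint: "mat_adjoint G = G"
proof -
  let ?K = "W' * W"
  have K: "mat_adjoint ?K = ?K" using W by (simp add: mat_adjoint_mult[of _ k N _ k] mat_adjoint_adjoint[of _ N k])
  have one: "mat_adjoint (1\<^sub>m k) = (1\<^sub>m k :: complex mat)"
    using carrier_matD[OF mat_adjoint_carrier[OF one_carrier_mat]]
    by (intro eq_matI) (auto simp: mat_adjoint_index[OF one_carrier_mat])
  have GK: "mat_adjoint G * ?K = 1\<^sub>m k"
    using mat_adjoint_mult[OF gram G(1)] by (simp only: G(2) K one)
  have "mat_adjoint G = mat_adjoint G * (?K * G)"
    by (simp only: G(2) right_mult_one_mat[OF mat_adjoint_carrier[OF G(1)]])
  also have "\<dots> = mat_adjoint G * ?K * G"
    by (rule assoc_mult_mat[symmetric, of _ k k _ k _ k]) (use G(1) in simp_all)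
  also have "\<dots> = G" using G(1) by (simp only: GK left_mult_one_mat)
  finally show ?thesis .
qed

lemma PW: "P * W = W"
proof -
  have "P * W = W * (G * W' * W)"
    unfolding range_proj_def by (rule assoc_mult_mat[OF W GW' W])
  also have "G * W' * W = G * (W' * W)" by (rule assoc_mult_mat[OF G(1) W' W])
  finally show ?thesis by (simp add: G(3) right_mult_one_mat[OF W])
qed

lemma PP: "P * P = P"
proof -
  have "P * P = P * W * (G * W')"
    unfolding range_proj_def[of W] by (rule assoc_mult_mat[symmetric, OF P[unfolded range_proj_def] W GW'])
  then show ?thesis by (simp add: PW) (simp add: range_proj_def)
qed

lemma P_adjoint: "mat_adjoint P = P"
proof -
  have "mat_adjoint P = mat_adjoint (G * W') * W'"
    unfolding range_proj_def by (rule mat_adjoint_mult[OF W GW'])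
  also have "mat_adjoint (G * W') = W * G"
    using mat_adjoint_mult[OF G(1) W'] by (simp add: G_adjoint mat_adjoint_adjoint[OF W])
  also have "W * G * W' = P" unfolding range_proj_def by (rule assoc_mult_mat[OF W G(1) W'])
  finally show ?thesis .
qed

lemma W'P: "W' * P = W'"
  using mat_adjoint_mult[OF P W] by (simp add: PW P_adjoint)

lemma orth_proj_range: "orth_proj N ((\<lambda>x. W *\<^sub>v x) ` carrier_vec k) = P"
proof (rule orth_proj_eqI[OF P PP P_adjoint])
  have "P *\<^sub>v x = W *\<^sub>v ((G * W') *\<^sub>v x)" if "x \<in> carrier_vec N" for x
    unfolding range_proj_def by (rule assoc_mult_mat_vec[OF W GW' that])
  moreover have "W *\<^sub>v x = P *\<^sub>v (W *\<^sub>v x)" if "x \<in> carrier_vec k" for x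
    using assoc_mult_mat_vec[OF P W that] by (simp add: PW)
  ultimately show "(\<lambda>x. P *\<^sub>v x) ` carrier_vec N = (\<lambda>x. W *\<^sub>v x) ` carrier_vec k"
    by (auto simp: image_iff mult_mat_vec_carrier[OF GW'] mult_mat_vec_carrier[OF W]) 
      (metis W GW' mult_mat_vec_carrier)+
qed

abbreviation "R \<equiv> 1\<^sub>m N - P"

lemma R [simp]: "R \<in> carrier_mat N N" by (simp add: minus_carrier_mat)

lemma RW: "R * W = 0\<^sub>m N k"
  using minus_mult_distrib_mat[OF one_carrier_mat P W] by (simp add: PW left_mult_one_mat[OF W])

lemma W'R: "W' * R = 0\<^sub>m k N"
  using mult_minus_distrib_mat[OF W' one_carrier_mat P] by (simp add: W'P right_mult_one_mat[OF W'])

lemma RR: "R * R = R"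
proof -
  have "R * R = R * 1\<^sub>m N - R * P"
    by (rule mult_minus_distrib_mat[OF R one_carrier_mat P])
  also have "R * P = 1\<^sub>m N * P - P * P" by (rule minus_mult_distrib_mat[OF one_carrier_mat P P])
  also have "\<dots> = 0\<^sub>m N N" by (simp add: PP left_mult_one_mat[OF P])
  also have "R * 1\<^sub>m N - 0\<^sub>m N N = R"
    unfolding right_mult_one_mat[OF R] using carrier_matD[OF P] by (intro eq_matI) simp_all
  finally show ?thesis .
qed

end

section \<open>Curvature of a complement\<close>

lemma wedge1_sum_left:
  "wedge1 (\<lambda>i. \<Sum>x\<in>S. c x * a x i) b = (\<Sum>x\<in>S. form_scale (c x) (wedge1 (a x) b))"
  by (rule even_form_eqI)
    (simp add: wedge1.rep_eq sum_distrib_left sum_distrib_right sum_subtractf right_diff_distrib mult_ac)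

lemma wedge1_sum_right:
  "wedge1 b (\<lambda>i. \<Sum>x\<in>S. c x * a x i) = (\<Sum>x\<in>S. form_scale (c x) (wedge1 b (a x)))"
  by (rule even_form_eqI)
    (simp add: wedge1.rep_eq sum_distrib_left sum_distrib_right sum_subtractf right_diff_distrib mult_ac)

lemma form_scale_sum: "form_scale c (sum f S) = (\<Sum>x\<in>S. form_scale c (f x))"
  by (rule even_form_eqI) (simp add: sum_distrib_left)

lemma form_scale_sum_left: "form_scale (sum c S) \<alpha> = (\<Sum>x\<in>S. form_scale (c x) \<alpha>)"
  by (rule even_form_eqI) (simp add: sum_distrib_right)

section \<open>Calculus of partial derivatives\<close>

definition partially_differentiable :: "nat \<Rightarrow> ((nat \<Rightarrow> real) \<Rightarrow> complex) \<Rightarrow> (nat \<Rightarrow> real) \<Rightarrow> bool" where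
  "partially_differentiable i g u \<longleftrightarrow> (\<lambda>t. g (u(i := t))) differentiable (at (u i))"

lemma partial_deriv_has_derivative:
  "partially_differentiable i g u \<Longrightarrow>
    ((\<lambda>t. g (u(i := t))) has_vector_derivative partial_deriv i g u) (at (u i))"
  unfolding partially_differentiable_def partial_deriv_def by (rule vector_derivative_works[THEN iffD1])

lemma partial_deriv_eqI:
  "((\<lambda>t. g (u(i := t))) has_vector_derivative d) (at (u i)) \<Longrightarrow> partial_deriv i g u = d"
  unfolding partial_deriv_def by (rule vector_derivative_at)

lemma partial_deriv_sum_mult:
  assumes "\<And>x. x \<in> S \<Longrightarrow> partially_differentiable i (f x) u" "\<And>x. x \<in> S \<Longrightarrow> partially_differentiable i (g x) u"
  shows "partial_deriv i (\<lambda>v. \<Sum>x\<in>S. f x v * g x v) u =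
    (\<Sum>x\<in>S. f x u * partial_deriv i (g x) u + partial_deriv i (f x) u * g x u)"
proof (rule partial_deriv_eqI, rule has_vector_derivative_sum)
  fix x assume x: "x \<in> S"
  show "((\<lambda>t. f x (u(i := t)) * g x (u(i := t))) has_vector_derivative
      f x u * partial_deriv i (g x) u + partial_deriv i (f x) u * g x u) (at (u i))"
    using has_vector_derivative_mult[OF partial_deriv_has_derivative[OF assms(1)[OF x]]
        partial_deriv_has_derivative[OF assms(2)[OF x]]] by simp
qed

lemma partial_deriv_const_minus:
  assumes "partially_differentiable i g u"
  shows "partial_deriv i (\<lambda>v. c - g v) u = - partial_deriv i g u"
  using has_vector_derivative_diff[OF has_vector_derivative_const partial_deriv_has_derivative[OF assms]]
  by (intro partial_deriv_eqI) simp

lemma partial_deriv_cnj: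
  assumes "partially_differentiable i g u"
  shows "partial_deriv i (\<lambda>v. cnj (g v)) u = cnj (partial_deriv i g u)"
  using has_vector_derivative_cnj[OF partial_deriv_has_derivative[OF assms]] by (rule partial_deriv_eqI)

lemma partially_differentiable_cnj:
  "partially_differentiable i g u \<Longrightarrow> partially_differentiable i (\<lambda>v. cnj (g v)) u"
  using has_vector_derivative_cnj[OF partial_deriv_has_derivative[of i g u]]
  unfolding partially_differentiable_def by (rule differentiableI_vector)

lemma partially_differentiable_const: "partially_differentiable i (\<lambda>v. c) u"
  by (simp add: partially_differentiable_def)

lemma partially_differentiable_add:
  "partially_differentiable i f u \<Longrightarrow> partially_differentiable i g u \<Longrightarrow>
    partially_differentiable i (\<lambda>v. f v + g v) u"
  by (simp add: partially_differentiable_def)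

lemma partially_differentiable_mult:
  "partially_differentiable i f u \<Longrightarrow> partially_differentiable i g u \<Longrightarrow>
    partially_differentiable i (\<lambda>v. f v * g v) u"
  by (simp add: partially_differentiable_def)

lemma partially_differentiable_divide:
  "partially_differentiable i f u \<Longrightarrow> partially_differentiable i g u \<Longrightarrow> g u \<noteq> 0 \<Longrightarrow>
    partially_differentiable i (\<lambda>v. f v / g v) u"
  by (simp add: partially_differentiable_def)

lemma partially_differentiable_sum:
  "(\<And>x. x \<in> S \<Longrightarrow> partially_differentiable i (f x) u) \<Longrightarrow> partially_differentiable i (\<lambda>v. \<Sum>x\<in>S. f x v) u"
  unfolding partially_differentiable_def
  by (cases "finite S") auto

lemma partially_differentiable_prod:
  "(\<And>x. x \<in> S \<Longrightarrow> partially_differentiable i (f x) u) \<Longrightarrow> partially_differentiable i (\<lambda>v. \<Prod>x\<in>S. f x v) u"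
  by (induction S rule: infinite_finite_induct)
    (auto intro: partially_differentiable_const partially_differentiable_mult)

lemma partially_differentiable_det:
  assumes A: "\<And>v. A v \<in> carrier_mat k k"
    and d: "\<And>p q. p < k \<Longrightarrow> q < k \<Longrightarrow> partially_differentiable i (\<lambda>v. A v $$ (p, q)) u"
  shows "partially_differentiable i (\<lambda>v. det (A v)) u"
  unfolding det_def'[OF A]
proof (intro partially_differentiable_sum partially_differentiable_mult partially_differentiable_const
    partially_differentiable_prod d)
  fix p x assume "p \<in> {p. p permutes {0..<k}}" "x \<in> {0..<k}"
  then show "x < k" "p x < k" using permutes_in_image[of p "{0..<k}" x] by auto
qed

lemma partially_differentiable_mat_mult:
  assumes AB: "\<And>v. A v \<in> carrier_mat n m" "\<And>v. B v \<in> carrier_mat m k" and pq: "p < n" "q < k"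
    and "\<And>l. l < m \<Longrightarrow> partially_differentiable i (\<lambda>v. A v $$ (p, l)) u"
    and "\<And>l. l < m \<Longrightarrow> partially_differentiable i (\<lambda>v. B v $$ (l, q)) u"
  shows "partially_differentiable i (\<lambda>v. (A v * B v) $$ (p, q)) u"
  unfolding mat_mult_index[OF AB pq]
  using assms by (intro partially_differentiable_sum partially_differentiable_mult) auto

lemma partially_differentiable_mat_inv:
  assumes A: "\<And>v. A v \<in> carrier_mat k k" and det: "det (A u) \<noteq> 0"
    and d: "\<And>p q. p < k \<Longrightarrow> q < k \<Longrightarrow> partially_differentiable i (\<lambda>v. A v $$ (p, q)) u"
    and pq: "p < k" "q < k"
  shows "partially_differentiable i (\<lambda>v. mat_inv (A v) $$ (p, q)) u"
proof -
  have "mat_inv (A v) $$ (p, q) = (- 1) ^ (q + p) * det (mat_delete (A v) q p) / det (A v)" for v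
    using A[of v] pq by (simp add: mat_inv_def adj_mat_def cofactor_def)
  moreover have "mat_delete (A v) q p $$ (a, b) =
      A v $$ (if a < q then a else Suc a, if b < p then b else Suc b)" if "a < k - 1" "b < k - 1" for a b v
    using A[of v] that by (simp add: mat_delete_def)
  ultimately show ?thesis
    using det d mat_delete_carrier[OF A]
    by (auto intro!: partially_differentiable_divide partially_differentiable_mult
      partially_differentiable_const partially_differentiable_det[of _ "k - 1"] partially_differentiable_det[of A k] A)
qed

text \<open>If c w = 0, then c d(w f) = (c dw) f. Here \<open>e\<close> is the derivative of
  \<open>w\<close> and \<open>d\<close> that of \<open>f\<close>; \<open>c\<close> will be a row or
  a column of \<open>R\<close>.\<close>

lemma sum_mult_product_rule:
  fixes c f d :: "nat \<Rightarrow> complex"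
  assumes "\<And>m. m < k \<Longrightarrow> (\<Sum>p<N. c p * w p m) = 0"
  shows "(\<Sum>p<N. c p * - (\<Sum>m<k. w p m * d m + e p m * f m)) = - (\<Sum>m<k. f m * (\<Sum>p<N. c p * e p m))"
proof -
  have "(\<Sum>p<N. c p * (\<Sum>m<k. w p m * d m + e p m * f m)) =
      (\<Sum>m<k. \<Sum>p<N. c p * w p m * d m + f m * (c p * e p m))"
    unfolding sum_distrib_left by (subst sum.swap) (simp add: algebra_simps)
  also have "\<dots> = (\<Sum>m<k. (\<Sum>p<N. c p * w p m) * d m + f m * (\<Sum>p<N. c p * e p m))"
    by (simp add: sum.distrib sum_distrib_left sum_distrib_right)
  also have "\<dots> = (\<Sum>m<k. f m * (\<Sum>p<N. c p * e p m))" by (simp add: assms)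
  finally show ?thesis by (simp only: mult_minus_right sum_negf)
qed

locale injective_family =
  fixes N k :: nat and W :: "(nat \<Rightarrow> real) \<Rightarrow> complex mat" and u :: "nat \<Rightarrow> real"
  assumes injective: "injective_mat N k (W v)"
    and differentiable: "p < N \<Longrightarrow> q < k \<Longrightarrow> partially_differentiable i (\<lambda>v. W v $$ (p, q)) u"
begin

interpretation I: injective_mat N k "W v" for v by (rule injective)

abbreviation "G v \<equiv> mat_inv (mat_adjoint (W v) * W v)"
abbreviation "R v \<equiv> 1\<^sub>m N - range_proj (W v)"

abbreviation "dW p q \<equiv> d_entry W p q u"

text \<open>In matrix form A = R dW, B = A G and C = (dW)^* R; the curvature will be the product of
  \<open>B\<close> and \<open>C\<close>.\<close>

definition "A x m = (\<lambda>i. \<Sum>p<N. R u $$ (x, p) * dW p m i)"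
definition "B x m = (\<lambda>i. \<Sum>l<k. G u $$ (l, m) * A x l i)"
definition "C m y = (\<lambda>i. \<Sum>r<N. R u $$ (r, y) * cnj (dW r m i))"

lemma adj_index: "m < k \<Longrightarrow> q < N \<Longrightarrow> mat_adjoint (W v) $$ (m, q) = cnj (W v $$ (q, m))"
  by (rule mat_adjoint_index[OF I.W])

lemma differentiable_adj:
  "p < N \<Longrightarrow> q < k \<Longrightarrow> partially_differentiable i (\<lambda>v. mat_adjoint (W v) $$ (q, p)) u"
  by (simp add: adj_index partially_differentiable_cnj differentiable)

lemma differentiable_G: "p < k \<Longrightarrow> q < k \<Longrightarrow> partially_differentiable i (\<lambda>v. G v $$ (p, q)) u"
  by (rule partially_differentiable_mat_inv[OF I.gram I.det_gram])
    (auto intro: partially_differentiable_mat_mult[OF I.W' I.W] differentiable differentiable_adj)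

lemma differentiable_WG: "p < N \<Longrightarrow> q < k \<Longrightarrow> partially_differentiable i (\<lambda>v. (W v * G v) $$ (p, q)) u"
  by (rule partially_differentiable_mat_mult[OF I.W I.G(1)]) (auto intro: differentiable differentiable_G)

lemma differentiable_GW': "p < k \<Longrightarrow> q < N \<Longrightarrow> partially_differentiable i (\<lambda>v. (G v * mat_adjoint (W v)) $$ (p, q)) u"
  by (rule partially_differentiable_mat_mult[OF I.G(1) I.W']) (auto intro: differentiable_adj differentiable_G)

lemma differentiable_P: "p < N \<Longrightarrow> q < N \<Longrightarrow> partially_differentiable i (\<lambda>v. range_proj (W v) $$ (p, q)) u"
  unfolding range_proj_def
  by (rule partially_differentiable_mat_mult[OF I.W I.GW']) (auto intro: differentiable differentiable_GW')

lemma d_R: "p < N \<Longrightarrow> q < N \<Longrightarrow> d_entry R p q u i = - partial_deriv i (\<lambda>v. range_proj (W v) $$ (p, q)) u"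
  using carrier_matD[OF I.P] unfolding d_entry_def
  by (simp add: partial_deriv_const_minus differentiable_P)

lemma RW_0: "x < N \<Longrightarrow> m < k \<Longrightarrow> (\<Sum>p<N. R u $$ (x, p) * W u $$ (p, m)) = 0"
  using mat_mult_index[OF I.R[of u] I.W[of u], of x m] by (simp add: I.RW)

lemma W'R_0: "m < k \<Longrightarrow> y < N \<Longrightarrow> (\<Sum>r<N. R u $$ (r, y) * cnj (W u $$ (r, m))) = 0"
  using mat_mult_index[OF I.W'[of u] I.R[of u], of m y] by (simp add: I.W'R adj_index mult.commute)

text \<open>Write the projector as W U with U = G W^*. In R d(W U) the term with dU dies because R W
  = 0.\<close>

lemma R_dR:
  assumes "x < N" "q < N"
  shows "(\<Sum>p<N. R u $$ (x, p) * d_entry R p q u i) =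
    - (\<Sum>m<k. (G u * mat_adjoint (W u)) $$ (m, q) * A x m i)"
proof -
  let ?U = "\<lambda>v. G v * mat_adjoint (W v)"
  have "d_entry R p q u i = - (\<Sum>m<k. W u $$ (p, m) * partial_deriv i (\<lambda>v. ?U v $$ (m, q)) u
      + dW p m i * ?U u $$ (m, q))" if "p < N" for p
    unfolding d_R[OF that assms(2)] unfolding range_proj_def mat_mult_index[OF I.W I.GW' that assms(2)] d_entry_def
    by (subst partial_deriv_sum_mult) (use that assms in \<open>auto intro: differentiable differentiable_GW'\<close>)
  then have "(\<Sum>p<N. R u $$ (x, p) * d_entry R p q u i) = (\<Sum>p<N. R u $$ (x, p) *
      - (\<Sum>m<k. W u $$ (p, m) * partial_deriv i (\<lambda>v. ?U v $$ (m, q)) u + dW p m i * ?U u $$ (m, q)))"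
    by (intro sum.cong refl) (simp only: lessThan_iff)
  also have "\<dots> = - (\<Sum>m<k. ?U u $$ (m, q) * (\<Sum>p<N. R u $$ (x, p) * dW p m i))"
    by (rule sum_mult_product_rule) (rule RW_0[OF assms(1)])
  finally show ?thesis by (simp only: A_def)
qed

text \<open>The mirror image of \<open>R_dR\<close>, with the projector bracketed as (W G) W^* and
  with W^* R = 0.\<close>

lemma dR_R:
  assumes "y < N" "q < N"
  shows "(\<Sum>r<N. R u $$ (r, y) * d_entry R q r u i) = - (\<Sum>m<k. (W u * G u) $$ (q, m) * C m y i)"
proof -
  let ?V = "\<lambda>v. W v * G v"
  have P: "range_proj (W v) = ?V v * mat_adjoint (W v)" for v
    unfolding range_proj_def by (rule assoc_mult_mat[symmetric, OF I.W I.G(1) I.W'])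
  have V: "?V v \<in> carrier_mat N k" for v by (rule mult_carrier_mat[OF I.W I.G(1)])
  have "d_entry R q r u i = - (\<Sum>m<k. ?V u $$ (q, m) * cnj (dW r m i)
      + partial_deriv i (\<lambda>v. ?V v $$ (q, m)) u * cnj (W u $$ (r, m)))" if "r < N" for r
  proof -
    have "partial_deriv i (\<lambda>v. mat_adjoint (W v) $$ (m, r)) u = cnj (dW r m i)" if "m < k" for m
      using that \<open>r < N\<close> by (simp add: adj_index d_entry_def partial_deriv_cnj differentiable)
    then show ?thesis
      unfolding d_R[OF assms(2) that] unfolding P mat_mult_index[OF V I.W' assms(2) that]
      by (subst partial_deriv_sum_mult)
        (use that assms in \<open>auto intro: partially_differentiable_cnj differentiable differentiable_WG simp: adj_index\<close>)
  qed
  then have "(\<Sum>r<N. R u $$ (r, y) * d_entry R q r u i) = (\<Sum>r<N. R u $$ (r, y) *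
      - (\<Sum>m<k. cnj (W u $$ (r, m)) * partial_deriv i (\<lambda>v. ?V v $$ (q, m)) u + cnj (dW r m i) * ?V u $$ (q, m)))"
    by (intro sum.cong refl) (simp only: lessThan_iff add.commute mult.commute)
  also have "\<dots> = - (\<Sum>m<k. ?V u $$ (q, m) * (\<Sum>r<N. R u $$ (r, y) * cnj (dW r m i)))"
    by (rule sum_mult_product_rule) (rule W'R_0[OF _ assms(1)])
  finally show ?thesis by (simp only: C_def)
qed

lemma GW'WG: "m < k \<Longrightarrow> l < k \<Longrightarrow>
  (\<Sum>q<N. (G u * mat_adjoint (W u)) $$ (m, q) * (W u * G u) $$ (q, l)) = G u $$ (m, l)"
proof -
  assume ml: "m < k" "l < k"
  have "G u * mat_adjoint (W u) * (W u * G u) = G u * (mat_adjoint (W u) * (W u * G u))"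
    by (rule assoc_mult_mat[OF I.G(1) I.W' mult_carrier_mat[OF I.W I.G(1)]])
  also have "mat_adjoint (W u) * (W u * G u) = mat_adjoint (W u) * W u * G u"
    by (rule assoc_mult_mat[symmetric, OF I.W' I.W I.G(1)])
  finally have "G u * mat_adjoint (W u) * (W u * G u) = G u"
    by (simp only: I.G(2) right_mult_one_mat[OF I.G(1)])
  then show ?thesis
    using mat_mult_index[OF I.GW'[of u] mult_carrier_mat[OF I.W[of u] I.G(1)[of u]] ml] by simp
qed

text \<open>With U = G W^* and V = W G the curvature is (-A U)(-V C). The signs cancel and U V = G,
  which is attached to \<open>A\<close> to form \<open>B\<close>.\<close>

theorem curvature_eq: "curvature N R u = wedge_mat N k N B C"
proof (rule eq_matI)
  fix x y assume "x < dim_row (wedge_mat N k N B C)" "y < dim_col (wedge_mat N k N B C)"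
  then have xy: "x < N" "y < N" by (simp_all add: wedge_mat_def)
  let ?U = "G u * mat_adjoint (W u)" and ?V = "W u * G u"
  have "curvature N R u $$ (x, y) = (\<Sum>q<N. \<Sum>p<N. \<Sum>r<N.
      form_scale (R u $$ (x, p) * R u $$ (r, y)) (wedge1 (d_entry R p q u) (d_entry R q r u)))"
    using xy unfolding curvature_def by simp (rule sum.swap)
  also have "\<dots> = (\<Sum>q<N. wedge1 (\<lambda>i. \<Sum>p<N. R u $$ (x, p) * d_entry R p q u i)
      (\<lambda>i. \<Sum>r<N. R u $$ (r, y) * d_entry R q r u i))"
    by (simp only: wedge1_sum_left wedge1_sum_right form_scale_sum form_scale_simps)
  also have "\<dots> = (\<Sum>q<N. wedge1 (\<lambda>i. \<Sum>m<k. - ?U $$ (m, q) * A x m i) (\<lambda>i. \<Sum>l<k. - ?V $$ (q, l) * C l y i))"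
    using xy by (intro sum.cong refl) (simp add: R_dR dR_R sum_negf)
  also have "\<dots> = (\<Sum>q<N. \<Sum>m<k. \<Sum>l<k. form_scale (?U $$ (m, q) * ?V $$ (q, l)) (wedge1 (A x m) (C l y)))"
    by (simp only: wedge1_sum_left wedge1_sum_right form_scale_sum form_scale_simps minus_mult_minus)
  also have "\<dots> = (\<Sum>m<k. \<Sum>l<k. \<Sum>q<N. form_scale (?U $$ (m, q) * ?V $$ (q, l)) (wedge1 (A x m) (C l y)))"
    by (subst sum.swap, rule sum.cong, rule refl, rule sum.swap)
  also have "\<dots> = (\<Sum>m<k. \<Sum>l<k. form_scale (G u $$ (m, l)) (wedge1 (A x m) (C l y)))"
    by (intro sum.cong refl) (simp add: GW'WG flip: form_scale_sum_left)
  also have "\<dots> = (\<Sum>l<k. wedge1 (B x l) (C l y))"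
    unfolding B_def wedge1_sum_left by (rule sum.swap)
  finally show "curvature N R u $$ (x, y) = wedge_mat N k N B C $$ (x, y)"
    using xy by (simp add: wedge_mat_index)
qed (simp_all add: curvature_def wedge_mat_def)

end

lemma wedge1_scale_left: "wedge1 (\<lambda>i. c * a i) b = form_scale c (wedge1 a b)"
  using wedge1_sum_left[of "\<lambda>_. c" "\<lambda>_. a" "{()}"] by simp

lemma wedge1_scale_right: "wedge1 b (\<lambda>i. c * a i) = form_scale c (wedge1 b a)"
  using wedge1_sum_right[of b "\<lambda>_. c" "\<lambda>_. a" "{()}"] by simp

context injective_family
begin

lemma R_B: "x < N \<Longrightarrow> (\<Sum>y<N. R u $$ (x, y) * B y m i) = B x m i"
proof -
  assume x: "x < N"
  interpret I: injective_mat N k "W u" by (rule injective)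
  have "(\<Sum>y<N. R u $$ (x, y) * A y l i) = A x l i" for l
  proof -
    have "(\<Sum>y<N. R u $$ (x, y) * A y l i) = (\<Sum>p<N. (\<Sum>y<N. R u $$ (x, y) * R u $$ (y, p)) * dW p l i)"
      unfolding A_def sum_distrib_left sum_distrib_right by (subst sum.swap) (simp only: mult.assoc)
    also have "\<dots> = (\<Sum>p<N. (R u * R u) $$ (x, p) * dW p l i)"
      by (intro sum.cong refl) (simp only: lessThan_iff mat_mult_index[OF I.R I.R x])
    finally show ?thesis by (simp only: I.RR A_def)
  qed
  moreover have "(\<Sum>y<N. R u $$ (x, y) * B y m i) = (\<Sum>l<k. G u $$ (l, m) * (\<Sum>y<N. R u $$ (x, y) * A y l i))"
    unfolding B_def sum_distrib_left by (subst sum.swap) (simp only: mult_ac)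
  ultimately show ?thesis by (simp only: B_def)
qed

text \<open>\<open>C\<close> ends with the projector \<open>R\<close>, and R B = B. In the reversed
  product it is therefore absorbed, leaving the bare conjugate differential of the frame.\<close>

lemma wedge_mat_C_B: "wedge_mat k N k C B = wedge_mat k N k (\<lambda>m r i. cnj (dW r m i)) B"
proof (rule eq_matI)
  fix m l assume "m < dim_row (wedge_mat k N k (\<lambda>m r i. cnj (dW r m i)) B)"
    "l < dim_col (wedge_mat k N k (\<lambda>m r i. cnj (dW r m i)) B)"
  then have ml: "m < k" "l < k" by (simp_all add: wedge_mat_def)
  have "wedge_mat k N k C B $$ (m, l) =
      (\<Sum>y<N. \<Sum>r<N. form_scale (R u $$ (r, y)) (wedge1 (\<lambda>i. cnj (dW r m i)) (B y l)))"
    unfolding wedge_mat_index[OF ml] C_def wedge1_sum_left ..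
  also have "\<dots> = (\<Sum>r<N. wedge1 (\<lambda>i. cnj (dW r m i)) (\<lambda>i. \<Sum>y<N. R u $$ (r, y) * B y l i))"
    unfolding wedge1_sum_right by (rule sum.swap)
  also have "\<dots> = wedge_mat k N k (\<lambda>m r i. cnj (dW r m i)) B $$ (m, l)"
    using ml by (simp add: R_B wedge_mat_index)
  finally show "wedge_mat k N k C B $$ (m, l) = wedge_mat k N k (\<lambda>m r i. cnj (dW r m i)) B $$ (m, l)" .
qed (simp_all add: wedge_mat_def)

end

lemma wedge_mat_scale_left:
  "wedge_mat n m k (\<lambda>x y i. c * B x y i) C = map_mat (form_scale c) (wedge_mat n m k B C)"
  by (rule eq_matI) (auto simp: wedge_mat_def wedge1_scale_left form_scale_sum)

lemma wedge_mat_scale_right: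
  "wedge_mat n m k B (\<lambda>x y i. c * C x y i) = map_mat (form_scale c) (wedge_mat n m k B C)"
  by (rule eq_matI) (auto simp: wedge_mat_def wedge1_scale_right form_scale_sum)

section \<open>The frame of the affine chart\<close>

definition chart_frame :: "nat \<Rightarrow> (nat \<Rightarrow> real) \<Rightarrow> complex mat" where
  "chart_frame n v = 1\<^sub>m 4 @\<^sub>r chart_mat n v"

lemma chart_mat_carrier: "chart_mat n v \<in> carrier_mat n 4"
  by (simp add: chart_mat_def)

lemma chart_frame_carrier: "chart_frame n v \<in> carrier_mat (n + 4) 4"
  unfolding chart_frame_def
  using carrier_append_rows[OF one_carrier_mat chart_mat_carrier] by (simp add: add.commute)

lemma chart_frame_index:
  "p < n + 4 \<Longrightarrow> q < 4 \<Longrightarrow> chart_frame n v $$ (p, q) =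
    (if p < 4 then if p = q then 1 else 0 else chart_mat n v $$ (p - 4, q))"
  using carrier_matD[OF chart_mat_carrier[of n v]] by (auto simp: chart_frame_def append_rows_def)

lemma chart_frame_injective: "injective_mat (n + 4) 4 (chart_frame n v)"
proof
  show "chart_frame n v \<in> carrier_mat (n + 4) 4" by (rule chart_frame_carrier)
  fix x :: "complex vec" assume x: "x \<in> carrier_vec 4" "chart_frame n v *\<^sub>v x = 0\<^sub>v (n + 4)"
  have *: "x @\<^sub>v (chart_mat n v *\<^sub>v x) = 0\<^sub>v (n + 4)"
    using mat_mult_append[OF one_carrier_mat chart_mat_carrier x(1), of n v] x by (simp add: chart_frame_def)
  show "x = 0\<^sub>v 4"
  proof (rule eq_vecI)
    fix i assume i: "i < dim_vec (0\<^sub>v 4 :: complex vec)"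
    then have "x $ i = (x @\<^sub>v (chart_mat n v *\<^sub>v x)) $ i" using x(1) by simp
    then show "x $ i = 0\<^sub>v 4 $ i" using i by (simp add: *)
  qed (use x in simp)
qed

lemma partially_differentiable_chart_mat:
  assumes "p < n" "q < 4"
  shows "partially_differentiable i (\<lambda>v. chart_mat n v $$ (p, q)) u"
proof -
  have coord: "partially_differentiable i (\<lambda>v. complex_of_real (v j)) u" for j
    unfolding partially_differentiable_def by (cases "j = i") (auto intro!: bounded_linear_imp_differentiable bounded_linear_of_real)
  have "chart_mat n v $$ (p, q) = complex_of_real (v (2 * (4 * p + q))) +
      \<i> * complex_of_real (v (2 * (4 * p + q) + 1))" for v
    using assms by (simp add: chart_mat_def Complex_eq)
  then show ?thesis
    by (simp only:) (intro partially_differentiable_add partially_differentiable_mult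
      partially_differentiable_const coord)
qed

lemma chart_frame_family: "injective_family (n + 4) 4 (chart_frame n) u"
proof (intro injective_family.intro chart_frame_injective)
  fix p q i :: nat assume "p < n + 4" "q < 4"
  then show "partially_differentiable i (\<lambda>v. chart_frame n v $$ (p, q)) u"
    by (cases "p < 4")
      (auto simp: chart_frame_index intro!: partially_differentiable_const partially_differentiable_chart_mat)
qed

lemma d_entry_chart_frame:
  assumes "p < n + 4" "q < 4"
  shows "d_entry (chart_frame n) p q u = (if p < 4 then \<lambda>i. 0 else d_entry (chart_mat n) (p - 4) q u)"
  using assms unfolding d_entry_def
  by (auto simp: fun_eq_iff chart_frame_index intro!: partial_deriv_eqI)

lemma universal_quotient_chart:
  "universal_quotient (n + 4) (chart n v) = 1\<^sub>m (n + 4) - range_proj (chart_frame n v)"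
proof -
  interpret injective_mat "n + 4" 4 "chart_frame n v" by (rule chart_frame_injective)
  show ?thesis
    unfolding universal_quotient_def chart_eq_range
    using orth_proj_range by (simp add: chart_frame_def)
qed

text \<open>The shift by 4 skips the rows that belong to the constant identity block of the
  frame.\<close>

definition quotient_form :: "nat \<Rightarrow> (nat \<Rightarrow> real) \<Rightarrow> nat \<Rightarrow> nat \<Rightarrow> nat \<Rightarrow> complex" where
  "quotient_form n u j m = injective_family.B (n + 4) 4 (chart_frame n) u (j + 4) m"

text \<open>The Chern-Weil factor i/(2 pi) is absorbed into this side of the product.\<close>

definition coquotient_form :: "nat \<Rightarrow> (nat \<Rightarrow> real) \<Rightarrow> nat \<Rightarrow> nat \<Rightarrow> nat \<Rightarrow> complex" where
  "coquotient_form n u m j = (\<lambda>i. \<i> / (2 * complex_of_real pi) * cnj (d_entry (chart_mat n) j m u i))"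

text \<open>The determinants of sizes n+4 and n are both inverse to the same 4 x 4 determinant,
  hence equal. This cuts the number of 1-forms down to exactly 8n.\<close>

lemma total_chern_form_quotient:
  "total_chern_form (n + 4) (\<lambda>v. universal_quotient (n + 4) (chart n v)) u =
    det (1\<^sub>m n + wedge_mat n 4 n (quotient_form n u) (coquotient_form n u))"
proof -
  interpret injective_family "n + 4" 4 "chart_frame n" u by (rule chart_frame_family)
  let ?\<kappa> = "\<i> / (2 * complex_of_real pi)"
  let ?C = "\<lambda>m y i. ?\<kappa> * C m y i"
  let ?p = "det (1\<^sub>m (n + 4) + wedge_mat (n + 4) 4 (n + 4) B ?C)"
  let ?p' = "det (1\<^sub>m n + wedge_mat n 4 n (quotient_form n u) (coquotient_form n u))"
  let ?q = "det (1\<^sub>m 4 + wedge_mat 4 (n + 4) 4 ?C B)"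
  have p: "total_chern_form (n + 4) (\<lambda>v. universal_quotient (n + 4) (chart n v)) u = ?p"
    unfolding total_chern_form_def universal_quotient_chart curvature_eq wedge_mat_scale_right ..
  \<comment> \<open>After \<open>wedge_mat_C_B\<close> the first four summands contain differentials
    of constant entries and drop out.\<close>
  have "wedge_mat 4 (n + 4) 4 ?C B = wedge_mat 4 n 4 (coquotient_form n u) (quotient_form n u)"
  proof (rule eq_matI)
    fix m l assume "m < dim_row (wedge_mat 4 n 4 (coquotient_form n u) (quotient_form n u))"
      "l < dim_col (wedge_mat 4 n 4 (coquotient_form n u) (quotient_form n u))"
    then have ml: "m < 4" "l < 4" by (simp_all add: wedge_mat_def)
    let ?E = "\<lambda>r i. cnj (d_entry (chart_frame n) r m u i)"
    have E0: "wedge1 (?E r) (B r l) = 0" if "r < 4" for r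
    proof -
      have "?E r = (\<lambda>i. 0 * 0)" using that ml by (simp add: d_entry_chart_frame)
      then show ?thesis using wedge1_scale_left[of 0 "\<lambda>_. 0" "B r l"] by (simp only: form_scale_simps)
    qed
    have "wedge_mat 4 (n + 4) 4 ?C B $$ (m, l) = form_scale ?\<kappa> (\<Sum>r<n + 4. wedge1 (?E r) (B r l))"
      unfolding wedge_mat_scale_left wedge_mat_C_B using ml by (simp add: wedge_mat_def)
    also have "(\<Sum>r<n + 4. wedge1 (?E r) (B r l)) = (\<Sum>r=4..<n + 4. wedge1 (?E r) (B r l))"
      by (rule sum.mono_neutral_right) (auto simp: E0)
    also have "\<dots> = (\<Sum>j<n. wedge1 (?E (j + 4)) (B (j + 4) l))"
      by (rule sum.reindex_bij_witness[of _ "\<lambda>j. j + 4" "\<lambda>r. r - 4"]) auto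
    also have "form_scale ?\<kappa> \<dots> = wedge_mat 4 n 4 (coquotient_form n u) (quotient_form n u) $$ (m, l)"
      using ml
      by (simp add: wedge_mat_index coquotient_form_def quotient_form_def form_scale_sum
        d_entry_chart_frame wedge1_scale_left del: times_divide_eq_left)
    finally show "wedge_mat 4 (n + 4) 4 ?C B $$ (m, l) =
      wedge_mat 4 n 4 (coquotient_form n u) (quotient_form n u) $$ (m, l)" .
  qed (simp_all add: wedge_mat_def)
  then have "?p' * ?q = 1" using odd_sylvester[of n 4 "quotient_form n u" "coquotient_form n u"] by simp
  then have "?p = ?p * (?p' * ?q)" by simp
  also have "\<dots> = ?p' * (?p * ?q)" by (simp only: mult_ac)
  also have "?p * ?q = 1" by (rule odd_sylvester)
  finally have "?p = ?p'" by simp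
  then show ?thesis using p by simp
qed

section \<open>Chern forms of the universal quotient bundle\<close>

text \<open>One numbering of all 8n forms: \<open>4 * i + l\<close> stands for entry (i, l) of
  \<open>quotient_form\<close>, \<open>4 * (n + j) + l\<close> for entry (l, j) of
  \<open>coquotient_form\<close>.\<close>

definition chart_coframe :: "nat \<Rightarrow> (nat \<Rightarrow> real) \<Rightarrow> nat \<Rightarrow> nat \<Rightarrow> complex" where
  "chart_coframe n u p = (if p < 4 * n then quotient_form n u (p div 4) (p mod 4)
     else coquotient_form n u (p mod 4) (p div 4 - n))"

lemma constant_family_total_chern_form:
  "constant_family (chart_coframe n) (8 * n)
    (\<lambda>u. total_chern_form (n + 4) (\<lambda>v. universal_quotient (n + 4) (chart n v)) u)"
proof -
  let ?X = "\<lambda>u. 1\<^sub>m n + wedge_mat n 4 n (quotient_form n u) (coquotient_form n u)"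
  have "constant_family (chart_coframe n) (8 * n) (\<lambda>u. det (mat n n (\<lambda>ij. ?X u $$ ij)))"
  proof (rule constant_family_det)
    fix i j assume ij: "i < n" "j < n"
    have dm: "(4 * k + l) div 4 = k" "(4 * k + l) mod 4 = l" if "l < 4" for k l :: nat using that by simp_all
    have wedge: "wedge1 (quotient_form n u i l) (coquotient_form n u l j) =
        wedge1 (chart_coframe n u (4 * i + l)) (chart_coframe n u (4 * (n + j) + l))" if "l < 4" for u l
      unfolding chart_coframe_def dm[OF that] using ij that by simp
    have "?X u $$ (i, j) = (if i = j then 1 else 0) +
        (\<Sum>l<4. wedge1 (chart_coframe n u (4 * i + l)) (chart_coframe n u (4 * (n + j) + l)))" for u
      using ij carrier_matD[OF wedge_mat_carrier[of n 4 n "quotient_form n u" "coquotient_form n u"]]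
      by (simp add: wedge_mat_index wedge del: wedge_mat_carrier distrib_left_numeral)
    then show "constant_family (chart_coframe n) (8 * n) (\<lambda>u. ?X u $$ (i, j))"
      using ij by (cases "i = j")
        (auto intro!: constant_family.add constant_family_1 constant_family.zero constant_family_sum
          constant_family_wedge1)
  qed
  moreover have "mat n n (\<lambda>ij. ?X u $$ ij) = ?X u" for u
    by (rule eq_matI) (auto simp: wedge_mat_def)
  ultimately show ?thesis by (simp only: total_chern_form_quotient)
qed

lemma constant_family_sigma: "constant_family (chart_coframe n) (8 * n) (\<lambda>u. sigma n i u)"
proof -
  consider "i < 0 \<or> int n < i" | "i = 0" | "0 < i" "i \<le> int n" by linarith
  then show ?thesis
    using constant_family_homogeneous_part[OF constant_family_total_chern_form]
    by cases (simp_all add: sigma_def chern_form_def constant_family.zero constant_family_1)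
qed

lemma constant_family_sigma_seq: "constant_family (chart_coframe n) (8 * n) (\<lambda>u. sigma_seq n I u)"
  unfolding sigma_seq_def by (rule constant_family_det) (simp add: constant_family_sigma)

text \<open>
  The total Chern forms of the quotient bundle and of the rank 4 subbundle are inverse to each
  other already as forms, not only in cohomology.
\<close>
lemma sigma_recurrence:
  obtains e1 e2 e3 e4 where "\<And>i. 1 \<le> i \<Longrightarrow> sigma n i u =
    e1 * sigma n (i - 1) u - e2 * sigma n (i - 2) u + e3 * sigma n (i - 3) u - e4 * sigma n (i - 4) u"
proof
  let ?X = "wedge_mat n 4 n (quotient_form n u) (coquotient_form n u)"
  let ?Y = "wedge_mat 4 n 4 (coquotient_form n u) (quotient_form n u)"
  let ?p = "det (1\<^sub>m n + ?X)" and ?q = "det (1\<^sub>m 4 + ?Y)"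
  define t where "t j = homogeneous_part (2 * j) ?q" for j
  interpret X: two_form_matrix n ?X by (rule two_form_wedge_mat)
  interpret Y: two_form_matrix 4 ?Y by (rule two_form_wedge_mat)
  have deg: "max_degree (2 * k) (det (1\<^sub>m k + Z))" if "two_form_matrix k Z" for k Z
  proof -
    interpret Z: two_form_matrix k Z by fact
    have "max_degree 2 ((1\<^sub>m k + Z) $$ (i, j))" if ij: "i < k" "j < k" for i j
      using max_degree_add[of 2 "if i = j then 1 else 0", OF _ max_degree_two_form[OF Z.two_form[OF ij]]]
        carrier_matD[OF Z.carrier] ij by simp
    then show ?thesis by (rule max_degree_det[OF Z.carrier_simps(1)])
  qed
  have sigma: "sigma n (int i) u = homogeneous_part (2 * i) ?p" for i
  proof -
    consider "i = 0" | "0 < i" "i \<le> n" | "n < i" by linarith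
    then show ?thesis
    proof cases
      case 1
      then show ?thesis by (simp add: sigma_def homogeneous_part_0 X.const_coeff form_scale_simps)
    next
      case 2
      then show ?thesis by (simp add: sigma_def chern_form_def total_chern_form_quotient)
    next
      \<comment> \<open>The convention that \<sigma> vanishes beyond \<open>n\<close> agrees with
        the determinant: of size \<open>n\<close> with entries of degree at most 2, it has degree at
        most \<open>2 * n\<close>.\<close>
      case 3
      then show ?thesis
        using homogeneous_part_max_degree[OF deg[OF X.two_form_matrix_axioms], of "2 * i"] by (simp add: sigma_def)
    qed
  qed
  have t0: "t 0 = 1" by (simp add: t_def homogeneous_part_0 Y.const_coeff form_scale_simps)
  have t_zero: "t j = 0" if "4 < j" for j
    unfolding t_def using that by (intro homogeneous_part_max_degree[OF deg[OF Y.two_form_matrix_axioms]]) simp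
  fix i :: int assume i: "1 \<le> i"
  define m where "m = nat i"
  have m: "i = int m" "m \<ge> 1" using i by (simp_all add: m_def)
  have "homogeneous_part (2 * m) (?q * ?p) = 0"
    using odd_sylvester[of n 4 "quotient_form n u" "coquotient_form n u"] m(2)
    by (intro even_form_eqI) (auto simp: mult.commute)
  then have "0 = (\<Sum>j\<le>m. t j * sigma n (i - int j) u)"
    unfolding homogeneous_part_mult t_def m(1) by (simp add: sigma of_nat_diff[symmetric] del: of_nat_diff)
  \<comment> \<open>The ranges up to \<open>m\<close> and up to 4 are compared inside a common one:
    beyond \<open>m\<close> the index of \<sigma> is negative, beyond 4 the form \<open>t j\<close>
    vanishes.\<close>
  also have "\<dots> = (\<Sum>j\<le>4 + m. t j * sigma n (i - int j) u)"
    by (rule sum.mono_neutral_left) (auto simp: m(1) sigma_def)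
  also have "\<dots> = (\<Sum>j\<le>4. t j * sigma n (i - int j) u)"
    by (rule sum.mono_neutral_right) (auto simp: t_zero)
  also have "\<dots> = sigma n i u + t 1 * sigma n (i - 1) u + t 2 * sigma n (i - 2) u
      + t 3 * sigma n (i - 3) u + t 4 * sigma n (i - 4) u"
    by (simp add: eval_nat_numeral t0)
  \<comment> \<open>The witnesses are e_j = (-1)^j t_j, in the sign convention of elementary
    symmetric functions.\<close>
  finally show "sigma n i u = (- t 1) * sigma n (i - 1) u - t 2 * sigma n (i - 2) u
      + (- t 3) * sigma n (i - 3) u - t 4 * sigma n (i - 4) u"
    by (simp add: algebra_simps eq_neg_iff_add_eq_0)
qed

section \<open>Determinants built from a linear recurrence\<close>

lemma det_mat_expand:
  fixes f :: "nat \<times> nat \<Rightarrow> 'a :: comm_ring_1"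
  assumes "0 < n"
  shows "det (mat n n f) =
    (\<Sum>j<n. f (0, j) * ((- 1) ^ j * det (mat (n - 1) (n - 1) (\<lambda>(a, b). f (Suc a, if b < j then b else Suc b)))))"
proof -
  have "mat_delete (mat n n f) 0 j = mat (n - 1) (n - 1) (\<lambda>(a, b). f (Suc a, if b < j then b else Suc b))"
    if "j < n" for j
    using that by (intro eq_matI) (auto simp: mat_delete_def)
  then show ?thesis
    using assms by (subst laplace_expansion_row[of _ n 0]) (auto simp: cofactor_def intro!: sum.cong)
qed

definition det4 :: "(nat \<Rightarrow> 'a :: comm_ring_1) \<Rightarrow> (nat \<Rightarrow> 'a) \<Rightarrow> (nat \<Rightarrow> 'a) \<Rightarrow> (nat \<Rightarrow> 'a) \<Rightarrow> 'a" where
  "det4 a b c d = det (mat 4 4 (\<lambda>(s, r). ([a, b, c, d] ! s) r))"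

lemma det4_expand:
  "det4 a b c d =
     a 0 * (b 1 * (c 2 * d 3 - c 3 * d 2) - b 2 * (c 1 * d 3 - c 3 * d 1) + b 3 * (c 1 * d 2 - c 2 * d 1))
   - a 1 * (b 0 * (c 2 * d 3 - c 3 * d 2) - b 2 * (c 0 * d 3 - c 3 * d 0) + b 3 * (c 0 * d 2 - c 2 * d 0))
   + a 2 * (b 0 * (c 1 * d 3 - c 3 * d 1) - b 1 * (c 0 * d 3 - c 3 * d 0) + b 3 * (c 0 * d 1 - c 1 * d 0))
   - a 3 * (b 0 * (c 1 * d 2 - c 2 * d 1) - b 1 * (c 0 * d 2 - c 2 * d 0) + b 2 * (c 0 * d 1 - c 1 * d 0))"
proof -
  have sums: "sum f {..<4} = f 0 + f 1 + f 2 + f 3" "sum f {..<3} = f 0 + f 1 + f 2"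
    "sum f {..<2} = f 0 + f 1" "sum f {..<1} = f 0" for f :: "nat \<Rightarrow> 'a"
    by (simp_all add: eval_nat_numeral)
  have d: "det (mat 1 1 f) = f (0, 0)"
    "det (mat 2 2 f) = f (0, 0) * f (1, 1) - f (0, 1) * f (1, 0)" for f :: "nat \<times> nat \<Rightarrow> 'a"
    using det_mat_expand[of 1 f] det_mat_expand[of 2 f] det_mat_expand[of 1 "\<lambda>(a, b). f (Suc a, Suc b)"]
      det_mat_expand[of 1 "\<lambda>(a, b). f (Suc a, if b < 1 then b else Suc b)"]
    unfolding sums by simp_all
  have d3: "det (mat 3 3 f) = f (0, 0) * (f (1, 1) * f (2, 2) - f (1, 2) * f (2, 1))
      - f (0, 1) * (f (1, 0) * f (2, 2) - f (1, 2) * f (2, 0))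
      + f (0, 2) * (f (1, 0) * f (2, 1) - f (1, 1) * f (2, 0))" for f :: "nat \<times> nat \<Rightarrow> 'a"
    using det_mat_expand[of 3 f] unfolding sums by (simp add: d[unfolded numeral_2_eq_2] numeral_2_eq_2 algebra_simps)
  show ?thesis
    unfolding det4_def using det_mat_expand[of 4 "\<lambda>(s, r). ([a, b, c, d] ! s) r"]
    unfolding sums by (simp add: d3[unfolded numeral_2_eq_2 numeral_3_eq_3] numeral_2_eq_2 numeral_3_eq_3 algebra_simps)
qed

text \<open>The companion matrix of the recurrence: four consecutive terms in descending order are
  sent to the next such window.\<close>

definition row_step :: "'a :: comm_ring_1 \<Rightarrow> 'a \<Rightarrow> 'a \<Rightarrow> 'a \<Rightarrow> (nat \<Rightarrow> 'a) \<Rightarrow> nat \<Rightarrow> 'a" where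
  "row_step e1 e2 e3 e4 v i =
     (if i = 0 then e1 * v 0 - e2 * v 1 + e3 * v 2 - e4 * v 3 else v (i - 1))"

context
  fixes e1 e2 e3 e4 :: "'a :: comm_ring_1"
begin

private abbreviation "S \<equiv> row_step e1 e2 e3 e4"

text \<open>For every linear map S, applying S to k of the rows in all possible ways multiplies the
  determinant by a coefficient of the characteristic polynomial of S. For a companion matrix these
  are \<open>e1\<close>, \<open>e2\<close>, \<open>e3\<close>, which gives this lemma and the next
  two.\<close>

lemma det4_step_1:
  "det4 (S a) b c d + det4 a (S b) c d + det4 a b (S c) d + det4 a b c (S d) = e1 * det4 a b c d"
  by (simp add: det4_expand row_step_def algebra_simps)

lemma det4_step_2:
  "det4 (S a) (S b) c d + det4 (S a) b (S c) d + det4 (S a) b c (S d)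
    + det4 a (S b) (S c) d + det4 a (S b) c (S d) + det4 a b (S c) (S d) = e2 * det4 a b c d"
  by (simp add: det4_expand row_step_def algebra_simps)

lemma det4_step_3:
  "det4 a (S b) (S c) (S d) + det4 (S a) b (S c) (S d) + det4 (S a) (S b) c (S d) + det4 (S a) (S b) (S c) d
    = e3 * det4 a b c d"
  by (simp add: det4_expand row_step_def algebra_simps)

end

text \<open>Polynomials in \<open>Z, X1, \<dots>, X4\<close>; a monomial is given by its exponents.\<close>
type_synonym monomial = "nat \<times> nat \<times> nat \<times> nat \<times> nat"

definition monom5 :: "monomial \<Rightarrow> monomial \<Rightarrow>\<^sub>0 int" where
  "monom5 m = Poly_Mapping.single m 1"

lemma monom5_mult: "monom5 m * monom5 m' = monom5 (m + m')"
  by (simp add: monom5_def mult_single)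

lemma monom5_0: "monom5 0 = 1"
  by (simp add: monom5_def)

text \<open>Evaluation of polynomials in raising operators is additive but not multiplicative, so
  products are expanded formally and evaluated only afterwards.\<close>

definition linear_ext :: "(monomial \<Rightarrow> 'a :: comm_ring_1) \<Rightarrow> (monomial \<Rightarrow>\<^sub>0 int) \<Rightarrow> 'a" where
  "linear_ext \<phi> f = (\<Sum>m\<in>Poly_Mapping.keys f. of_int (Poly_Mapping.lookup f m) * \<phi> m)"

lemma linear_ext_superset:
  "finite A \<Longrightarrow> Poly_Mapping.keys f \<subseteq> A \<Longrightarrow> linear_ext \<phi> f = (\<Sum>m\<in>A. of_int (Poly_Mapping.lookup f m) * \<phi> m)"
  unfolding linear_ext_def by (rule sum.mono_neutral_left) (auto simp: in_keys_iff)

lemma linear_ext_add: "linear_ext \<phi> (f + g) = linear_ext \<phi> f + linear_ext \<phi> g"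
proof -
  let ?A = "Poly_Mapping.keys f \<union> Poly_Mapping.keys g"
  have "Poly_Mapping.keys (f + g) \<subseteq> ?A" by (rule Poly_Mapping.keys_add)
  then show ?thesis
    using linear_ext_superset[of ?A "f + g" \<phi>] linear_ext_superset[of ?A f \<phi>] linear_ext_superset[of ?A g \<phi>]
    by (simp add: lookup_add distrib_right sum.distrib)
qed

lemma linear_ext_0: "linear_ext \<phi> 0 = 0"
  by (simp add: linear_ext_def)

lemma linear_ext_monom5: "linear_ext \<phi> (monom5 m) = \<phi> m"
  by (simp add: linear_ext_def monom5_def)

lemma linear_ext_uminus: "linear_ext \<phi> (- f) = - linear_ext \<phi> f"
  using linear_ext_add[of \<phi> f "- f"] by (simp add: linear_ext_0 eq_neg_iff_add_eq_0 add.commute)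

lemma linear_ext_diff: "linear_ext \<phi> (f - g) = linear_ext \<phi> f - linear_ext \<phi> g"
  using linear_ext_add[of \<phi> f "- g"] by (simp add: linear_ext_uminus)

lemma linear_ext_sum: "linear_ext \<phi> (sum f A) = (\<Sum>x\<in>A. linear_ext \<phi> (f x))"
  by (induction A rule: infinite_finite_induct) (simp_all add: linear_ext_0 linear_ext_add)

lemma linear_ext_of_nat_mult: "linear_ext \<phi> (of_nat c * f) = of_nat c * linear_ext \<phi> f"
  by (induction c) (simp_all add: linear_ext_0 linear_ext_add distrib_right)

text \<open>Integer polynomials are generated by monomials under addition and negation, so
  identities between additive maps need checking on monomials only.\<close>

lemma monomial_induct [case_names monom add uminus]:
  assumes monom: "\<And>m. P (monom5 m)" and add: "\<And>f g. P f \<Longrightarrow> P g \<Longrightarrow> P (f + g)"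
    and uminus: "\<And>f. P f \<Longrightarrow> P (- f)"
  shows "P f"
proof (induction f rule: Poly_Mapping.update_induct)
  case const
  show ?case using add[OF monom[of 0] uminus[OF monom[of 0]]] by simp
next
  case (update f a b)
  have P0: "P 0" using add[OF monom[of 0] uminus[OF monom[of 0]]] by simp
  have nat: "P (Poly_Mapping.single a (int k))" for k
  proof (induction k)
    case (Suc k)
    have "Poly_Mapping.single a (int (Suc k)) = monom5 a + Poly_Mapping.single a (int k)"
      by (simp add: monom5_def single_add)
    then show ?case using Suc add monom by simp
  qed (simp add: P0)
  have "P (Poly_Mapping.single a b)"
  proof (cases "b \<ge> 0")
    case True
    then show ?thesis using nat[of "nat b"] by simp
  next
    case False
    then show ?thesis using uminus[OF nat[of "nat (- b)"]] by (simp add: single_uminus)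
  qed
  moreover have "Poly_Mapping.update a b f = Poly_Mapping.single a b + f"
    using update by (intro poly_mapping_eqI) (auto simp: lookup_update lookup_add lookup_single in_keys_iff)
  ultimately show ?case using update add by simp
qed

lemma monom5_power:
  "monom5 (k, p, q, r, s) ^ e = monom5 (e * k, e * p, e * q, e * r, e * s)"
  by (induction e) (simp_all add: monom5_mult flip: monom5_0 zero_prod_def)

definition "Z = monom5 (1, 0, 0, 0, 0)"
definition "X1 = monom5 (0, 1, 0, 0, 0)"
definition "X2 = monom5 (0, 0, 1, 0, 0)"
definition "X3 = monom5 (0, 0, 0, 1, 0)"
definition "X4 = monom5 (0, 0, 0, 0, 1)"

lemmas variable_defs = Z_def X1_def X2_def X3_def X4_def

lemma variables_power:
  "Z ^ k * X1 ^ p * X2 ^ q * X3 ^ r * X4 ^ s = monom5 (k, p, q, r, s)"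
  by (simp add: variable_defs monom5_power monom5_mult)

text \<open>
  \<open>h\<close> is the sequence of complete symmetric functions of four variables with elementary
  symmetric functions \<open>e1, \<dots>, e4\<close>.
\<close>
locale four_term_recurrence =
  fixes h :: "int \<Rightarrow> 'a :: comm_ring_1" and e1 e2 e3 e4 :: 'a
  assumes h_neg: "i < 0 \<Longrightarrow> h i = 0" and h_0: "h 0 = 1"
    and rec: "1 \<le> i \<Longrightarrow> h i = e1 * h (i - 1) - e2 * h (i - 2) + e3 * h (i - 3) - e4 * h (i - 4)"
begin

definition row :: "nat \<Rightarrow> nat \<Rightarrow> 'a" where
  "row i r = h (int i - int (r + 1))"

definition minor :: "nat \<Rightarrow> nat \<Rightarrow> nat \<Rightarrow> nat \<Rightarrow> 'a" where
  "minor i j k l = det4 (row i) (row j) (row k) (row l)"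

lemma det4_row_cong: "(\<And>r. r < 4 \<Longrightarrow> a r = a' r) \<Longrightarrow> (\<And>r. r < 4 \<Longrightarrow> b r = b' r) \<Longrightarrow>
  (\<And>r. r < 4 \<Longrightarrow> c r = c' r) \<Longrightarrow> (\<And>r. r < 4 \<Longrightarrow> d r = d' r) \<Longrightarrow> det4 a b c d = det4 a' b' c' d'"
  by (simp add: det4_expand)

text \<open>The bound on \<open>i\<close> matters in the first column: for \<open>i = 0\<close> the
  new entry is \<open>h 0 = 1\<close>, which the recurrence does not produce.\<close>

lemma row_Suc: "r < 4 \<Longrightarrow> 1 \<le> i \<Longrightarrow> row (Suc i) r = row_step e1 e2 e3 e4 (row i) r"
proof (cases "r = 0")
  case True
  assume "1 \<le> i"
  then show ?thesis using True rec[of "int i"] by (simp add: row_def row_step_def)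
next
  case False
  then show ?thesis by (simp add: row_def row_step_def of_nat_diff algebra_simps)
qed

text \<open>Pieri's rule without interlacing conditions: the indices may be in any order, and a
  raised sequence with equal entries simply contributes 0.\<close>

lemma minor_step:
  assumes "1 \<le> i" "1 \<le> j" "1 \<le> k" "1 \<le> l"
  shows "minor (Suc i) j k l + minor i (Suc j) k l + minor i j (Suc k) l + minor i j k (Suc l) = e1 * minor i j k l"
    and "minor (Suc i) (Suc j) k l + minor (Suc i) j (Suc k) l + minor (Suc i) j k (Suc l)
      + minor i (Suc j) (Suc k) l + minor i (Suc j) k (Suc l) + minor i j (Suc k) (Suc l) = e2 * minor i j k l"
    and "minor i (Suc j) (Suc k) (Suc l) + minor (Suc i) j (Suc k) (Suc l)
      + minor (Suc i) (Suc j) k (Suc l) + minor (Suc i) (Suc j) (Suc k) l = e3 * minor i j k l"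
proof -
  let ?S = "row_step e1 e2 e3 e4"
  \<comment> \<open>The Booleans mark the raised rows, so one congruence covers all the
    subsets.\<close>
  have S: "minor (if a then Suc i else i) (if b then Suc j else j) (if c then Suc k else k) (if d then Suc l else l) =
    det4 (if a then ?S (row i) else row i) (if b then ?S (row j) else row j)
      (if c then ?S (row k) else row k) (if d then ?S (row l) else row l)" for a b c d
    unfolding minor_def using assms by (intro det4_row_cong) (auto simp: row_Suc)
  note S' = S[of True False False False] S[of False True False False] S[of False False True False]
    S[of False False False True] S[of True True False False] S[of True False True False]
    S[of True False False True] S[of False True True False] S[of False True False True]
    S[of False False True True] S[of False True True True] S[of True False True True]
    S[of True True False True] S[of True True True False] S[of False False False False]
  note S'' = S'[unfolded if_True if_False]
  show "minor (Suc i) j k l + minor i (Suc j) k l + minor i j (Suc k) l + minor i j k (Suc l) = e1 * minor i j k l"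
    unfolding S'' by (rule det4_step_1)
  show "minor (Suc i) (Suc j) k l + minor (Suc i) j (Suc k) l + minor (Suc i) j k (Suc l)
      + minor i (Suc j) (Suc k) l + minor i (Suc j) k (Suc l) + minor i j (Suc k) (Suc l) = e2 * minor i j k l"
    unfolding S'' by (rule det4_step_2)
  show "minor i (Suc j) (Suc k) (Suc l) + minor (Suc i) j (Suc k) (Suc l)
      + minor (Suc i) (Suc j) k (Suc l) + minor (Suc i) (Suc j) (Suc k) l = e3 * minor i j k l"
    unfolding S'' by (rule det4_step_3)
qed

lemma minor_repeat:
  "minor i i k l = 0" "minor i j i l = 0" "minor i j k i = 0"
  "minor i j j l = 0" "minor i j k j = 0" "minor i j k k = 0"
  by (simp_all add: minor_def det4_expand algebra_simps)

lemma minor_1234: "minor 1 2 3 4 = 1"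
  by (simp add: minor_def det4_expand row_def h_0 h_neg)

lemma h_1: "h 1 = e1"
  using rec[of 1] by (simp add: h_0 h_neg)

lemma h_2: "h 2 = e1\<^sup>2 - e2"
  using rec[of 2] by (simp add: h_0 h_neg h_1 power2_eq_square)

text \<open>Of the six ways to raise two of the rows 1, 2, 3, 4, only raising the last two avoids
  equal rows. Likewise below for three rows.\<close>

lemma minor_1245: "minor 1 2 4 5 = e2"
  using minor_step(2)[of 1 2 3 4] unfolding Suc_1 Suc_numeral semiring_norm(2,5,8)
  by (simp add: minor_repeat minor_1234 del: One_nat_def)

lemma minor_1345: "minor 1 3 4 5 = e3"
  using minor_step(3)[of 1 2 3 4] unfolding Suc_1 Suc_numeral semiring_norm(2,5,8)
  by (simp add: minor_repeat minor_1234 del: One_nat_def)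

text \<open>The variables X1, ..., X4 raise the rows starting from 1, 2, 3, 4. \<open>Z\<close> is
  kept apart because powers of \<open>h 1\<close> must survive as the factor in
  \<open>schubert_degree\<close>.\<close>

fun value_of :: "monomial \<Rightarrow> 'a" where
  "value_of (k, p, q, r, s) = h 1 ^ k * minor (1 + p) (2 + q) (3 + r) (4 + s)"

abbreviation "L \<equiv> linear_ext value_of"

lemma L_z: "L (Z * f) = h 1 * L f"
proof (induction f rule: monomial_induct)
  case (monom m)
  obtain k p q r s where "m = (k, p, q, r, s)" by (cases m) auto
  then show ?case by (simp add: Z_def monom5_mult linear_ext_monom5)
qed (simp_all add: distrib_left linear_ext_add linear_ext_uminus)

lemma L_e1: "L ((X1 + X2 + X3 + X4) * f) = e1 * L f"
proof (induction f rule: monomial_induct)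
  case (monom m)
  obtain k p q r s where m: "m = (k, p, q, r, s)" by (cases m) auto
  show ?case
    using minor_step(1)[of "1 + p" "2 + q" "3 + r" "4 + s"]
    by (simp add: m variable_defs monom5_mult linear_ext_monom5 distrib_right linear_ext_add
      mult.left_commute[of e1] flip: distrib_left)
qed (simp_all only: distrib_left linear_ext_add linear_ext_uminus mult_minus_right)

lemma L_e2: "L ((X1 * X2 + X1 * X3 + X1 * X4 + X2 * X3 + X2 * X4 + X3 * X4) * f) = e2 * L f"
proof (induction f rule: monomial_induct)
  case (monom m)
  obtain k p q r s where m: "m = (k, p, q, r, s)" by (cases m) auto
  show ?case
    using minor_step(2)[of "1 + p" "2 + q" "3 + r" "4 + s"]
    by (simp add: m variable_defs monom5_mult linear_ext_monom5 distrib_right linear_ext_add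
      mult.left_commute[of e2] flip: distrib_left)
qed (simp_all only: distrib_left linear_ext_add linear_ext_uminus mult_minus_right)

lemma L_e3: "L ((X2 * X3 * X4 + X1 * X3 * X4 + X1 * X2 * X4 + X1 * X2 * X3) * f) = e3 * L f"
proof (induction f rule: monomial_induct)
  case (monom m)
  obtain k p q r s where m: "m = (k, p, q, r, s)" by (cases m) auto
  show ?case
    using minor_step(3)[of "1 + p" "2 + q" "3 + r" "4 + s"]
    by (simp add: m variable_defs monom5_mult linear_ext_monom5 distrib_right linear_ext_add
      mult.left_commute[of e3] flip: distrib_left)
qed (simp_all only: distrib_left linear_ext_add linear_ext_uminus mult_minus_right)

text \<open>
  Under \<open>L\<close> the variable \<open>Z\<close> may replace \<open>X1 + X2 + X3 + X4\<close>, which turns the ten monomials of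
  the complete symmetric polynomial of degree 2 into five terms.
\<close>
lemma L_h2: "L ((Z * X1 + X2 * (X3 + X4) + X3 * (X3 + X4) + X4\<^sup>2 + X2\<^sup>2) * f) = h 2 * L f"
proof -
  let ?e1 = "X1 + X2 + X3 + X4" and ?e2 = "X1 * X2 + X1 * X3 + X1 * X4 + X2 * X3 + X2 * X4 + X3 * X4"
  \<comment> \<open>The complete symmetric polynomial as e1^2 - e2, plus a bracket that
    \<open>L\<close> kills because \<open>h 1 = e1\<close>.\<close>
  have "(Z * X1 + X2 * (X3 + X4) + X3 * (X3 + X4) + X4\<^sup>2 + X2\<^sup>2) * f =
      ?e1 * (?e1 * f) - ?e2 * f + (Z * (X1 * f) - ?e1 * (X1 * f))"
    by (simp add: algebra_simps power2_eq_square)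
  then show ?thesis
    by (simp only: linear_ext_add linear_ext_diff L_e1 L_e2 L_z h_1 h_2) (simp add: algebra_simps power2_eq_square)
qed

lemma L_power: "(\<And>f. L (g * f) = c * L f) \<Longrightarrow> L (g ^ k * f) = c ^ k * L f"
  by (induction k arbitrary: f) (simp_all add: mult.assoc)

text \<open>The factors are peeled off one at a time, each by its own multiplication rule for
  \<open>L\<close>, down to \<open>L 1\<close>, which is the minor of 1, 2, 3, 4.\<close>

lemma L_product:
  "L (Z ^ a * (Z * X1 + X2 * (X3 + X4) + X3 * (X3 + X4) + X4\<^sup>2 + X2\<^sup>2) ^ b
      * (X1 * X2 + X1 * X3 + X1 * X4 + X2 * X3 + X2 * X4 + X3 * X4) ^ c
      * (X2 * X3 * X4 + X1 * X3 * X4 + X1 * X2 * X4 + X1 * X2 * X3) ^ d) =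
    h 1 ^ a * h 2 ^ b * minor 1 2 4 5 ^ c * minor 1 3 4 5 ^ d"
proof -
  have "L 1 = value_of (0, 0, 0, 0, 0)"
    using linear_ext_monom5[of value_of 0] unfolding monom5_0 by (simp only: zero_prod_def)
  then have "L 1 = 1" using minor_1234 by simp
  moreover have "L (g * 1) = L g" for g by simp
  ultimately show ?thesis
    using L_power[OF L_e3, of d 1]
    by (simp add: mult.assoc L_power[OF L_z] L_power[OF L_h2] L_power[OF L_e2] minor_1245 minor_1345 del: One_nat_def)
qed

end

section \<open>Multinomial expansion\<close>

lemma finite_weak_compositions: "finite (weak_compositions h m)"
proof (rule finite_subset)
  show "weak_compositions h m \<subseteq> {1..h} \<rightarrow>\<^sub>E {..m}"
  proof
    fix \<mu> assume \<mu>: "\<mu> \<in> weak_compositions h m"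
    then have "\<mu> i \<le> m" if "i \<in> {1..h}" for i
      using member_le_sum[of i "{1..h}" \<mu>] that by (auto simp: weak_compositions_def)
    then show "\<mu> \<in> {1..h} \<rightarrow>\<^sub>E {..m}" using \<mu> by (auto simp: weak_compositions_def PiE_def)
  qed
qed (simp add: finite_PiE)

text \<open>Makes the division in \<open>multinomial\<close> exact.\<close>

lemma prod_fact_dvd_fact_sum:
  "(\<Prod>i\<in>A. fact (f i)) dvd (fact (\<Sum>i\<in>A. f i) :: nat)"
proof (induction A rule: infinite_finite_induct)
  case (insert x A)
  then have "fact (f x) * (\<Prod>i\<in>A. fact (f i)) dvd (fact (f x) * fact (\<Sum>i\<in>A. f i) :: nat)"
    by (intro mult_dvd_mono) simp_all
  also have "\<dots> dvd fact (f x + (\<Sum>i\<in>A. f i))" by (rule fact_fact_dvd_fact)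
  finally show ?case using insert by simp
qed simp_all

lemma multinomial_Suc:
  assumes \<mu>: "\<mu> \<in> weak_compositions h k" and "k \<le> m"
  shows "multinomial (Suc h) m (\<mu>(Suc h := m - k)) = (m choose k) * multinomial h k \<mu>"
proof -
  let ?P = "\<Prod>i=1..h. fact (\<mu> i) :: nat"
  have "fact k = multinomial h k \<mu> * ?P"
    using prod_fact_dvd_fact_sum[of \<mu> "{1..h}"] \<mu> by (simp add: multinomial_def weak_compositions_def)
  moreover have "fact m = fact k * fact (m - k) * (m choose k)"
    using binomial_fact_lemma[OF assms(2)] by simp
  ultimately have "fact m = (m choose k) * multinomial h k \<mu> * (?P * fact (m - k))" by (simp add: mult_ac)
  moreover have "(\<Prod>i=1..Suc h. fact ((\<mu>(Suc h := m - k)) i)) = ?P * fact (m - k)" by simp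
  moreover have "?P * fact (m - k) > 0" by (simp add: prod_pos)
  ultimately show ?thesis unfolding multinomial_def[of "Suc h"] by (simp only:) simp
qed

lemma multinomial_theorem:
  fixes y :: "nat \<Rightarrow> 'a :: comm_ring_1"
  shows "(\<Sum>i=1..h. y i) ^ m =
    (\<Sum>\<mu>\<in>weak_compositions h m. of_nat (multinomial h m \<mu>) * (\<Prod>i=1..h. y i ^ \<mu> i))"
proof (induction h arbitrary: m)
  case 0
  \<comment> \<open>The only extensional function on the empty index set is constantly
    \<open>undefined\<close>.\<close>
  have "weak_compositions 0 m = (if m = 0 then {\<lambda>_. undefined} else {})"
    by (auto simp: weak_compositions_def)
  then show ?case by (cases "m = 0") (simp_all add: multinomial_def zero_power)
next
  case (Suc h)
  have "(\<Sum>i=1..Suc h. y i) ^ m = ((\<Sum>i=1..h. y i) + y (Suc h)) ^ m" by simp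
  also have "\<dots> = (\<Sum>k\<le>m. of_nat (m choose k) * (\<Sum>i=1..h. y i) ^ k * y (Suc h) ^ (m - k))"
    by (rule binomial_ring)
  also have "\<dots> = (\<Sum>(k, \<mu>)\<in>(SIGMA k:{..m}. weak_compositions h k). of_nat (m choose k) *
      (of_nat (multinomial h k \<mu>) * (\<Prod>i=1..h. y i ^ \<mu> i)) * y (Suc h) ^ (m - k))"
    unfolding Suc.IH by (simp add: sum_distrib_left sum_distrib_right sum.Sigma finite_weak_compositions)
  also have "\<dots> = (\<Sum>\<nu>\<in>weak_compositions (Suc h) m. of_nat (multinomial (Suc h) m \<nu>) * (\<Prod>i=1..Suc h. y i ^ \<nu> i))"
  \<comment> \<open>The last part is split off; resetting it to \<open>undefined\<close> keeps the
    shorter composition extensional.\<close>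
  proof (rule sum.reindex_bij_witness[where i = "\<lambda>\<nu>. (m - \<nu> (Suc h), \<nu>(Suc h := undefined))"
        and j = "\<lambda>(k, \<mu>). \<mu>(Suc h := m - k)"], goal_cases)
    case (1 p)
    then show ?case by (auto simp: weak_compositions_def fun_eq_iff PiE_def extensional_def)
  next
    case (2 p)
    then show ?case by (auto simp: weak_compositions_def PiE_def extensional_def)
  next
    case (3 \<nu>)
    then show ?case by (auto simp: weak_compositions_def fun_eq_iff PiE_def extensional_def)
  next
    case (4 \<nu>)
    then show ?case by (auto simp: weak_compositions_def PiE_def extensional_def)
  next
    case (5 p)
    then show ?case by (auto simp: multinomial_Suc mult_ac simp del: of_nat_mult) (simp add: mult_ac)
  qed
  finally show ?case .
qed

lemma mult_sum_sum:
  fixes c :: "'a :: comm_ring_1"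
  shows "c * (sum f A * sum g B) = (\<Sum>x\<in>A. \<Sum>y\<in>B. c * (f x * g y))"
  unfolding sum_product by (simp only: sum_distrib_left)

lemma mult_sum_sum_sum:
  fixes c :: "'a :: comm_ring_1"
  shows "c * sum f A * sum g B * sum h C = (\<Sum>x\<in>A. \<Sum>y\<in>B. \<Sum>w\<in>C. c * f x * g y * h w)"
proof -
  have "c * sum f A * sum g B * sum h C = (\<Sum>x\<in>A. c * f x) * (sum g B * sum h C)"
    by (simp only: sum_distrib_left[symmetric] mult.assoc)
  also have "\<dots> = (\<Sum>x\<in>A. \<Sum>y\<in>B. \<Sum>w\<in>C. c * f x * (g y * h w))"
    unfolding sum_product by (simp only: sum_distrib_left)
  finally show ?thesis by (simp only: mult.assoc)
qed

context four_term_recurrence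
begin

lemma binomial_x34: "(X3 + X4) ^ k = (\<Sum>l=0..k. of_nat (k choose l) * X3 ^ l * X4 ^ (k - l))"
  by (simp add: binomial_ring atLeast0AtMost)

text \<open>The powers of X3 + X4 coming from the second and third factors are kept apart; expanding
  them separately produces \<open>l\<close> and \<open>m\<close> with their two binomial
  coefficients.\<close>

lemma monomial_expansion:
  fixes \<beta> \<gamma> \<delta> :: "nat \<Rightarrow> nat"
  shows "Z ^ a * ((Z * X1) ^ \<beta> 1 * (X2 * (X3 + X4)) ^ \<beta> 2 * (X3 * (X3 + X4)) ^ \<beta> 3 * (X4\<^sup>2) ^ \<beta> 4 * (X2\<^sup>2) ^ \<beta> 5)
      * ((X1 * (X3 + X4)) ^ \<gamma> 1 * (X2 * (X3 + X4)) ^ \<gamma> 2 * (X3 * X4) ^ \<gamma> 3 * (X1 * X2) ^ \<gamma> 4)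
      * ((X2 * X3 * X4) ^ \<delta> 1 * (X1 * X3 * X4) ^ \<delta> 2 * (X1 * X2 * X4) ^ \<delta> 3 * (X1 * X2 * X3) ^ \<delta> 4) =
    (\<Sum>l=0..\<beta> 2 + \<beta> 3. \<Sum>m=0..\<gamma> 1 + \<gamma> 2. of_nat (((\<beta> 2 + \<beta> 3) choose l) * ((\<gamma> 1 + \<gamma> 2) choose m)) *
      monom5 (a + \<beta> 1, (\<Sum>j\<in>{1..4} - {1}. \<delta> j) + \<gamma> 1 + \<gamma> 4 + \<beta> 1,
        (\<Sum>j\<in>{1..4} - {2}. \<delta> j) + \<gamma> 2 + \<gamma> 4 + \<beta> 2 + 2 * \<beta> 5,
        (\<Sum>j\<in>{1..4} - {3}. \<delta> j) + \<gamma> 3 + \<beta> 3 + l + m,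
        (\<Sum>j\<in>{1..4} - {4}. \<delta> j) + \<gamma> 3 + 2 * \<beta> 4 + (\<beta> 2 + \<beta> 3 - l) + (\<gamma> 1 + \<gamma> 2 - m)))"
    (is "?lhs = _")
proof -
  have sets: "{1..4} - {1} = {2, 3, 4::nat}" "{1..4} - {2} = {1, 3, 4::nat}"
    "{1..4} - {3} = {1, 2, 4::nat}" "{1..4} - {4} = {1, 2, 3::nat}" by auto
  have "?lhs = Z ^ (a + \<beta> 1) * X1 ^ (\<delta> 2 + \<delta> 3 + \<delta> 4 + \<gamma> 1 + \<gamma> 4 + \<beta> 1)
      * X2 ^ (\<delta> 1 + \<delta> 3 + \<delta> 4 + \<gamma> 2 + \<gamma> 4 + \<beta> 2 + 2 * \<beta> 5)
      * X3 ^ (\<delta> 1 + \<delta> 2 + \<delta> 4 + \<gamma> 3 + \<beta> 3) * X4 ^ (\<delta> 1 + \<delta> 2 + \<delta> 3 + \<gamma> 3 + 2 * \<beta> 4)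
      * ((X3 + X4) ^ (\<beta> 2 + \<beta> 3) * (X3 + X4) ^ (\<gamma> 1 + \<gamma> 2))"
    by (simp only: power_mult_distrib power_add power_mult[symmetric] mult_ac)
  also have "\<dots> = (\<Sum>l=0..\<beta> 2 + \<beta> 3. \<Sum>m=0..\<gamma> 1 + \<gamma> 2.
      of_nat (((\<beta> 2 + \<beta> 3) choose l) * ((\<gamma> 1 + \<gamma> 2) choose m)) * (Z ^ (a + \<beta> 1)
      * X1 ^ (\<delta> 2 + \<delta> 3 + \<delta> 4 + \<gamma> 1 + \<gamma> 4 + \<beta> 1)
      * X2 ^ (\<delta> 1 + \<delta> 3 + \<delta> 4 + \<gamma> 2 + \<gamma> 4 + \<beta> 2 + 2 * \<beta> 5)
      * X3 ^ (\<delta> 1 + \<delta> 2 + \<delta> 4 + \<gamma> 3 + \<beta> 3 + l + m)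
      * X4 ^ (\<delta> 1 + \<delta> 2 + \<delta> 3 + \<gamma> 3 + 2 * \<beta> 4 + (\<beta> 2 + \<beta> 3 - l) + (\<gamma> 1 + \<gamma> 2 - m))))"
    unfolding binomial_x34 mult_sum_sum
    by (intro sum.cong refl) (simp only: power_add of_nat_mult mult_ac)
  finally show ?thesis
    unfolding variables_power sets by (simp add: add.assoc)
qed

lemma pieri_expansion:
  "h 1 ^ a * h 2 ^ b * minor 1 2 4 5 ^ c * minor 1 3 4 5 ^ d =
    (\<Sum>\<beta>\<in>weak_compositions 5 b. \<Sum>\<gamma>\<in>weak_compositions 4 c. \<Sum>\<delta>\<in>weak_compositions 4 d.
     \<Sum>l=0..\<beta> 2 + \<beta> 3. \<Sum>m=0..\<gamma> 1 + \<gamma> 2.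
       of_nat (multinomial 5 b \<beta> * multinomial 4 c \<gamma> * multinomial 4 d \<delta>
         * ((\<beta> 2 + \<beta> 3) choose l) * ((\<gamma> 1 + \<gamma> 2) choose m))
       * (h 1 ^ (a + \<beta> 1) * minor
         (1 + (\<Sum>j\<in>{1..4} - {1}. \<delta> j) + \<gamma> 1 + \<gamma> 4 + \<beta> 1)
         (2 + (\<Sum>j\<in>{1..4} - {2}. \<delta> j) + \<gamma> 2 + \<gamma> 4 + \<beta> 2 + 2 * \<beta> 5)
         (3 + (\<Sum>j\<in>{1..4} - {3}. \<delta> j) + \<gamma> 3 + \<beta> 3 + l + m)
         (4 + (\<Sum>j\<in>{1..4} - {4}. \<delta> j) + \<gamma> 1 + \<gamma> 2 + \<gamma> 3 + \<beta> 2 + 2 * \<beta> 4 + \<beta> 3 - l - m)))"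
proof -
  \<comment> \<open>Compositions are indexed from 1, lists from 0. Factoring out X3 + X4 leaves four
    terms of e2 instead of six; \<open>yd i\<close> omits the i-th variable, whence the sums over j
    different from i.\<close>
  define yb where "yb i = [Z * X1, X2 * (X3 + X4), X3 * (X3 + X4), X4\<^sup>2, X2\<^sup>2] ! (i - 1)" for i
  define yc where "yc i = [X1 * (X3 + X4), X2 * (X3 + X4), X3 * X4, X1 * X2] ! (i - 1)" for i
  define yd where "yd i = [X2 * X3 * X4, X1 * X3 * X4, X1 * X2 * X4, X1 * X2 * X3] ! (i - 1)" for i
  have sums: "sum f {1..4} = f 1 + f 2 + f 3 + f 4" "sum f {1..5} = f 1 + f 2 + f 3 + f 4 + f 5"
    for f :: "nat \<Rightarrow> monomial \<Rightarrow>\<^sub>0 int"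
    by (simp_all add: eval_nat_numeral)
  have prods: "prod f {1..4} = f 1 * f 2 * f 3 * f 4" "prod f {1..5} = f 1 * f 2 * f 3 * f 4 * f 5"
    for f :: "nat \<Rightarrow> monomial \<Rightarrow>\<^sub>0 int"
    by (simp_all add: eval_nat_numeral)
  have nths: "yb 1 = Z * X1" "yb 2 = X2 * (X3 + X4)" "yb 3 = X3 * (X3 + X4)" "yb 4 = X4\<^sup>2" "yb 5 = X2\<^sup>2"
    "yc 1 = X1 * (X3 + X4)" "yc 2 = X2 * (X3 + X4)" "yc 3 = X3 * X4" "yc 4 = X1 * X2"
    "yd 1 = X2 * X3 * X4" "yd 2 = X1 * X3 * X4" "yd 3 = X1 * X2 * X4" "yd 4 = X1 * X2 * X3"
    by (simp_all add: yb_def yc_def yd_def eval_nat_numeral)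
  have e2: "X1 * X2 + X1 * X3 + X1 * X4 + X2 * X3 + X2 * X4 + X3 * X4 = sum yc {1..4}"
    unfolding sums nths by (simp add: algebra_simps)
  have "h 1 ^ a * h 2 ^ b * minor 1 2 4 5 ^ c * minor 1 3 4 5 ^ d =
      L (Z ^ a * sum yb {1..5} ^ b * sum yc {1..4} ^ c * sum yd {1..4} ^ d)"
    unfolding L_product[symmetric] e2 unfolding sums nths ..
  also have "Z ^ a * sum yb {1..5} ^ b * sum yc {1..4} ^ c * sum yd {1..4} ^ d =
    (\<Sum>\<beta>\<in>weak_compositions 5 b. \<Sum>\<gamma>\<in>weak_compositions 4 c. \<Sum>\<delta>\<in>weak_compositions 4 d.
      of_nat (multinomial 5 b \<beta> * multinomial 4 c \<gamma> * multinomial 4 d \<delta>)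
      * (Z ^ a * (\<Prod>i=1..5. yb i ^ \<beta> i) * (\<Prod>i=1..4. yc i ^ \<gamma> i) * (\<Prod>i=1..4. yd i ^ \<delta> i)))"
    unfolding multinomial_theorem mult_sum_sum_sum
    by (intro sum.cong refl) (simp only: of_nat_mult mult_ac)
  also have "L \<dots> = (\<Sum>\<beta>\<in>weak_compositions 5 b. \<Sum>\<gamma>\<in>weak_compositions 4 c. \<Sum>\<delta>\<in>weak_compositions 4 d.
      of_nat (multinomial 5 b \<beta> * multinomial 4 c \<gamma> * multinomial 4 d \<delta>)
      * L (Z ^ a * (\<Prod>i=1..5. yb i ^ \<beta> i) * (\<Prod>i=1..4. yc i ^ \<gamma> i) * (\<Prod>i=1..4. yd i ^ \<delta> i)))"
    by (simp only: linear_ext_sum linear_ext_of_nat_mult)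
  also have "\<dots> = (\<Sum>\<beta>\<in>weak_compositions 5 b. \<Sum>\<gamma>\<in>weak_compositions 4 c. \<Sum>\<delta>\<in>weak_compositions 4 d.
     \<Sum>l=0..\<beta> 2 + \<beta> 3. \<Sum>m=0..\<gamma> 1 + \<gamma> 2.
       of_nat (multinomial 5 b \<beta> * multinomial 4 c \<gamma> * multinomial 4 d \<delta>
         * ((\<beta> 2 + \<beta> 3) choose l) * ((\<gamma> 1 + \<gamma> 2) choose m))
       * (h 1 ^ (a + \<beta> 1) * minor
         (1 + (\<Sum>j\<in>{1..4} - {1}. \<delta> j) + \<gamma> 1 + \<gamma> 4 + \<beta> 1)
         (2 + (\<Sum>j\<in>{1..4} - {2}. \<delta> j) + \<gamma> 2 + \<gamma> 4 + \<beta> 2 + 2 * \<beta> 5)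
         (3 + (\<Sum>j\<in>{1..4} - {3}. \<delta> j) + \<gamma> 3 + \<beta> 3 + l + m)
         (4 + (\<Sum>j\<in>{1..4} - {4}. \<delta> j) + \<gamma> 1 + \<gamma> 2 + \<gamma> 3 + \<beta> 2 + 2 * \<beta> 4 + \<beta> 3 - l - m)))"
  proof (intro sum.cong refl)
    fix \<beta> \<gamma> \<delta> :: "nat \<Rightarrow> nat"
    \<comment> \<open>The truncated subtractions may be regrouped because \<open>l\<close> and
      \<open>m\<close> stay within their bounds.\<close>
    have last: "4 + ((\<Sum>j\<in>{1..4} - {4}. \<delta> j) + \<gamma> 3 + 2 * \<beta> 4 + (\<beta> 2 + \<beta> 3 - l) + (\<gamma> 1 + \<gamma> 2 - m)) =
        4 + (\<Sum>j\<in>{1..4} - {4}. \<delta> j) + \<gamma> 1 + \<gamma> 2 + \<gamma> 3 + \<beta> 2 + 2 * \<beta> 4 + \<beta> 3 - l - m"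
      if "l \<in> {0..\<beta> 2 + \<beta> 3}" "m \<in> {0..\<gamma> 1 + \<gamma> 2}" for l m
      using that by simp
    show "of_nat (multinomial 5 b \<beta> * multinomial 4 c \<gamma> * multinomial 4 d \<delta>)
      * L (Z ^ a * (\<Prod>i=1..5. yb i ^ \<beta> i) * (\<Prod>i=1..4. yc i ^ \<gamma> i) * (\<Prod>i=1..4. yd i ^ \<delta> i)) =
      (\<Sum>l=0..\<beta> 2 + \<beta> 3. \<Sum>m=0..\<gamma> 1 + \<gamma> 2.
       of_nat (multinomial 5 b \<beta> * multinomial 4 c \<gamma> * multinomial 4 d \<delta>
         * ((\<beta> 2 + \<beta> 3) choose l) * ((\<gamma> 1 + \<gamma> 2) choose m))
       * (h 1 ^ (a + \<beta> 1) * minor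
         (1 + (\<Sum>j\<in>{1..4} - {1}. \<delta> j) + \<gamma> 1 + \<gamma> 4 + \<beta> 1)
         (2 + (\<Sum>j\<in>{1..4} - {2}. \<delta> j) + \<gamma> 2 + \<gamma> 4 + \<beta> 2 + 2 * \<beta> 5)
         (3 + (\<Sum>j\<in>{1..4} - {3}. \<delta> j) + \<gamma> 3 + \<beta> 3 + l + m)
         (4 + (\<Sum>j\<in>{1..4} - {4}. \<delta> j) + \<gamma> 1 + \<gamma> 2 + \<gamma> 3 + \<beta> 2 + 2 * \<beta> 4 + \<beta> 3 - l - m)))"
      unfolding prods nths monomial_expansion linear_ext_sum linear_ext_of_nat_mult linear_ext_monom5
        value_of.simps sum_distrib_left
      by (intro sum.cong refl) (simp only: last, simp only: of_nat_mult mult.assoc add.assoc)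
  qed
  finally show ?thesis .
qed

end

section \<open>Degrees of Schubert varieties\<close>

lemma sigma_seq_permute:
  assumes \<tau>: "\<tau> permutes {..<4}" and I: "length I = 4"
  shows "sigma_seq n (permute_list \<tau> I) u = signof \<tau> * sigma_seq n I u"
proof -
  let ?A = "mat 4 4 (\<lambda>(s, r). sigma n (int (I ! s) - int (r + 1)) u)"
  have "\<tau> s < 4" if "s < 4" for s using permutes_in_image[OF \<tau>, of s] that by simp
  then have "mat 4 4 (\<lambda>(s, r). sigma n (int (permute_list \<tau> I ! s) - int (r + 1)) u) =
      mat 4 4 (\<lambda>(s, r). ?A $$ (\<tau> s, r))"
    using I by (intro eq_matI) (auto simp: permute_list_def)
  then show ?thesis
    unfolding sigma_seq_def using det_permute_rows[of ?A 4 \<tau>] \<tau> by (simp add: atLeast0LessThan)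
qed

lemma sigma_seq_not_distinct:
  assumes J: "length J = 4" "\<not> distinct J"
  shows "sigma_seq n J u = 0"
proof -
  obtain s t where st: "s < 4" "t < 4" "s \<noteq> t" "J ! s = J ! t"
    using J by (auto simp: distinct_conv_nth)
  show ?thesis unfolding sigma_seq_def
    by (rule det_identical_rows[of _ 4 s t]) (use st in \<open>auto intro!: eq_vecI\<close>)
qed

text \<open>From j >= n + 5 every index in that row is at least n + 1, so the row is zero. The
  convention for entries beyond n + 4 is thus automatic.\<close>

lemma sigma_seq_too_large:
  assumes J: "length J = 4" "j \<in> set J" "n + 4 < j"
  shows "sigma_seq n J u = 0"
proof -
  obtain s where s: "s < 4" "J ! s = j" using J by (auto simp: in_set_conv_nth)
  have "sigma n (int (J ! s) - int (r + 1)) u = 0" if "r < 4" for r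
    using that s J(3) by (simp add: sigma_def)
  then show ?thesis
    unfolding sigma_seq_def using s by (subst laplace_expansion_row[of _ 4 s]) auto
qed

text \<open>Makes the truncated subtractions in \<open>schubert_degree\<close> exact.\<close>

lemma strict_sorted_nth_ge:
  assumes "sorted_wrt (<) (I :: nat list)" "\<And>i. i \<in> set I \<Longrightarrow> 1 \<le> i" "s < length I"
  shows "s + 1 \<le> I ! s"
  using assms(3)
proof (induction s)
  case 0
  then show ?case using assms(2) by simp
next
  case (Suc s)
  then show ?case using sorted_wrt_nth_less[OF assms(1), of s "Suc s"] by simp
qed

text \<open>The determinant \<open>sigma_seq\<close> is itself alternating and vanishes in the
  excluded cases, so the sorting and the sign in \<open>omega\<close> disappear. Since 10 = 1 + 2 +
  3 + 4, the exponent is 4n - w.\<close>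

lemma omega_eq_integral:
  assumes J: "length J = 4" "\<And>j. j \<in> set J \<Longrightarrow> 1 \<le> j"
  shows "omega n J =
    grassmannian_integral n (\<lambda>u. sigma n 1 u ^ (4 * n + 10 - sum_list J) * sigma_seq n J u)"
proof (cases "distinct J \<and> set J \<subseteq> {1..n + 4}")
  case False
  then have "sigma_seq n J u = 0" for u
    using sigma_seq_not_distinct[OF J(1)] sigma_seq_too_large[OF J(1)] J(2)
    by (metis atLeastAtMost_iff not_le subsetI)
  then have "grassmannian_integral n (\<lambda>u. sigma n 1 u ^ (4 * n + 10 - sum_list J) * sigma_seq n J u) = 0"
    by (simp add: grassmannian_integral_def)
  then show ?thesis using False by (auto simp: omega_def)
next
  case True
  define I where "I = sort J"
  have I: "length I = 4" "sorted_wrt (<) I" "distinct I" "set I = set J"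
    using J True by (auto simp: I_def strict_sorted_iff)
  have "mset J = mset I" by (simp add: I_def)
  then obtain \<tau> where \<tau>: "\<tau> permutes {..<4}" "permute_list \<tau> I = J"
    using mset_eq_permutation I(1) by metis
  \<comment> \<open>Uniqueness of the sorting permutation comes from the distinct entries of
    \<open>I\<close>.\<close>
  have the: "(THE \<tau>. \<tau> permutes {..<4} \<and> J = permute_list \<tau> I) = \<tau>"
  proof (rule the_equality)
    fix \<rho> assume \<rho>: "\<rho> permutes {..<4} \<and> J = permute_list \<rho> I"
    show "\<rho> = \<tau>"
    proof
      fix s
      show "\<rho> s = \<tau> s"
      proof (cases "s < 4")
        case True
        have "I ! \<rho> s = I ! \<tau> s"
          using \<rho> \<tau> True I(1) by (metis permute_list_nth)
        moreover have "\<rho> s < 4" "\<tau> s < 4"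
          using permutes_in_image[of \<rho> "{..<4}" s] permutes_in_image[of \<tau> "{..<4}" s] \<rho> \<tau> True by simp_all
        ultimately show ?thesis using nth_eq_iff_index_eq[OF I(3)] I(1) by simp
      next
        case False
        then show ?thesis
          using permutes_not_in[of \<rho> "{..<4}" s] permutes_not_in[of \<tau> "{..<4}" s] \<rho> \<tau> by simp
      qed
    qed
  qed (use \<tau> in simp)
  have ge: "s + 1 \<le> I ! s" if "s < 4" for s
    using strict_sorted_nth_ge[OF I(2), of s] that I J by auto
  have "(\<Sum>s<4. I ! s) = sum_list I"
    using I(1) by (simp add: sum_list_sum_nth atLeast0LessThan)
  also have "\<dots> = sum_list J" using \<open>mset J = mset I\<close> by (metis sum_mset_sum_list)
  moreover have "(\<Sum>s<4. s + 1) = (10::nat)" by (simp add: eval_nat_numeral)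
  moreover have "(\<Sum>s<4. I ! s - (s + 1)) + (\<Sum>s<4. s + 1) = (\<Sum>s<4. I ! s)"
    unfolding sum.distrib[symmetric] by (rule sum.cong[OF refl], rule le_add_diff_inverse2, rule ge) simp
  ultimately have w: "4 * n - (\<Sum>s<4. I ! s - (s + 1)) = 4 * n + 10 - sum_list J" by linarith
  let ?k = "4 * n + 10 - sum_list J"
  have "omega n J = of_int (sign \<tau>) * grassmannian_integral n (\<lambda>u. sigma n 1 u ^ ?k * sigma_seq n I u)"
    unfolding omega_def I_def[symmetric] the schubert_degree_def Let_def w using True by simp
  also have "\<dots> = grassmannian_integral n (\<lambda>u. sigma n 1 u ^ ?k * sigma_seq n J u)"
    using sigma_seq_permute[OF \<tau>(1) I(1), of n] \<tau>(2)
    by (cases \<tau> rule: sign_cases) (simp_all add: grassmannian_integral_uminus)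
  finally show ?thesis .
qed

lemma grassmannian_integral_of_nat_mult:
  "grassmannian_integral n (\<lambda>u. of_nat c * \<alpha> u) = of_nat c * grassmannian_integral n \<alpha>"
proof -
  have "of_nat c * \<alpha> u = form_scale (of_nat c) (\<alpha> u)" for u
  proof (induction c)
    case (Suc c)
    then show ?case by (intro even_form_eqI) (simp add: distrib_right)
  qed (simp add: form_scale_simps)
  then show ?thesis by (simp add: grassmannian_integral_scale)
qed

theorem theorem5p10:
  fixes n a b c d :: nat
  assumes "a + 2 * b + 2 * c + 3 * d = 4 * n"
  shows "f_number n a b c d =
    (\<Sum>\<beta> \<in> weak_compositions 5 b. \<Sum>\<gamma> \<in> weak_compositions 4 c. \<Sum>\<delta> \<in> weak_compositions 4 d.
     \<Sum>l = 0..\<beta> 2 + \<beta> 3. \<Sum>m = 0..\<gamma> 1 + \<gamma> 2.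
       of_nat (multinomial 5 b \<beta> * multinomial 4 c \<gamma> * multinomial 4 d \<delta>
         * ((\<beta> 2 + \<beta> 3) choose l) * ((\<gamma> 1 + \<gamma> 2) choose m))
       * omega n
         [1 + (\<Sum>j \<in> {1..4} - {1}. \<delta> j) + \<gamma> 1 + \<gamma> 4 + \<beta> 1,
          2 + (\<Sum>j \<in> {1..4} - {2}. \<delta> j) + \<gamma> 2 + \<gamma> 4 + \<beta> 2 + 2 * \<beta> 5,
          3 + (\<Sum>j \<in> {1..4} - {3}. \<delta> j) + \<gamma> 3 + \<beta> 3 + l + m,
          4 + (\<Sum>j \<in> {1..4} - {4}. \<delta> j) + \<gamma> 1 + \<gamma> 2 + \<gamma> 3 + \<beta> 2 + 2 * \<beta> 4 + \<beta> 3 - l - m])"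
proof -
  define J where "J \<beta> \<gamma> \<delta> l m =
     [1 + (\<Sum>j \<in> {1..4} - {1}. \<delta> j) + \<gamma> 1 + \<gamma> 4 + \<beta> 1,
      2 + (\<Sum>j \<in> {1..4} - {2}. \<delta> j) + \<gamma> 2 + \<gamma> 4 + \<beta> 2 + 2 * \<beta> 5,
      3 + (\<Sum>j \<in> {1..4} - {3}. \<delta> j) + \<gamma> 3 + \<beta> 3 + l + m,
      4 + (\<Sum>j \<in> {1..4} - {4}. \<delta> j) + \<gamma> 1 + \<gamma> 2 + \<gamma> 3 + \<beta> 2 + 2 * \<beta> 4 + \<beta> 3 - l - m]"
    for \<beta> \<gamma> \<delta> :: "nat \<Rightarrow> nat" and l m
  define K where "K \<beta> \<gamma> \<delta> l m = multinomial 5 b \<beta> * multinomial 4 c \<gamma> * multinomial 4 d \<delta>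
      * ((\<beta> 2 + \<beta> 3) choose l) * ((\<gamma> 1 + \<gamma> 2) choose m)" for \<beta> \<gamma> \<delta> l m
  define T where "T \<beta> \<gamma> \<delta> l m u = sigma n 1 u ^ (a + \<beta> 1) * sigma_seq n (J \<beta> \<gamma> \<delta> l m) u"
    for \<beta> \<gamma> \<delta> l m u
  let ?const = "constant_family (chart_coframe n) (8 * n)"
  \<comment> \<open>An identity of forms at each point of the chart, before any integration.\<close>
  have pointwise: "sigma n 1 u ^ a * sigma n 2 u ^ b * sigma_seq n [1, 2, 4, 5] u ^ c * sigma_seq n [1, 3, 4, 5] u ^ d =
    (\<Sum>\<beta> \<in> weak_compositions 5 b. \<Sum>\<gamma> \<in> weak_compositions 4 c. \<Sum>\<delta> \<in> weak_compositions 4 d.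
     \<Sum>l = 0..\<beta> 2 + \<beta> 3. \<Sum>m = 0..\<gamma> 1 + \<gamma> 2. of_nat (K \<beta> \<gamma> \<delta> l m) * T \<beta> \<gamma> \<delta> l m u)" for u
  proof -
    obtain e1 e2 e3 e4 where rec: "\<And>i. 1 \<le> i \<Longrightarrow> sigma n i u =
      e1 * sigma n (i - 1) u - e2 * sigma n (i - 2) u + e3 * sigma n (i - 3) u - e4 * sigma n (i - 4) u"
      using sigma_recurrence[of n u] by blast
    interpret four_term_recurrence "\<lambda>i. sigma n i u" e1 e2 e3 e4
      by unfold_locales (simp_all add: sigma_def[of n 0] rec, simp add: sigma_def)
    have "minor i j k l = sigma_seq n [i, j, k, l] u" for i j k l
    proof -
      have "mat 4 4 (\<lambda>(s, r). ([row i, row j, row k, row l] ! s) r) =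
          mat 4 4 (\<lambda>(s, r). sigma n (int ([i, j, k, l] ! s) - int (r + 1)) u)"
        by (rule eq_matI) (auto simp: row_def less_Suc_eq numeral_eq_Suc)
      then show ?thesis by (simp add: minor_def det4_def sigma_seq_def)
    qed
    then show ?thesis using pieri_expansion[of a b c d] unfolding T_def J_def K_def by simp
  qed
  have const_T: "?const (\<lambda>u. of_nat k * T \<beta> \<gamma> \<delta> l m u)" for k \<beta> \<gamma> \<delta> l m
  proof -
    have "?const (\<lambda>u. of_nat k)"
      by (induction k) (auto intro: constant_family.zero constant_family.add constant_family_1)
    then show ?thesis
      unfolding T_def
      by (intro constant_family_mult constant_family_power constant_family_sigma constant_family_sigma_seq)
  qed
  have omega: "grassmannian_integral n (\<lambda>u. of_nat k * T \<beta> \<gamma> \<delta> l m u) = of_nat k * omega n (J \<beta> \<gamma> \<delta> l m)"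
    if "\<beta> \<in> weak_compositions 5 b" "\<gamma> \<in> weak_compositions 4 c" "\<delta> \<in> weak_compositions 4 d"
      "l \<in> {0..\<beta> 2 + \<beta> 3}" "m \<in> {0..\<gamma> 1 + \<gamma> 2}" for k \<beta> \<gamma> \<delta> l m
  proof -
    have sets: "{1..4} - {1} = {2, 3, 4::nat}" "{1..4} - {2} = {1, 3, 4::nat}"
      "{1..4} - {3} = {1, 2, 4::nat}" "{1..4} - {4} = {1, 2, 3::nat}"
      by auto
    have sums: "sum f {1..4} = f 1 + f 2 + f 3 + f 4" "sum f {1..5} = f 1 + f 2 + f 3 + f 4 + f 5"
      for f :: "nat \<Rightarrow> nat" by (simp_all add: eval_nat_numeral)
    have "b = \<beta> 1 + \<beta> 2 + \<beta> 3 + \<beta> 4 + \<beta> 5" "c = \<gamma> 1 + \<gamma> 2 + \<gamma> 3 + \<gamma> 4" "d = \<delta> 1 + \<delta> 2 + \<delta> 3 + \<delta> 4"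
      using that(1-3) unfolding weak_compositions_def sums by auto
    \<comment> \<open>The degree condition enters here: the entries of \<open>J\<close> add up to 10
      + 2b + 2c + 3d - \<beta> 1.\<close>
    then have "4 * n + 10 - sum_list (J \<beta> \<gamma> \<delta> l m) = a + \<beta> 1"
      unfolding J_def sets using assms that(4,5) by simp
    moreover have "\<forall>j\<in>set (J \<beta> \<gamma> \<delta> l m). 1 \<le> j"
      unfolding J_def list.set using that(4,5) by simp
    moreover have "length (J \<beta> \<gamma> \<delta> l m) = 4" by (simp add: J_def)
    ultimately have "omega n (J \<beta> \<gamma> \<delta> l m) = grassmannian_integral n (T \<beta> \<gamma> \<delta> l m)"
      using omega_eq_integral[of "J \<beta> \<gamma> \<delta> l m" n] unfolding T_def by (simp only:)
    then show ?thesis by (simp only: grassmannian_integral_of_nat_mult)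
  qed
  have "f_number n a b c d =
    (\<Sum>\<beta> \<in> weak_compositions 5 b. \<Sum>\<gamma> \<in> weak_compositions 4 c. \<Sum>\<delta> \<in> weak_compositions 4 d.
     \<Sum>l = 0..\<beta> 2 + \<beta> 3. \<Sum>m = 0..\<gamma> 1 + \<gamma> 2.
       grassmannian_integral n (\<lambda>u. of_nat (K \<beta> \<gamma> \<delta> l m) * T \<beta> \<gamma> \<delta> l m u))"
    unfolding f_number_def pointwise
    \<comment> \<open>Each round exchanges the integral with one of the five nested sums.\<close>
    by (((subst grassmannian_integral_sum[of _ "chart_coframe n"], intro constant_family_sum const_T),
        intro sum.cong refl)+)
  also have "\<dots> = (\<Sum>\<beta> \<in> weak_compositions 5 b. \<Sum>\<gamma> \<in> weak_compositions 4 c. \<Sum>\<delta> \<in> weak_compositions 4 d.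
     \<Sum>l = 0..\<beta> 2 + \<beta> 3. \<Sum>m = 0..\<gamma> 1 + \<gamma> 2. of_nat (K \<beta> \<gamma> \<delta> l m) * omega n (J \<beta> \<gamma> \<delta> l m))"
    by (intro sum.cong refl omega)
  finally show ?thesis unfolding J_def K_def .
qed

end
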